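(* Let $T$ be a countable complete first-order theory with monster model $\mathcal U$, let $\phi(x;y)$ be an NIP formula and let $M \prec \mathcal U$ be a countable model of $T$. (1) Let $p\in S_\phi(\mathcal U)$ be a global $M$-invariant $\phi$-type. Then $p$ is Borel-definable; more precisely, the set $$\{q\in S_y(M) : p\vdash \phi(x;b) \text{ for } b\in q(\mathcal U)\}$$ is both an $F_\sigma$ and a $G_\delta$ subset of $S_y(M)$. (2) The set $\mathrm{Inv}_\phi(M)$ of global $M$-invariant $\phi$-types (with the topology induced from $S_\phi(\mathcal U)$) is a Rosenthal compactum. In particular: if $Z\subseteq S_\phi(\mathcal U)$ is a family of $M$-invariant $\phi$-types and $p\in \overline Z$ (the topological closure of $Z$), then $p$ is the limit of a sequence of elements of $Z$.
   Context: $\mathcal U$ is a monster model of $T$ (sufficiently saturated and strongly homogeneous), and $M$ is a small elementary submodel. $x$ and $y$ are finite tuples of variables. A formula $\phi(x;y)$ is NIP if there do not exist, in $\mathcal U$, an infinite set $A$ of $|x|$-tuples and, for each $I\subseteq A$, a $|y|$-tuple $b_I$ such that for all $a\in A$: $\mathcal U\models \phi(a;b_I) \iff a\in I$. $S_y(M)$ is the space of complete types over $M$ in the variable $y$, with its usual (Stone) topology; $q(\mathcal U)$ is the set of realizations of $q$ in $\mathcal U$. $S_\phi(\mathcal U)$ is the space of global $\phi$-types, i.e. maximal consistent sets of formulas of the form $\phi(x;b)$ or $\neg\phi(x;b)$, $b\in\mathcal U$, with the topology generated by the sets $\{p : \phi(x;b)\in p\}$ and $\{p:\neg\phi(x;b)\in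 p\}$. A global $\phi$-type $p$ is $M$-invariant if whenever $b,b'\in\mathcal U$ have the same type over $M$, $p\vdash\phi(x;b)$ if and only if $p\vdash \phi(x;b')$. (So for $M$-invariant $p$, whether $p\vdash\phi(x;b)$ depends only on $\mathrm{tp}(b/M)$.) For a Polish space $X$, a function $f:X\to\mathbb R$ is of Baire class 1 if it is the pointwise limit of a sequence of continuous functions; $B_1(X)$ is the set of these functions with the topology of pointwise convergence (induced from $\mathbb R^X$). A compact Hausdorff space $K$ is a Rosenthal compactum if it can be embedded (homeomorphically onto its image) in $B_1(X)$ for some Polish space $X$. *)

theory Defs
  imports "HOL-Analysis.Analysis"
begin

section \<open>First-order logic\<close>

text \<open>
  Languages are carried by sets of symbols, so that a language may lack function or relation
  symbols altogether. Constants are function symbols of arity 0; equality is logical.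
\<close>

record ('f, 'r) language =
  Funs :: "'f set"
  Rels :: "'r set"
  farity :: "'f \<Rightarrow> nat"
  rarity :: "'r \<Rightarrow> nat"

definition countable_language :: "('f, 'r) language \<Rightarrow> bool" where
  "countable_language L \<longleftrightarrow> countable (Funs L) \<and> countable (Rels L)"

datatype 'f tm = Var nat | Fn 'f "'f tm list"

datatype ('f, 'r) fm =
    Eq "'f tm" "'f tm"
  | Rel 'r "'f tm list"
  | Neg "('f, 'r) fm"
  | And "('f, 'r) fm" "('f, 'r) fm"
  | Ex nat "('f, 'r) fm"

fun tm_vars :: "'f tm \<Rightarrow> nat set" where
  "tm_vars (Var n) = {n}"
| "tm_vars (Fn f ts) = \<Union> (tm_vars ` set ts)"

fun wf_tm :: "('f, 'r) language \<Rightarrow> 'f tm \<Rightarrow> bool" where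
  "wf_tm L (Var n) \<longleftrightarrow> True"
| "wf_tm L (Fn f ts) \<longleftrightarrow> f \<in> Funs L \<and> length ts = farity L f \<and> (\<forall>t\<in>set ts. wf_tm L t)"

primrec fv :: "('f, 'r) fm \<Rightarrow> nat set" where
  "fv (Eq s t) = tm_vars s \<union> tm_vars t"
| "fv (Rel R ts) = \<Union> (tm_vars ` set ts)"
| "fv (Neg \<phi>) = fv \<phi>"
| "fv (And \<phi> \<psi>) = fv \<phi> \<union> fv \<psi>"
| "fv (Ex n \<phi>) = fv \<phi> - {n}"

primrec wf_fm :: "('f, 'r) language \<Rightarrow> ('f, 'r) fm \<Rightarrow> bool" where
  "wf_fm L (Eq s t) \<longleftrightarrow> wf_tm L s \<and> wf_tm L t"
| "wf_fm L (Rel R ts) \<longleftrightarrow> R \<in> Rels L \<and> length ts = rarity L R \<and> (\<forall>t\<in>set ts. wf_tm L t)"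
| "wf_fm L (Neg \<phi>) \<longleftrightarrow> wf_fm L \<phi>"
| "wf_fm L (And \<phi> \<psi>) \<longleftrightarrow> wf_fm L \<phi> \<and> wf_fm L \<psi>"
| "wf_fm L (Ex n \<phi>) \<longleftrightarrow> wf_fm L \<phi>"

definition formulas :: "('f, 'r) language \<Rightarrow> nat set \<Rightarrow> ('f, 'r) fm set" where
  "formulas L V = {\<phi>. wf_fm L \<phi> \<and> fv \<phi> \<subseteq> V}"

abbreviation sentences :: "('f, 'r) language \<Rightarrow> ('f, 'r) fm set" where
  "sentences L \<equiv> formulas L {}"

record ('f, 'r, 'a) struc =
  Dom :: "'a set"
  fint :: "'f \<Rightarrow> 'a list \<Rightarrow> 'a"
  rint :: "'r \<Rightarrow> 'a list \<Rightarrow> bool"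

definition tuples :: "('f, 'r, 'a) struc \<Rightarrow> nat \<Rightarrow> 'a list set" where
  "tuples N n = {as. length as = n \<and> set as \<subseteq> Dom N}"

definition is_struc :: "('f, 'r) language \<Rightarrow> ('f, 'r, 'a) struc \<Rightarrow> bool" where
  "is_struc L N \<longleftrightarrow> Dom N \<noteq> {} \<and>
     (\<forall>f\<in>Funs L. \<forall>as\<in>tuples N (farity L f). fint N f as \<in> Dom N)"

primrec eval_tm :: "('f, 'r, 'a) struc \<Rightarrow> (nat \<Rightarrow> 'a) \<Rightarrow> 'f tm \<Rightarrow> 'a" where
  "eval_tm N v (Var n) = v n"
| "eval_tm N v (Fn f ts) = fint N f (map (eval_tm N v) ts)"

primrec sat :: "('f, 'r, 'a) struc \<Rightarrow> (nat \<Rightarrow> 'a) \<Rightarrow> ('f, 'r) fm \<Rightarrow> bool" where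
  "sat N v (Eq s t) \<longleftrightarrow> eval_tm N v s = eval_tm N v t"
| "sat N v (Rel R ts) \<longleftrightarrow> rint N R (map (eval_tm N v) ts)"
| "sat N v (Neg \<phi>) \<longleftrightarrow> \<not> sat N v \<phi>"
| "sat N v (And \<phi> \<psi>) \<longleftrightarrow> sat N v \<phi> \<and> sat N v \<psi>"
| "sat N v (Ex n \<phi>) \<longleftrightarrow> (\<exists>a\<in>Dom N. sat N (v(n := a)) \<phi>)"

text \<open>
  The assignment sending the variables \<open>xs\<close> to the tuple \<open>as\<close>; its values elsewhere are
  irrelevant, because it is only applied to formulas whose free variables are among \<open>xs\<close>.
\<close>

definition asg :: "nat list \<Rightarrow> 'a list \<Rightarrow> nat \<Rightarrow> 'a" where
  "asg xs as = the \<circ> map_of (zip xs as)"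

definition is_model :: "('f, 'r) language \<Rightarrow> ('f, 'r) fm set \<Rightarrow> ('f, 'r, 'a) struc \<Rightarrow> bool" where
  "is_model L T N \<longleftrightarrow> is_struc L N \<and> (\<forall>\<sigma>\<in>T. \<forall>v. sat N v \<sigma>)"

text \<open>
  Semantic consequence has to range over models carried by one fixed type. The type of formulas
  is infinite and at least as large as the language, so by downward Loewenheim-Skolem
  every model is elementarily equivalent to one carried by a subset of this type, and
  nothing is lost.
\<close>

definition satisfiable :: "('f, 'r) language \<Rightarrow> ('f, 'r) fm set \<Rightarrow> bool" where
  "satisfiable L T \<longleftrightarrow> (\<exists>N :: ('f, 'r, ('f, 'r) fm) struc. is_model L T N)"

definition entails :: "('f, 'r) language \<Rightarrow> ('f, 'r) fm set \<Rightarrow> ('f, 'r) fm \<Rightarrow> bool" where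
  "entails L T \<sigma> \<longleftrightarrow>
     (\<forall>N :: ('f, 'r, ('f, 'r) fm) struc. is_model L T N \<longrightarrow> is_model L {\<sigma>} N)"

definition complete_theory :: "('f, 'r) language \<Rightarrow> ('f, 'r) fm set \<Rightarrow> bool" where
  "complete_theory L T \<longleftrightarrow> T \<subseteq> sentences L \<and> satisfiable L T \<and>
     (\<forall>\<sigma>\<in>sentences L. entails L T \<sigma> \<or> entails L T (Neg \<sigma>))"

definition elementary_submodel ::
    "('f, 'r) language \<Rightarrow> ('f, 'r, 'a) struc \<Rightarrow> ('f, 'r, 'a) struc \<Rightarrow> bool" where
  "elementary_submodel L M N \<longleftrightarrow> is_struc L M \<and> is_struc L N \<and> Dom M \<subseteq> Dom N \<and>
     (\<forall>f\<in>Funs L. \<forall>as\<in>tuples M (farity L f). fint M f as = fint N f as) \<and>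
     (\<forall>R\<in>Rels L. \<forall>as\<in>tuples M (rarity L R). rint M R as = rint N R as) \<and>
     (\<forall>\<phi>\<in>formulas L UNIV. \<forall>v. v ` fv \<phi> \<subseteq> Dom M \<longrightarrow> sat M v \<phi> = sat N v \<phi>)"


section \<open>Parameters and types\<close>

text \<open>
  The language \<open>L(A)\<close>: a constant symbol \<open>Inr a\<close> is added for each \<open>a \<in> A\<close>. A single expansion
  \<open>with_params N\<close> interprets all of these languages, for every \<open>A \<subseteq> Dom N\<close>.
\<close>

definition lang_params :: "('f, 'r) language \<Rightarrow> 'a set \<Rightarrow> ('f + 'a, 'r) language" where
  "lang_params L A = \<lparr>Funs = Inl ` Funs L \<union> Inr ` A, Rels = Rels L,
     farity = case_sum (farity L) (\<lambda>_. 0), rarity = rarity L\<rparr>"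

definition with_params :: "('f, 'r, 'a) struc \<Rightarrow> ('f + 'a, 'r, 'a) struc" where
  "with_params N = \<lparr>Dom = Dom N, fint = case_sum (fint N) (\<lambda>a _. a), rint = rint N\<rparr>"

text \<open>Substitution of parameters for free variables; parameters are closed, so nothing is captured.\<close>

primrec tm_plug :: "(nat \<Rightarrow> 'a option) \<Rightarrow> 'f tm \<Rightarrow> ('f + 'a) tm" where
  "tm_plug \<sigma> (Var n) = (case \<sigma> n of None \<Rightarrow> Var n | Some a \<Rightarrow> Fn (Inr a) [])"
| "tm_plug \<sigma> (Fn f ts) = Fn (Inl f) (map (tm_plug \<sigma>) ts)"

primrec fm_plug :: "(nat \<Rightarrow> 'a option) \<Rightarrow> ('f, 'r) fm \<Rightarrow> ('f + 'a, 'r) fm" where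
  "fm_plug \<sigma> (Eq s t) = Eq (tm_plug \<sigma> s) (tm_plug \<sigma> t)"
| "fm_plug \<sigma> (Rel R ts) = Rel R (map (tm_plug \<sigma>) ts)"
| "fm_plug \<sigma> (Neg \<phi>) = Neg (fm_plug \<sigma> \<phi>)"
| "fm_plug \<sigma> (And \<phi> \<psi>) = And (fm_plug \<sigma> \<phi>) (fm_plug \<sigma> \<psi>)"
| "fm_plug \<sigma> (Ex n \<phi>) = Ex n (fm_plug (\<sigma>(n := None)) \<phi>)"

text \<open>The formula \<open>\<phi>(x;b)\<close>, where \<open>b\<close> is plugged in for the variables \<open>ys\<close>.\<close>

definition inst :: "('f, 'r) fm \<Rightarrow> nat list \<Rightarrow> 'a list \<Rightarrow> ('f + 'a, 'r) fm" where
  "inst \<phi> ys b = fm_plug (map_of (zip ys b)) \<phi>"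

text \<open>
  Consistency of a set of formulas with parameters is meant modulo the elementary diagram of
  the ambient structure, that is, finite satisfiability in it.
\<close>

definition fin_sat :: "('f, 'r, 'a) struc \<Rightarrow> nat list \<Rightarrow> ('f + 'a, 'r) fm set \<Rightarrow> bool" where
  "fin_sat N xs \<Gamma> \<longleftrightarrow> (\<forall>F. finite F \<and> F \<subseteq> \<Gamma> \<longrightarrow>
     (\<exists>a\<in>tuples N (length xs). \<forall>\<psi>\<in>F. sat (with_params N) (asg xs a) \<psi>))"

definition max_consistent ::
    "('f, 'r, 'a) struc \<Rightarrow> nat list \<Rightarrow> ('f + 'a, 'r) fm set \<Rightarrow> ('f + 'a, 'r) fm set set" where
  "max_consistent N xs \<Delta> = {p. p \<subseteq> \<Delta> \<and> fin_sat N xs p \<and>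
     (\<forall>p'. p' \<subseteq> \<Delta> \<and> fin_sat N xs p' \<and> p \<subseteq> p' \<longrightarrow> p' = p)}"

definition realizations ::
    "('f, 'r, 'a) struc \<Rightarrow> nat list \<Rightarrow> ('f + 'a, 'r) fm set \<Rightarrow> 'a list set" where
  "realizations N xs q =
     {a \<in> tuples N (length xs). \<forall>\<psi>\<in>q. sat (with_params N) (asg xs a) \<psi>}"

text \<open>\<open>p \<turnstile> \<psi>\<close>, for a set \<open>p\<close> of formulas with parameters, modulo the elementary diagram of \<open>N\<close>.\<close>

definition proves ::
    "('f, 'r, 'a) struc \<Rightarrow> nat list \<Rightarrow> ('f + 'a, 'r) fm set \<Rightarrow> ('f + 'a, 'r) fm \<Rightarrow> bool" where
  "proves N xs p \<psi> \<longleftrightarrow> (\<exists>F. finite F \<and> F \<subseteq> p \<and>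
     (\<forall>a\<in>tuples N (length xs). (\<forall>\<theta>\<in>F. sat (with_params N) (asg xs a) \<theta>) \<longrightarrow>
        sat (with_params N) (asg xs a) \<psi>))"

text \<open>\<open>tp(b/A)\<close> and \<open>S\<^sub>y(A)\<close>, computed in the ambient structure \<open>N\<close>.\<close>

definition tp ::
    "('f, 'r) language \<Rightarrow> ('f, 'r, 'a) struc \<Rightarrow> 'a set \<Rightarrow> nat list \<Rightarrow> 'a list \<Rightarrow> ('f + 'a, 'r) fm set" where
  "tp L N A ys b =
     {\<psi> \<in> formulas (lang_params L A) (set ys). sat (with_params N) (asg ys b) \<psi>}"

definition complete_types ::
    "('f, 'r) language \<Rightarrow> ('f, 'r, 'a) struc \<Rightarrow> 'a set \<Rightarrow> nat list \<Rightarrow> ('f + 'a, 'r) fm set set" where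
  "complete_types L N A ys = max_consistent N ys (formulas (lang_params L A) (set ys))"

definition stone_topology ::
    "('f, 'r) language \<Rightarrow> ('f, 'r, 'a) struc \<Rightarrow> 'a set \<Rightarrow> nat list \<Rightarrow> ('f + 'a, 'r) fm set topology" where
  "stone_topology L N A ys = topology_generated_by
     ((\<lambda>\<psi>. {q \<in> complete_types L N A ys. \<psi> \<in> q}) ` formulas (lang_params L A) (set ys))"


section \<open>Monster models\<close>

unbundle cardinal_syntax

definition saturated :: "('f, 'r) language \<Rightarrow> 'k rel \<Rightarrow> ('f, 'r, 'a) struc \<Rightarrow> bool" where
  "saturated L \<kappa> N \<longleftrightarrow> (\<forall>A zs. A \<subseteq> Dom N \<and> |A| <o \<kappa> \<and> distinct zs \<longrightarrow>
     (\<forall>q\<in>complete_types L N A zs. realizations N zs q \<noteq> {}))"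

definition partial_elementary ::
    "('f, 'r) language \<Rightarrow> ('f, 'r, 'a) struc \<Rightarrow> 'a set \<Rightarrow> ('a \<Rightarrow> 'a) \<Rightarrow> bool" where
  "partial_elementary L N A h \<longleftrightarrow> h ` A \<subseteq> Dom N \<and>
     (\<forall>\<phi>\<in>formulas L UNIV. \<forall>v. v ` fv \<phi> \<subseteq> A \<longrightarrow> sat N v \<phi> = sat N (h \<circ> v) \<phi>)"

definition automorphism :: "('f, 'r) language \<Rightarrow> ('f, 'r, 'a) struc \<Rightarrow> ('a \<Rightarrow> 'a) \<Rightarrow> bool" where
  "automorphism L N g \<longleftrightarrow> bij_betw g (Dom N) (Dom N) \<and>
     (\<forall>f\<in>Funs L. \<forall>as\<in>tuples N (farity L f). g (fint N f as) = fint N f (map g as)) \<and>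
     (\<forall>R\<in>Rels L. \<forall>as\<in>tuples N (rarity L R). rint N R as = rint N R (map g as))"

definition strongly_homogeneous :: "('f, 'r) language \<Rightarrow> 'k rel \<Rightarrow> ('f, 'r, 'a) struc \<Rightarrow> bool" where
  "strongly_homogeneous L \<kappa> N \<longleftrightarrow>
     (\<forall>A h. A \<subseteq> Dom N \<and> |A| <o \<kappa> \<and> partial_elementary L N A h \<longrightarrow>
        (\<exists>g. automorphism L N g \<and> (\<forall>a\<in>A. g a = h a)))"

text \<open>
  The cardinal \<open>\<kappa>\<close> bounds the small sets. It is required to be uncountable, so that countable
  submodels are small; otherwise it is arbitrary.
\<close>

definition monster_model ::
    "('f, 'r) language \<Rightarrow> ('f, 'r) fm set \<Rightarrow> 'k rel \<Rightarrow> ('f, 'r, 'a) struc \<Rightarrow> bool" where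
  "monster_model L T \<kappa> U \<longleftrightarrow> is_model L T U \<and> Card_order \<kappa> \<and> natLeq <o \<kappa> \<and>
     saturated L \<kappa> U \<and> strongly_homogeneous L \<kappa> U"


section \<open>NIP formulas and \<open>\<phi>\<close>-types\<close>

definition NIP :: "('f, 'r, 'a) struc \<Rightarrow> ('f, 'r) fm \<Rightarrow> nat list \<Rightarrow> nat list \<Rightarrow> bool" where
  "NIP U \<phi> xs ys \<longleftrightarrow> \<not> (\<exists>A b. infinite A \<and> A \<subseteq> tuples U (length xs) \<and>
     (\<forall>I. I \<subseteq> A \<longrightarrow> b I \<in> tuples U (length ys) \<and>
        (\<forall>a\<in>A. sat U (asg (xs @ ys) (a @ b I)) \<phi> \<longleftrightarrow> a \<in> I)))"

definition phi_formulas ::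
    "('f, 'r, 'a) struc \<Rightarrow> ('f, 'r) fm \<Rightarrow> nat list \<Rightarrow> ('f + 'a, 'r) fm set" where
  "phi_formulas U \<phi> ys = (\<Union>b\<in>tuples U (length ys). {inst \<phi> ys b, Neg (inst \<phi> ys b)})"

definition phi_types ::
    "('f, 'r, 'a) struc \<Rightarrow> ('f, 'r) fm \<Rightarrow> nat list \<Rightarrow> nat list \<Rightarrow> ('f + 'a, 'r) fm set set" where
  "phi_types U \<phi> xs ys = max_consistent U xs (phi_formulas U \<phi> ys)"

definition phi_topology ::
    "('f, 'r, 'a) struc \<Rightarrow> ('f, 'r) fm \<Rightarrow> nat list \<Rightarrow> nat list \<Rightarrow> ('f + 'a, 'r) fm set topology" where
  "phi_topology U \<phi> xs ys = topology_generated_by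
     ((\<lambda>\<psi>. {p \<in> phi_types U \<phi> xs ys. \<psi> \<in> p}) ` phi_formulas U \<phi> ys)"

text \<open>\<open>Inv\<^sub>\<phi>(A)\<close>, the global \<open>\<phi>\<close>-types that are invariant over \<open>A\<close>.\<close>

definition inv_phi_types ::
    "('f, 'r) language \<Rightarrow> ('f, 'r, 'a) struc \<Rightarrow> 'a set \<Rightarrow> ('f, 'r) fm \<Rightarrow> nat list \<Rightarrow> nat list
      \<Rightarrow> ('f + 'a, 'r) fm set set" where
  "inv_phi_types L U A \<phi> xs ys = {p \<in> phi_types U \<phi> xs ys.
     \<forall>b\<in>tuples U (length ys). \<forall>b'\<in>tuples U (length ys). tp L U A ys b = tp L U A ys b' \<longrightarrow>
       (proves U xs p (inst \<phi> ys b) \<longleftrightarrow> proves U xs p (inst \<phi> ys b'))}"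

text \<open>
  The set of \<open>q \<in> S\<^sub>y(A)\<close> such that \<open>p \<turnstile> \<phi>(x;b)\<close> for \<open>b \<in> q(U)\<close>. For \<open>p\<close> invariant over a small set
  \<open>A\<close>, it does not matter whether \<open>b\<close> is quantified universally or existentially here.
\<close>

definition defining_set ::
    "('f, 'r) language \<Rightarrow> ('f, 'r, 'a) struc \<Rightarrow> 'a set \<Rightarrow> ('f, 'r) fm \<Rightarrow> nat list \<Rightarrow> nat list
      \<Rightarrow> ('f + 'a, 'r) fm set \<Rightarrow> ('f + 'a, 'r) fm set set" where
  "defining_set L U A \<phi> xs ys p = {q \<in> complete_types L U A ys.
     \<forall>b\<in>realizations U ys q. proves U xs p (inst \<phi> ys b)}"

definition borel_definable ::
    "('f, 'r) language \<Rightarrow> ('f, 'r, 'a) struc \<Rightarrow> 'a set \<Rightarrow> ('f, 'r) fm \<Rightarrow> nat list \<Rightarrow> nat list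
      \<Rightarrow> ('f + 'a, 'r) fm set \<Rightarrow> bool" where
  "borel_definable L U A \<phi> xs ys p \<longleftrightarrow> defining_set L U A \<phi> xs ys p \<in>
     sigma_sets (complete_types L U A ys) {V. openin (stone_topology L U A ys) V}"


section \<open>Rosenthal compacta\<close>

definition polish_topology :: "'a topology \<Rightarrow> bool" where
  "polish_topology X \<longleftrightarrow> completely_metrizable_space X \<and> separable_space X"

definition baire_one :: "'a topology \<Rightarrow> ('a \<Rightarrow> real) set" where
  "baire_one X = {f \<in> extensional (topspace X). \<exists>g :: nat \<Rightarrow> 'a \<Rightarrow> real.
     (\<forall>n. continuous_map X euclideanreal (g n)) \<and>
     (\<forall>x\<in>topspace X. (\<lambda>n. g n x) \<longlonglongrightarrow> f x)}"

definition baire_one_topology :: "'a topology \<Rightarrow> ('a \<Rightarrow> real) topology" where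
  "baire_one_topology X = subtopology (powertop_real (topspace X)) (baire_one X)"

text \<open>
  A Polish space has at most continuum many points, so up to homeomorphism every Polish space
  is a topology on a subset of the type \<open>nat \<Rightarrow> real\<close>; the topology \<open>X\<close> is unrelated
  to the usual topology of that type.
\<close>

definition rosenthal_compactum :: "'a topology \<Rightarrow> bool" where
  "rosenthal_compactum K \<longleftrightarrow> compact_space K \<and> Hausdorff_space K \<and>
     (\<exists>(X :: (nat \<Rightarrow> real) topology) e.
        polish_topology X \<and> embedding_map K (baire_one_topology X) e)"

end

theory Submission
  imports Defs
begin

text \<open>
  Fix an invariant \<open>\<phi>\<close>-type \<open>p\<close> and call \<open>p \<turnstile> \<phi>(x;b)\<close>, as a property of \<open>q = tp(b/M)\<close>, the value
  of \<open>p\<close> at \<open>q\<close>. Three facts carry the theorem, and each reduces to one combinatorial form of NIP: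
  for some \<open>d\<close> no \<open>d\<close> tuples are shattered by \<open>\<phi>\<close> (\<open>shattering_bounded\<close>). The definition of NIP
  forbids only an infinite shattered family, so compactness is needed to get this bound.

  \<^item> The value of \<open>p\<close> is never dense and codense on a nonempty set \<open>F\<close> of types
    (\<open>not_dense_codense\<close>). Otherwise one builds tuples \<open>a\<^sub>0, a\<^sub>1, \<dots>\<close> such that every \<open>q \<in> F\<close> has
    realizations with every pattern against \<open>a\<^sub>0, \<dots>, a\<^sub>n\<close>: the next tuple realizes \<open>p\<close> over
    countably many realizations of types in \<open>F\<close> of both values, and since each \<open>q \<in> F\<close> is a limit
    of types of either value, saturation gives realizations of \<open>q\<close> with either value against the
    new tuple. That contradicts the bound. By an exhaustion argument over the countably many basic
    clopen sets, the set defined by \<open>p\<close> is both \<open>F\<^sub>\<sigma>\<close> and \<open>G\<^sub>\<delta>\<close>, so its indicator is of the first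
    Baire class, and \<open>p \<mapsto> indicator\<close> embeds the compact space of invariant types.

  \<^item> If \<open>p\<close> is in the closure of \<open>Z\<close>, it is in the closure of a countable part of \<open>Z\<close>
    (\<open>countable_tightness\<close>). This is a topological consequence of the first fact, applied to finite
    powers of \<open>S\<^sub>y(M)\<close>: if no countable part of \<open>Z\<close> suffices, an accumulation point \<open>g\<close> of a
    sequence in \<open>Z\<close> agrees with \<open>p\<close> on a dense and codense subset of some closed set, against
    the Baire category theorem.

  \<^item> If \<open>p\<close> is in the closure of a countable \<open>Z\<close>, it is the limit of a sequence in \<open>Z\<close>
    (\<open>convergent_sequence_if_not_shattering\<close>). Choose an ultrafilter on \<open>Z\<close> converging to \<open>p\<close>.
    Since \<open>d\<close> types are never shattered, some pattern \<open>S\<close> is not realized by \<open>g\<^sub>0, \<dots>, g\<^sub>d\<^sub>-\<^sub>1\<close>, for most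
    \<open>g\<^sub>0\<close>, then most \<open>g\<^sub>1\<close>, and so on, "most" meaning in a set of the ultrafilter. Only countably many
    such sets occur, because the earlier types range over finite sequences from \<open>Z\<close>. At every point
    one of them consists of types with the value of \<open>p\<close> there: if all contained a type with the
    other value, the missing pattern could be realized at that point one coordinate at a time.
    A sequence that enters each of these countably many sets for good converges to \<open>p\<close>.
\<close>

section \<open>Satisfaction and plugged-in parameters\<close>

lemma eval_tm_cong: "(\<And>n. n \<in> tm_vars t \<Longrightarrow> v n = w n) \<Longrightarrow> eval_tm N v t = eval_tm N w t"
proof (induction t)
  case (Fn f ts)
  then have "map (eval_tm N v) ts = map (eval_tm N w) ts" by (auto intro!: map_cong)
  then show ?case by (simp del: map_eq_conv)
qed simp

lemma sat_cong:
  assumes "\<And>n. n \<in> fv \<psi> \<Longrightarrow> v n = w n"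
  shows "sat N v \<psi> = sat N w \<psi>"
  using assms
proof (induction \<psi> arbitrary: v w)
  case (Eq s t)
  have "eval_tm N v s = eval_tm N w s" "eval_tm N v t = eval_tm N w t"
    using Eq by (auto intro!: eval_tm_cong)
  then show ?case by simp
next
  case (Rel R ts)
  have "map (eval_tm N v) ts = map (eval_tm N w) ts"
    by (rule map_cong[OF refl], rule eval_tm_cong) (use Rel in auto)
  then show ?case by (simp del: map_eq_conv)
next
  case (Neg \<psi>)
  have "sat N v \<psi> = sat N w \<psi>" by (rule Neg.IH, use Neg.prems in simp)
  then show ?case by simp
next
  case (And \<psi>1 \<psi>2)
  have "sat N v \<psi>1 = sat N w \<psi>1" "sat N v \<psi>2 = sat N w \<psi>2"
    by (rule And.IH, use And.prems in simp)+
  then show ?case by simp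
next
  case (Ex n \<psi>)
  have "sat N (v(n := a)) \<psi> = sat N (w(n := a)) \<psi>" for a
    by (rule Ex.IH) (use Ex.prems in auto)
  then show ?case by simp
qed

lemma eval_tm_plug:
  "eval_tm (with_params N) v (tm_plug \<sigma> t)
     = eval_tm N (\<lambda>n. case \<sigma> n of None \<Rightarrow> v n | Some a \<Rightarrow> a) t"
proof (induction t)
  case (Var n)
  then show ?case by (simp add: with_params_def split: option.split)
next
  case (Fn f ts)
  then have "map (eval_tm (with_params N) v \<circ> tm_plug \<sigma>) ts
      = map (eval_tm N (\<lambda>n. case \<sigma> n of None \<Rightarrow> v n | Some a \<Rightarrow> a)) ts" by auto
  then show ?case by (simp add: with_params_def del: map_eq_conv)
qed

lemma sat_fm_plug:
  "sat (with_params N) v (fm_plug \<sigma> \<psi>)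
     = sat N (\<lambda>n. case \<sigma> n of None \<Rightarrow> v n | Some a \<Rightarrow> a) \<psi>"
proof (induction \<psi> arbitrary: \<sigma> v)
  case (Rel R ts)
  have "map (eval_tm (with_params N) v \<circ> tm_plug \<sigma>) ts
      = map (eval_tm N (\<lambda>n. case \<sigma> n of None \<Rightarrow> v n | Some a \<Rightarrow> a)) ts"
    by (simp add: eval_tm_plug)
  then show ?case by (simp add: with_params_def del: map_eq_conv)
next
  case (Ex n \<psi>)
  have "(\<lambda>m. case (\<sigma>(n := None)) m of None \<Rightarrow> (v(n := a)) m | Some b \<Rightarrow> b)
      = (\<lambda>m. case \<sigma> m of None \<Rightarrow> v m | Some b \<Rightarrow> b)(n := a)" for a
    by (auto simp: fun_eq_iff split: option.split)
  then show ?case using Ex.IH by (simp add: with_params_def)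
qed (simp_all add: eval_tm_plug)

lemma tm_plug_in_lang:
  assumes "wf_tm L t" "ran \<sigma> \<subseteq> A"
  shows "wf_tm (lang_params L A) (tm_plug \<sigma> t)" "tm_vars (tm_plug \<sigma> t) = tm_vars t - dom \<sigma>"
  using assms
  by (induction t) (auto simp: lang_params_def ran_def split: option.split)

lemma fm_plug_in_lang:
  assumes "wf_fm L \<psi>" "ran \<sigma> \<subseteq> A"
  shows "wf_fm (lang_params L A) (fm_plug \<sigma> \<psi>) \<and> fv (fm_plug \<sigma> \<psi>) = fv \<psi> - dom \<sigma>"
  using assms
proof (induction \<psi> arbitrary: \<sigma>)
  case (Eq s t)
  then show ?case by (auto simp: tm_plug_in_lang)
next
  case (Rel R ts)
  then show ?case
  proof -
    have "wf_tm (lang_params L A) (tm_plug \<sigma> t)" "tm_vars (tm_plug \<sigma> t) = tm_vars t - dom \<sigma>"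
      if "t \<in> set ts" for t
      using that Rel(1) tm_plug_in_lang[OF _ Rel(2), of L t] by auto
    then show ?thesis using Rel by (simp add: lang_params_def)
  qed
next
  case (Ex n \<psi>)
  have "ran (\<sigma>(n := None)) \<subseteq> A" using Ex.prems by (auto simp: ran_def)
  with Ex show ?case by (auto simp: fun_upd_def)
qed auto

lemma asg_eq:
  assumes "distinct zs" "length as = length zs" "i < length zs"
  shows "asg zs as (zs ! i) = as ! i"
  using assms by (simp add: asg_def map_of_zip_nth)

text \<open>The truth of \<open>\<phi>(a;b)\<close> can be read as a property of \<open>a\<close> with \<open>b\<close> plugged in or the other way
  round; the arguments below constantly change sides.\<close>

lemma sat_inst:
  assumes "distinct (xs @ ys)" "fv \<phi> \<subseteq> set (xs @ ys)" "length a = length xs" "length b = length ys"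
  shows "sat (with_params U) (asg xs a) (inst \<phi> ys b) \<longleftrightarrow> sat U (asg (xs @ ys) (a @ b)) \<phi>"
    and "sat (with_params U) (asg ys b) (inst \<phi> xs a) \<longleftrightarrow> sat U (asg (xs @ ys) (a @ b)) \<phi>"
proof -
  have d: "dom (map_of (zip xs a)) = set xs" "dom (map_of (zip ys b)) = set ys"
    using assms(3,4) by simp_all
  have disj: "set xs \<inter> set ys = {}" using assms(1) by simp
  have *: "map_of (zip (xs @ ys) (a @ b)) = map_of (zip ys b) ++ map_of (zip xs a)"
    using assms(3,4) by simp
  have "(case map_of (zip ys b) n of None \<Rightarrow> asg xs a n | Some c \<Rightarrow> c) = asg (xs @ ys) (a @ b) n \<and>
    (case map_of (zip xs a) n of None \<Rightarrow> asg ys b n | Some c \<Rightarrow> c) = asg (xs @ ys) (a @ b) n"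
    if "n \<in> fv \<phi>" for n
  proof (cases "n \<in> set xs")
    case True
    then have "map_of (zip ys b) n = None" using d(2) disj by blast
    moreover obtain c where "map_of (zip xs a) n = Some c" using True d(1) by blast
    ultimately show ?thesis unfolding asg_def * by (simp add: map_add_def)
  next
    case False
    then have "map_of (zip xs a) n = None" using d(1) by blast
    moreover have "n \<in> dom (map_of (zip ys b))" unfolding d(2) using False that assms(2) by auto
    then obtain c where "map_of (zip ys b) n = Some c" by blast
    ultimately show ?thesis unfolding asg_def * by (simp add: map_add_def)
  qed
  then show "sat (with_params U) (asg xs a) (inst \<phi> ys b) \<longleftrightarrow> sat U (asg (xs @ ys) (a @ b)) \<phi>"
    and "sat (with_params U) (asg ys b) (inst \<phi> xs a) \<longleftrightarrow> sat U (asg (xs @ ys) (a @ b)) \<phi>"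
    unfolding inst_def sat_fm_plug by (auto intro!: sat_cong)
qed

lemma inst_in_formulas:
  assumes "\<phi> \<in> formulas L (set zs \<union> set ws)" "length b = length ws" "set b \<subseteq> A"
  shows "inst \<phi> ws b \<in> formulas (lang_params L A) (set zs)"
proof -
  have "ran (map_of (zip ws b)) \<subseteq> A"
    using assms(3) by (auto simp: ran_def dest!: map_of_SomeD set_zip_rightD)
  moreover have "dom (map_of (zip ws b)) = set ws" using assms(2) by simp
  ultimately show ?thesis
    using assms(1) fm_plug_in_lang[of L \<phi> "map_of (zip ws b)" A]
    by (auto simp: formulas_def inst_def)
qed

section \<open>Maximal consistent sets and saturation\<close>

text \<open>
  The set of \<open>\<phi>\<close>-formulas is not closed under negation, but each of its members has an equivalent
  of its negation in the set. Working with negation up to equivalence treats \<open>\<phi>\<close>-types and complete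
  types alike.
\<close>

definition complementary ::
    "('f, 'r, 'a) struc \<Rightarrow> nat list \<Rightarrow> ('f + 'a, 'r) fm \<Rightarrow> ('f + 'a, 'r) fm \<Rightarrow> bool" where
  "complementary N zs \<psi> \<eta> \<longleftrightarrow> (\<forall>a\<in>tuples N (length zs).
     sat (with_params N) (asg zs a) \<eta> \<longleftrightarrow> \<not> sat (with_params N) (asg zs a) \<psi>)"

lemma complementary_Neg [simp]:
  "complementary N zs \<psi> (Neg \<psi>)" "complementary N zs (Neg \<psi>) \<psi>"
  by (auto simp: complementary_def)

lemma fin_satE:
  assumes "fin_sat N zs p" "finite F" "F \<subseteq> p"
  obtains a where "a \<in> tuples N (length zs)" "\<And>\<theta>. \<theta> \<in> F \<Longrightarrow> sat (with_params N) (asg zs a) \<theta>"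
  using assms unfolding fin_sat_def by meson

lemma not_fin_satE:
  assumes "\<not> fin_sat N zs p"
  obtains F where "finite F" "F \<subseteq> p"
    "\<And>a. a \<in> tuples N (length zs) \<Longrightarrow> \<exists>\<theta>\<in>F. \<not> sat (with_params N) (asg zs a) \<theta>"
  using assms unfolding fin_sat_def by meson

lemma fin_sat_insert_cases:
  assumes "fin_sat N zs p" "complementary N zs \<psi> \<eta>"
  shows "fin_sat N zs (insert \<psi> p) \<or> fin_sat N zs (insert \<eta> p)"
proof (rule ccontr)
  assume "\<not> ?thesis"
  then have n: "\<not> fin_sat N zs (insert \<psi> p)" "\<not> fin_sat N zs (insert \<eta> p)" by auto
  obtain F where F: "finite F" "F \<subseteq> insert \<psi> p"
      "\<And>a. a \<in> tuples N (length zs) \<Longrightarrow> \<exists>\<theta>\<in>F. \<not> sat (with_params N) (asg zs a) \<theta>"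
    using not_fin_satE[OF n(1)] by metis
  obtain G where G: "finite G" "G \<subseteq> insert \<eta> p"
      "\<And>a. a \<in> tuples N (length zs) \<Longrightarrow> \<exists>\<theta>\<in>G. \<not> sat (with_params N) (asg zs a) \<theta>"
    using not_fin_satE[OF n(2)] by metis
  have "finite ((F - {\<psi>}) \<union> (G - {\<eta>}))" "(F - {\<psi>}) \<union> (G - {\<eta>}) \<subseteq> p" using F G by auto
  then obtain a where a: "a \<in> tuples N (length zs)"
     "\<And>\<theta>. \<theta> \<in> (F - {\<psi>}) \<union> (G - {\<eta>}) \<Longrightarrow> sat (with_params N) (asg zs a) \<theta>"
    using fin_satE[OF assms(1)] by metis
  obtain \<theta> \<theta>' where t: "\<theta> \<in> F" "\<not> sat (with_params N) (asg zs a) \<theta>"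
     "\<theta>' \<in> G" "\<not> sat (with_params N) (asg zs a) \<theta>'"
    using F(3)[OF a(1)] G(3)[OF a(1)] by auto
  have "\<theta> = \<psi>" "\<theta>' = \<eta>" using t a(2)[of \<theta>] a(2)[of \<theta>'] by auto
  then show False using t assms(2) a(1) by (simp add: complementary_def)
qed

lemma fin_sat_mono: "fin_sat N zs p \<Longrightarrow> q \<subseteq> p \<Longrightarrow> fin_sat N zs q"
  unfolding fin_sat_def by (meson subset_trans)

lemma not_both_complementary:
  assumes "fin_sat N zs p" "complementary N zs \<psi> \<eta>" "\<psi> \<in> p" shows "\<eta> \<notin> p"
proof
  assume "\<eta> \<in> p"
  then have "finite {\<psi>, \<eta>} \<and> {\<psi>, \<eta>} \<subseteq> p" using assms by auto
  then obtain a where "a \<in> tuples N (length zs)"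
      "sat (with_params N) (asg zs a) \<psi>" "sat (with_params N) (asg zs a) \<eta>"
    using fin_satE[OF assms(1)] by (metis insertI1 insertI2)
  then show False using assms(2) by (simp add: complementary_def)
qed

lemma max_consistent_decides:
  assumes "p \<in> max_consistent N zs \<Delta>" "\<psi> \<in> \<Delta>" "\<eta> \<in> \<Delta>" "complementary N zs \<psi> \<eta>"
  shows "\<eta> \<in> p \<longleftrightarrow> \<psi> \<notin> p"
proof -
  have p: "p \<subseteq> \<Delta>" "fin_sat N zs p" and
    m: "\<And>p'. p' \<subseteq> \<Delta> \<Longrightarrow> fin_sat N zs p' \<Longrightarrow> p \<subseteq> p' \<Longrightarrow> p' = p"
    using assms(1) by (auto simp: max_consistent_def)
  have "\<psi> \<in> p \<or> \<eta> \<in> p"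
    using fin_sat_insert_cases[OF p(2) assms(4)] m[of "insert \<psi> p"] m[of "insert \<eta> p"] p(1) assms(2,3)
    by blast
  then show ?thesis using not_both_complementary[OF p(2) assms(4)] by blast
qed

lemma max_consistentI:
  assumes "p \<subseteq> \<Delta>" "fin_sat N zs p"
    and "\<And>\<psi>. \<psi> \<in> \<Delta> \<Longrightarrow> \<psi> \<notin> p \<Longrightarrow> \<exists>\<eta>\<in>p. complementary N zs \<psi> \<eta>"
  shows "p \<in> max_consistent N zs \<Delta>"
proof -
  have "p' = p" if p': "p' \<subseteq> \<Delta>" "fin_sat N zs p'" "p \<subseteq> p'" for p'
  proof (rule ccontr)
    assume "p' \<noteq> p"
    then obtain \<psi> where "\<psi> \<in> p'" "\<psi> \<notin> p" using p' by blast
    then obtain \<eta> where "\<eta> \<in> p" "complementary N zs \<psi> \<eta>" using assms(3) p' by blast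
    then show False using not_both_complementary[OF p'(2)] p' \<open>\<psi> \<in> p'\<close> by blast
  qed
  then show ?thesis using assms by (auto simp: max_consistent_def)
qed

lemma extend_to_max_consistent:
  assumes "\<Gamma> \<subseteq> \<Delta>" "fin_sat N zs \<Gamma>"
  obtains p where "p \<in> max_consistent N zs \<Delta>" "\<Gamma> \<subseteq> p"
proof -
  let ?A = "{p. \<Gamma> \<subseteq> p \<and> p \<subseteq> \<Delta> \<and> fin_sat N zs p}"
  have "\<exists>m\<in>?A. \<forall>p\<in>?A. m \<subseteq> p \<longrightarrow> p = m"
  proof (rule subset_Zorn_nonempty)
    show "?A \<noteq> {}" using assms by auto
    fix \<C> assume ne: "\<C> \<noteq> {}" and C: "subset.chain ?A \<C>"
    have "fin_sat N zs (\<Union>\<C>)"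
      unfolding fin_sat_def
    proof (intro allI impI)
      fix F assume F: "finite F \<and> F \<subseteq> \<Union>\<C>"
      then obtain p where p: "p \<in> \<C>" "F \<subseteq> p"
        using finite_subset_Union_chain[of F \<C> ?A] C ne by metis
      then have "fin_sat N zs p" using C unfolding subset.chain_def by blast
      then show "\<exists>a\<in>tuples N (length zs). \<forall>\<psi>\<in>F. sat (with_params N) (asg zs a) \<psi>"
        using p F by (meson fin_satE)
    qed
    moreover have "\<Gamma> \<subseteq> \<Union>\<C>" "\<Union>\<C> \<subseteq> \<Delta>" using C ne unfolding subset.chain_def by blast+
    ultimately show "\<Union>\<C> \<in> ?A" by simp
  qed
  then obtain m where m: "m \<in> ?A" "\<forall>p\<in>?A. m \<subseteq> p \<longrightarrow> p = m" by (rule bexE)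
  from m(1) have "\<Gamma> \<subseteq> m" "m \<subseteq> \<Delta>" "fin_sat N zs m" by auto
  moreover have "p' = m" if "p' \<subseteq> \<Delta>" "fin_sat N zs p'" "m \<subseteq> p'" for p'
    using bspec[OF m(2), of p'] that \<open>\<Gamma> \<subseteq> m\<close> by simp
  ultimately show ?thesis using that[of m] by (simp add: max_consistent_def)
qed

lemma max_consistent_closed_under_entailment:
  assumes "p \<in> max_consistent N zs \<Delta>" "\<psi> \<in> \<Delta>" "finite F" "F \<subseteq> p"
    and "\<And>a. a \<in> tuples N (length zs) \<Longrightarrow> \<forall>\<theta>\<in>F. sat (with_params N) (asg zs a) \<theta> \<Longrightarrow>
           sat (with_params N) (asg zs a) \<psi>"
  shows "\<psi> \<in> p"
proof -
  have p: "p \<subseteq> \<Delta>" "fin_sat N zs p" and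
    m: "\<And>p'. p' \<subseteq> \<Delta> \<Longrightarrow> fin_sat N zs p' \<Longrightarrow> p \<subseteq> p' \<Longrightarrow> p' = p"
    using assms(1) by (auto simp: max_consistent_def)
  have "fin_sat N zs (insert \<psi> p)"
    unfolding fin_sat_def
  proof (intro allI impI)
    fix G assume "finite G \<and> G \<subseteq> insert \<psi> p"
    then have "finite ((G - {\<psi>}) \<union> F)" "(G - {\<psi>}) \<union> F \<subseteq> p" using assms by auto
    then obtain a where a: "a \<in> tuples N (length zs)"
      "\<And>\<theta>. \<theta> \<in> (G - {\<psi>}) \<union> F \<Longrightarrow> sat (with_params N) (asg zs a) \<theta>"
      using fin_satE[OF p(2)] by metis
    then have "sat (with_params N) (asg zs a) \<psi>" using assms(5)[of a] by simp
    then show "\<exists>a\<in>tuples N (length zs). \<forall>\<theta>\<in>G. sat (with_params N) (asg zs a) \<theta>"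
      using a by blast
  qed
  then show ?thesis using m[of "insert \<psi> p"] p assms(2) by blast
qed

lemma countable_imp_small:
  fixes A :: "'a set" assumes "natLeq <o \<kappa>" "countable A" shows "|A| <o \<kappa>"
proof -
  have "|A| \<le>o natLeq"
  proof -
    obtain f :: "'a \<Rightarrow> nat" where "inj_on f A" using assms(2) unfolding countable_def by blast
    then have "|A| \<le>o |UNIV :: nat set|" by (rule card_of_ordLeqI) simp
    then show ?thesis using card_of_nat by (rule ordLeq_ordIso_trans)
  qed
  then show ?thesis using assms(1) by (rule ordLeq_ordLess_trans)
qed

text \<open>Every countable set of parameters is small, because the cardinal of the monster model is
  uncountable; a partial type is realized by realizing a completion of it.\<close>

lemma monster_realizes:
  assumes "monster_model L T \<kappa> U" "A \<subseteq> Dom U" "countable A" "distinct zs"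
    and "\<Gamma> \<subseteq> formulas (lang_params L A) (set zs)" "fin_sat U zs \<Gamma>"
  obtains a where "a \<in> realizations U zs \<Gamma>"
proof -
  obtain q where q: "q \<in> complete_types L U A zs" "\<Gamma> \<subseteq> q"
    using extend_to_max_consistent[OF assms(5,6)] unfolding complete_types_def by blast
  have "|A| <o \<kappa>" using assms(1,3) countable_imp_small unfolding monster_model_def by blast
  then have "realizations U zs q \<noteq> {}"
    using assms(1,2,4) q(1) unfolding monster_model_def saturated_def by blast
  then show ?thesis using q(2) that unfolding realizations_def by blast
qed

section \<open>Shattering is bounded\<close>

text \<open>The compactness argument below quantifies over blocks of variables and copies one block to
  another. It is easier to do this with the defined relations, so that formulas appear only here.
  Variables hold the parameters too: an assignment of values to all variables names countably many.\<close>

definition definable :: "('f, 'r) language \<Rightarrow> ('f, 'r, 'a) struc \<Rightarrow> ((nat \<Rightarrow> 'a) \<Rightarrow> bool) \<Rightarrow> bool" where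
  "definable L N P \<longleftrightarrow>
     (\<exists>\<psi>. wf_fm L \<psi> \<and> (\<forall>v. range v \<subseteq> Dom N \<longrightarrow> sat N v \<psi> = P v))"

lemma definable_cong:
  assumes "definable L N P" "\<And>v. range v \<subseteq> Dom N \<Longrightarrow> P v = Q v"
  shows "definable L N Q"
  using assms unfolding definable_def by auto

lemma definable_Neg: "definable L N P \<Longrightarrow> definable L N (\<lambda>v. \<not> P v)"
  unfolding definable_def by (metis sat.simps(3) wf_fm.simps(3))

lemma definable_And: "definable L N P \<Longrightarrow> definable L N Q \<Longrightarrow> definable L N (\<lambda>v. P v \<and> Q v)"
  unfolding definable_def by (metis sat.simps(4) wf_fm.simps(4))

lemma definable_True: "definable L N (\<lambda>v. True)"
  unfolding definable_def by (rule exI[of _ "Eq (Var 0) (Var 0)"]) simp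

lemma definable_Ball:
  assumes "finite S" "\<And>s. s \<in> S \<Longrightarrow> definable L N (P s)"
  shows "definable L N (\<lambda>v. \<forall>s\<in>S. P s v)"
  using assms
proof (induction S rule: finite_induct)
  case empty
  then show ?case by (simp add: definable_True)
next
  case (insert s S)
  have "definable L N (\<lambda>v. P s v \<and> (\<forall>s\<in>S. P s v))"
    by (intro definable_And insert.IH insert.prems) auto
  then show ?case by simp
qed

lemma definable_eq_const: "definable L N P \<Longrightarrow> definable L N (\<lambda>v. P v = c)"
  by (cases c) (simp_all add: definable_Neg)

lemma definable_Ex:
  assumes "definable L N P" shows "definable L N (\<lambda>v. \<exists>a\<in>Dom N. P (v(n := a)))"
proof -
  obtain \<psi> where \<psi>: "wf_fm L \<psi>" "\<And>v. range v \<subseteq> Dom N \<Longrightarrow> sat N v \<psi> = P v"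
    using assms unfolding definable_def by blast
  have "range (v(n := a)) \<subseteq> Dom N" if "range v \<subseteq> Dom N" "a \<in> Dom N" for v a
    using that by auto
  then have "sat N v (Ex n \<psi>) = (\<exists>a\<in>Dom N. P (v(n := a)))" if "range v \<subseteq> Dom N" for v
    using \<psi>(2) that by simp
  then show ?thesis unfolding definable_def using \<psi>(1) by (intro exI[of _ "Ex n \<psi>"]) simp
qed

text \<open>Substituting a variable needs no renaming of bound variables, because
  \<open>\<psi>(z)\<close> can be written \<open>\<exists>x. x = z \<and> \<psi>(x)\<close>.\<close>

lemma definable_subst:
  assumes "definable L N P" "x \<noteq> z" shows "definable L N (\<lambda>v. P (v(x := v z)))"
proof -
  have "definable L N (\<lambda>v. v x = v z)"
    unfolding definable_def by (rule exI[of _ "Eq (Var x) (Var z)"]) simp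
  from definable_Ex[OF definable_And[OF this assms(1)], of x]
  show ?thesis by (rule definable_cong) (use assms(2) in auto)
qed

definition subst_asg :: "nat list \<Rightarrow> nat list \<Rightarrow> (nat \<Rightarrow> 'a) \<Rightarrow> nat \<Rightarrow> 'a" where
  "subst_asg xs zs v = (\<lambda>n. case map_of (zip xs zs) n of None \<Rightarrow> v n | Some z \<Rightarrow> v z)"

lemma definable_subst_list:
  fixes N :: "('f, 'r, 'a) struc"
  assumes "definable L N P" "length xs = length zs" "distinct xs" "set xs \<inter> set zs = {}"
  shows "definable L N (\<lambda>v. P (subst_asg xs zs v))"
  using assms(2-)
proof (induction xs zs rule: list_induct2)
  case Nil
  then show ?case using assms(1) by (simp add: subst_asg_def)
next
  case (Cons x xs z zs)
  have "definable L N (\<lambda>v. P (subst_asg xs zs (v(x := v z))))"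
    using Cons by (intro definable_subst[where P = "\<lambda>v. P (subst_asg xs zs v)"]) auto
  moreover have "subst_asg xs zs (v(x := v z)) = subst_asg (x # xs) (z # zs) v" for v :: "nat \<Rightarrow> 'a"
  proof -
    have "map_of (zip xs zs) x = None" using Cons by auto
    moreover have "w \<noteq> x" if "map_of (zip xs zs) n = Some w" for n w
      using Cons.prems that by (auto dest!: map_of_SomeD set_zip_rightD)
    ultimately show ?thesis
      by (auto simp: subst_asg_def fun_eq_iff split: option.split)
  qed
  ultimately show ?case by simp
qed

lemma definable_Ex_list:
  fixes N :: "('f, 'r, 'a) struc"
  assumes "definable L N P"
  shows "definable L N (\<lambda>v. \<exists>u. range u \<subseteq> Dom N \<and> (\<forall>n. n \<notin> set zs \<longrightarrow> u n = v n) \<and> P u)"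
proof (induction zs)
  case Nil
  have "(\<exists>u. range u \<subseteq> Dom N \<and> (\<forall>n. n \<notin> set [] \<longrightarrow> u n = v n) \<and> P u) = P v"
    if "range v \<subseteq> Dom N" for v
  proof -
    have "(\<forall>n. n \<notin> set [] \<longrightarrow> u n = v n) \<longleftrightarrow> u = v" for u by auto
    then show ?thesis using that by auto
  qed
  then show ?case using definable_cong[OF assms] by auto
next
  case (Cons z zs)
  show ?case
  proof (rule definable_cong[OF definable_Ex[OF Cons, of z]])
    fix v :: "nat \<Rightarrow> 'a"
    show "(\<exists>a\<in>Dom N. \<exists>u. range u \<subseteq> Dom N \<and> (\<forall>n. n \<notin> set zs \<longrightarrow> u n = (v(z := a)) n) \<and> P u)
      = (\<exists>u. range u \<subseteq> Dom N \<and> (\<forall>n. n \<notin> set (z # zs) \<longrightarrow> u n = v n) \<and> P u)" (is "?l = ?r")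
    proof
      assume ?l
      then show ?r by (metis fun_upd_apply list.set_intros(1,2))
    next
      assume ?r
      then obtain u where u: "range u \<subseteq> Dom N" "\<forall>n. n \<notin> set (z # zs) \<longrightarrow> u n = v n" "P u" by blast
      then have "u z \<in> Dom N" "\<forall>n. n \<notin> set zs \<longrightarrow> u n = (v(z := u z)) n" by auto
      then show ?l using u by blast
    qed
  qed
qed

definition overwrite :: "nat list \<Rightarrow> 'a list \<Rightarrow> (nat \<Rightarrow> 'a) \<Rightarrow> nat \<Rightarrow> 'a" where
  "overwrite zs a w = (\<lambda>n. if n \<in> set zs then asg zs a n else w n)"

lemma range_overwrite:
  assumes "range w \<subseteq> Dom N" "a \<in> tuples N (length zs)"
  shows "range (overwrite zs a w) \<subseteq> Dom N"
proof -
  have "asg zs a n \<in> Dom N" if "n \<in> set zs" for n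
  proof -
    have "n \<in> dom (map_of (zip zs a))" using that assms(2) by (simp add: tuples_def)
    then obtain c where c: "map_of (zip zs a) n = Some c" by blast
    then have "c \<in> set a" by (meson map_of_SomeD set_zip_rightD)
    then show ?thesis using c assms(2) by (auto simp: asg_def tuples_def)
  qed
  then show ?thesis using assms(1) by (auto simp: overwrite_def)
qed

text \<open>Saturation in terms of definable relations: all values of \<open>w\<close> outside \<open>zs\<close> are plugged in as
  parameters, so it does not matter which variables occur in the defining formulas.\<close>

lemma monster_realizes_definable:
  assumes "monster_model L T \<kappa> U" "range w \<subseteq> Dom U" "distinct zs"
    and "\<And>P. P \<in> \<P> \<Longrightarrow> definable L U P"
    and fin: "\<And>F. finite F \<Longrightarrow> F \<subseteq> \<P> \<Longrightarrow> \<exists>a\<in>tuples U (length zs). \<forall>P\<in>F. P (overwrite zs a w)"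
  obtains a where "a \<in> tuples U (length zs)" "\<And>P. P \<in> \<P> \<Longrightarrow> P (overwrite zs a w)"
proof -
  define \<psi> where "\<psi> P = (SOME \<psi>. wf_fm L \<psi> \<and> (\<forall>v. range v \<subseteq> Dom U \<longrightarrow> sat U v \<psi> = P v))" for P
  have \<psi>: "wf_fm L (\<psi> P)" "range v \<subseteq> Dom U \<Longrightarrow> sat U v (\<psi> P) = P v" if "P \<in> \<P>" for P v
    using someI_ex[OF assms(4)[OF that, unfolded definable_def]] unfolding \<psi>_def by blast+
  define \<sigma> where "\<sigma> n = (if n \<in> set zs then None else Some (w n))" for n
  have \<sigma>: "ran \<sigma> \<subseteq> range w" "dom \<sigma> = - set zs"
    by (auto simp: \<sigma>_def ran_def split: if_splits)
  have sat: "sat (with_params U) (asg zs a) (fm_plug \<sigma> (\<psi> P)) = P (overwrite zs a w)"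
    if "P \<in> \<P>" "a \<in> tuples U (length zs)" for P a
  proof -
    have "(\<lambda>n. case \<sigma> n of None \<Rightarrow> asg zs a n | Some c \<Rightarrow> c) = overwrite zs a w"
      by (auto simp: \<sigma>_def overwrite_def)
    then show ?thesis
      unfolding sat_fm_plug using \<psi>(2)[OF that(1) range_overwrite[OF assms(2) that(2)]] by simp
  qed
  let ?\<Gamma> = "(\<lambda>P. fm_plug \<sigma> (\<psi> P)) ` \<P>"
  have "?\<Gamma> \<subseteq> formulas (lang_params L (range w)) (set zs)"
    using fm_plug_in_lang[OF \<psi>(1) \<sigma>(1)] \<sigma>(2) by (auto simp: formulas_def)
  moreover have "fin_sat U zs ?\<Gamma>"
    unfolding fin_sat_def
  proof (intro allI impI)
    fix F assume F: "finite F \<and> F \<subseteq> ?\<Gamma>"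
    then obtain G where G: "G \<subseteq> \<P>" "finite G" "F = (\<lambda>P. fm_plug \<sigma> (\<psi> P)) ` G"
      by (meson finite_subset_image)
    then obtain a where "a \<in> tuples U (length zs)" "\<forall>P\<in>G. P (overwrite zs a w)"
      using fin by meson
    then show "\<exists>a\<in>tuples U (length zs). \<forall>\<psi>\<in>F. sat (with_params U) (asg zs a) \<psi>"
      using sat G by blast
  qed
  moreover have "countable (range w)" by simp
  ultimately obtain a where "a \<in> realizations U zs ?\<Gamma>"
    using monster_realizes[OF assms(1,2) _ assms(3)] by metis
  then have "a \<in> tuples U (length zs)" "\<And>P. P \<in> \<P> \<Longrightarrow> P (overwrite zs a w)"
    using sat by (auto simp: realizations_def)
  then show ?thesis using that by blast
qed

locale nip_formula =
  fixes L :: "('f, 'r) language" and T :: "('f, 'r) fm set" and \<kappa> :: "'k rel"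
    and U :: "('f, 'r, 'u) struc" and \<phi> :: "('f, 'r) fm" and xs ys :: "nat list"
  assumes monster: "monster_model L T \<kappa> U"
    and distinct: "distinct (xs @ ys)"
    and formula: "\<phi> \<in> formulas L (set (xs @ ys))"
    and nip: "NIP U \<phi> xs ys"
begin

abbreviation "Ux \<equiv> tuples U (length xs)"
abbreviation "Uy \<equiv> tuples U (length ys)"

definition holds :: "'u list \<Rightarrow> 'u list \<Rightarrow> bool" where
  "holds a b \<longleftrightarrow> sat U (asg (xs @ ys) (a @ b)) \<phi>"

lemma sat_inst_holds:
  assumes "a \<in> Ux" "b \<in> Uy"
  shows "sat (with_params U) (asg xs a) (inst \<phi> ys b) \<longleftrightarrow> holds a b"
    and "sat (with_params U) (asg ys b) (inst \<phi> xs a) \<longleftrightarrow> holds a b"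
  using sat_inst[OF distinct, of \<phi> a b U] assms formula
  unfolding holds_def formulas_def tuples_def by auto

lemma inst_formulas:
  shows "b \<in> Uy \<Longrightarrow> set b \<subseteq> A \<Longrightarrow> inst \<phi> ys b \<in> formulas (lang_params L A) (set xs)"
    and "a \<in> Ux \<Longrightarrow> set a \<subseteq> A \<Longrightarrow> inst \<phi> xs a \<in> formulas (lang_params L A) (set ys)"
  using formula by (auto intro!: inst_in_formulas simp: tuples_def Un_commute)

definition shattered :: "nat \<Rightarrow> (nat \<Rightarrow> 'u list) \<Rightarrow> bool" where
  "shattered d a \<longleftrightarrow> (\<forall>S\<in>Pow {..<d}. \<exists>b\<in>Uy. \<forall>i\<in>{..<d}. holds (a i) b \<longleftrightarrow> i \<in> S)"

lemma shattered_mono: 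
  assumes "shattered d a" "e \<le> d" shows "shattered e a"
  unfolding shattered_def
proof
  fix S assume "S \<in> Pow {..<e}"
  then have "S \<in> Pow {..<d}" using assms(2) by auto
  then show "\<exists>b\<in>Uy. \<forall>i\<in>{..<e}. holds (a i) b \<longleftrightarrow> i \<in> S"
    using assms unfolding shattered_def by (metis lessThan_iff less_le_trans)
qed

lemma shattered_cong: "(\<And>i. i < d \<Longrightarrow> a i = a' i) \<Longrightarrow> shattered d a = shattered d a'"
  unfolding shattered_def by simp

text \<open>An infinite sequence with shattered initial segments would contradict NIP: saturation over the
  countably many tuples turns patterns on the initial segments into a pattern on the whole sequence.\<close>

lemma not_all_shattered:
  assumes "\<And>i. a i \<in> Ux"
  shows "\<exists>d. \<not> shattered d a"
proof (rule ccontr)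
  assume "\<not> ?thesis"
  then have sh: "\<And>d. shattered d a" by blast
  have "inj a"
  proof (rule injI, rule ccontr)
    fix i j assume eq: "a i = a j" and "i \<noteq> j"
    have "{i} \<in> Pow {..<Suc (max i j)}" by auto
    then obtain b where "\<forall>k\<in>{..<Suc (max i j)}. holds (a k) b \<longleftrightarrow> k \<in> {i}"
      using sh[of "Suc (max i j)"] unfolding shattered_def by meson
    then have "holds (a i) b" "\<not> holds (a j) b" using \<open>i \<noteq> j\<close> by auto
    then show False using eq by simp
  qed
  have "\<exists>b\<in>Uy. \<forall>i. holds (a i) b \<longleftrightarrow> a i \<in> I" for I
  proof -
    let ?A = "\<Union>i. set (a i)"
    let ?\<Gamma> = "range (\<lambda>i. if a i \<in> I then inst \<phi> xs (a i) else Neg (inst \<phi> xs (a i)))"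
    have G: "?\<Gamma> \<subseteq> formulas (lang_params L ?A) (set ys)"
    proof -
      have "inst \<phi> xs (a i) \<in> formulas (lang_params L ?A) (set ys)" for i
        by (rule inst_formulas(2)[OF assms]) auto
      then show ?thesis unfolding formulas_def by (auto simp: subset_iff)
    qed
    have fin: "fin_sat U ys ?\<Gamma>"
      unfolding fin_sat_def
    proof (intro allI impI)
      fix F assume "finite F \<and> F \<subseteq> ?\<Gamma>"
      then obtain J where J: "finite J" 
        "F = (\<lambda>i. if a i \<in> I then inst \<phi> xs (a i) else Neg (inst \<phi> xs (a i))) ` J"
        by (meson finite_subset_image)
      then obtain d where d: "J \<subseteq> {..<d}" using finite_nat_iff_bounded by auto
      have "{i. i < d \<and> a i \<in> I} \<in> Pow {..<d}" by auto
      then obtain b where "b \<in> Uy" "\<forall>i\<in>{..<d}. holds (a i) b \<longleftrightarrow> i \<in> {i. i < d \<and> a i \<in> I}"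
        using sh[of d] unfolding shattered_def by meson
      then show "\<exists>b\<in>Uy. \<forall>\<psi>\<in>F. sat (with_params U) (asg ys b) \<psi>"
        using J d sat_inst_holds(2)[OF assms] by (intro bexI[of _ b]) auto
    qed
    have A: "?A \<subseteq> Dom U" "distinct ys" using assms distinct by (auto simp: tuples_def)
    have cA: "countable ?A" by (rule countable_UN) (auto simp: countable_finite)
    obtain b where b: "b \<in> realizations U ys ?\<Gamma>"
      by (rule monster_realizes[OF monster A(1) cA A(2) G fin])
    then have "b \<in> Uy" by (simp add: realizations_def)
    moreover have "holds (a i) b \<longleftrightarrow> a i \<in> I" for i
    proof -
      have "sat (with_params U) (asg ys b) (if a i \<in> I then inst \<phi> xs (a i) else Neg (inst \<phi> xs (a i)))"
        using b by (simp add: realizations_def)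
      then show ?thesis using sat_inst_holds(2)[OF assms \<open>b \<in> Uy\<close>] by (auto split: if_splits)
    qed
    ultimately show ?thesis by blast
  qed
  then obtain B where "\<forall>I. B I \<in> Uy \<and> (\<forall>i. holds (a i) (B I) \<longleftrightarrow> a i \<in> I)" by metis
  moreover have "infinite (range a)" using \<open>inj a\<close> by (simp add: range_inj_infinite)
  moreover have "range a \<subseteq> Ux" using assms by auto
  ultimately have "infinite (range a) \<and> range a \<subseteq> Ux \<and>
     (\<forall>I. I \<subseteq> range a \<longrightarrow> B I \<in> Uy \<and>
        (\<forall>a\<in>range a. sat U (asg (xs @ ys) (a @ B I)) \<phi> \<longleftrightarrow> a \<in> I))"
    unfolding holds_def by blast
  then show False using nip unfolding NIP_def by blast
qed

text \<open>Variables from \<open>base\<close> on are divided into consecutive blocks of the length of \<open>xs\<close>; block \<open>i\<close> holds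
  the \<open>i\<close>-th tuple. They are disjoint from \<open>xs\<close> and \<open>ys\<close>, which \<open>\<phi>\<close> uses.\<close>

definition base :: nat where "base = Suc (Max (insert 0 (set (xs @ ys))))"

definition block :: "nat \<Rightarrow> nat list" where
  "block i = map (\<lambda>l. base + i * length xs + l) [0..<length xs]"

definition tuple_at :: "(nat \<Rightarrow> 'u) \<Rightarrow> nat \<Rightarrow> 'u list" where
  "tuple_at v i = map v (block i)"

lemma base_gt: "n \<in> set xs \<union> set ys \<Longrightarrow> n < base"
  unfolding base_def by (simp add: less_Suc_eq_le)

lemma block_simps [simp]: "length (block i) = length xs" "distinct (block i)"
  by (auto simp: block_def distinct_map inj_on_def)

lemma set_block: "set (block i) = {base + i * length xs..<base + Suc i * length xs}"
proof -
  have "(\<lambda>l. base + i * length xs + l) ` {0..<length xs} = {base + i * length xs..<base + Suc i * length xs}"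
    using image_add_atLeastLessThan[of "base + i * length xs" 0 "length xs"] by (simp add: ac_simps)
  then show ?thesis by (simp add: block_def)
qed

lemma tuple_at_in: "range v \<subseteq> Dom U \<Longrightarrow> tuple_at v i \<in> Ux"
  by (auto simp: tuple_at_def tuples_def)

lemma tuple_at_cong:
  assumes "\<And>n. base + i * length xs \<le> n \<Longrightarrow> n < base + Suc i * length xs \<Longrightarrow> v n = w n"
  shows "tuple_at v i = tuple_at w i"
  unfolding tuple_at_def using assms by (intro map_cong) (auto simp: set_block)

text \<open>The tuple \<open>b\<close> is obtained by quantifying over the values of \<open>ys\<close>, and each \<open>a\<^sub>i\<close> by substituting block
  \<open>i\<close> for \<open>xs\<close>; the finitely many patterns form a conjunction.\<close>

lemma definable_shattered: "definable L U (\<lambda>v. shattered d (tuple_at v))"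
proof -
  have dphi: "definable L U (\<lambda>v. sat U v \<phi>)"
    using formula unfolding definable_def formulas_def by blast
  have "definable L U (\<lambda>v. \<exists>b\<in>Uy. \<forall>i\<in>{..<d}. holds (tuple_at v i) b \<longleftrightarrow> i \<in> S)" for S
  proof (rule definable_cong)
    have "set xs \<inter> set (block i) = {}" for i
      using base_gt by (force simp: set_block)
    then show "definable L U (\<lambda>v. \<exists>u. range u \<subseteq> Dom U \<and> (\<forall>n. n \<notin> set ys \<longrightarrow> u n = v n) \<and>
        (\<forall>i\<in>{..<d}. sat U (subst_asg xs (block i) u) \<phi> = (i \<in> S)))"
      using distinct by (intro definable_Ex_list definable_Ball definable_eq_const
        definable_subst_list[OF dphi]) auto
  next
    fix v :: "nat \<Rightarrow> 'u" assume v: "range v \<subseteq> Dom U"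
    have *: "sat U (subst_asg xs (block i) u) \<phi> = holds (tuple_at v i) (map u ys)"
      if "\<forall>n. n \<notin> set ys \<longrightarrow> u n = v n" for u i
      unfolding holds_def
    proof (rule sat_cong)
      fix n assume "n \<in> fv \<phi>"
      then have n: "n \<in> set xs \<or> n \<in> set ys" using formula by (auto simp: formulas_def)
      have len: "length (tuple_at v i @ map u ys) = length (xs @ ys)" by (simp add: tuple_at_def)
      show "subst_asg xs (block i) u n = asg (xs @ ys) (tuple_at v i @ map u ys) n"
      proof (cases "n \<in> set xs")
        case True
        then obtain l where l: "l < length xs" "n = xs ! l" by (metis in_set_conv_nth)
        then have "map_of (zip xs (block i)) n = Some (block i ! l)"
          using distinct by (simp add: map_of_zip_nth)
        moreover have "asg (xs @ ys) (tuple_at v i @ map u ys) ((xs @ ys) ! l) = v (block i ! l)"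
          using asg_eq[OF distinct len, of l] l by (simp add: nth_append tuple_at_def)
        moreover have "block i ! l \<notin> set ys"
        proof -
          have "block i ! l \<in> set (block i)" using l by simp
          then show ?thesis using base_gt by (force simp: set_block)
        qed
        ultimately show ?thesis using that l by (simp add: subst_asg_def nth_append)
      next
        case False
        then obtain l where l: "l < length ys" "n = ys ! l" using n by (metis in_set_conv_nth)
        have none: "map_of (zip xs (block i)) n = None" using False l by simp
        have "asg (xs @ ys) (tuple_at v i @ map u ys) ((xs @ ys) ! (length xs + l)) = u (ys ! l)"
          using asg_eq[OF distinct len, of "length xs + l"] l by (simp add: nth_append tuple_at_def)
        moreover have "(xs @ ys) ! (length xs + l) = n" using l by simp
        ultimately show ?thesis unfolding subst_asg_def none using l by simp
      qed
    qed
    show "(\<exists>u. range u \<subseteq> Dom U \<and> (\<forall>n. n \<notin> set ys \<longrightarrow> u n = v n) \<and>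
        (\<forall>i\<in>{..<d}. sat U (subst_asg xs (block i) u) \<phi> = (i \<in> S)))
      = (\<exists>b\<in>Uy. \<forall>i\<in>{..<d}. holds (tuple_at v i) b = (i \<in> S))" (is "?l = ?r")
    proof
      assume ?l
      then obtain u where u: "range u \<subseteq> Dom U" "\<forall>n. n \<notin> set ys \<longrightarrow> u n = v n"
        "\<forall>i\<in>{..<d}. sat U (subst_asg xs (block i) u) \<phi> = (i \<in> S)" by blast
      then have "map u ys \<in> Uy" by (auto simp: tuples_def)
      then show ?r using u(3) *[OF u(2)] by blast
    next
      assume ?r
      then obtain b where b: "b \<in> Uy" "\<forall>i\<in>{..<d}. holds (tuple_at v i) b = (i \<in> S)" by blast
      let ?u = "overwrite ys b v"
      have "range ?u \<subseteq> Dom U" using range_overwrite[OF v b(1)] .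
      moreover have off: "\<forall>n. n \<notin> set ys \<longrightarrow> ?u n = v n" by (simp add: overwrite_def)
      moreover have "map ?u ys = b"
      proof (rule nth_equalityI)
        show "length (map ?u ys) = length b" using b(1) by (simp add: tuples_def)
        fix l assume "l < length (map ?u ys)"
        then show "map ?u ys ! l = b ! l"
          using b(1) distinct asg_eq[of ys b l] by (simp add: tuples_def overwrite_def)
      qed
      ultimately show ?l using b(2) *[OF off] by (intro exI[of _ ?u]) simp
    qed
  qed
  then show ?thesis unfolding shattered_def by (intro definable_Ball) auto
qed

text \<open>The first \<open>k\<close> tuples can be prolonged to a shattered sequence of each finite length. The tuples
  found for different lengths need not be related.\<close>

definition extendible :: "nat \<Rightarrow> (nat \<Rightarrow> 'u) \<Rightarrow> bool" where
  "extendible k w \<longleftrightarrow> range w \<subseteq> Dom U \<and>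
     (\<forall>d. \<exists>u. range u \<subseteq> Dom U \<and>
        (\<forall>n. n \<notin> set [base + k * length xs..<base + d * length xs] \<longrightarrow> u n = w n) \<and>
        shattered d (tuple_at u))"

text \<open>The next tuple has to work for all lengths at once. For finitely many lengths the tuple from a
  prolongation of the greatest one does; saturation does the rest.\<close>

lemma extendible_step:
  assumes "extendible k w"
  obtains a where "a \<in> Ux" "extendible (Suc k) (overwrite (block k) a w)"
proof -
  let ?Q = "\<lambda>d v. \<exists>u. range u \<subseteq> Dom U \<and>
        (\<forall>n. n \<notin> set [base + Suc k * length xs..<base + d * length xs] \<longrightarrow> u n = v n) \<and>
        shattered d (tuple_at u)"
  have w: "range w \<subseteq> Dom U" using assms by (simp add: extendible_def)
  have def: "definable L U P" if "P \<in> range ?Q" for P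
  proof -
    from that obtain d where "P = ?Q d" by (rule rangeE)
    then show ?thesis
      using definable_Ex_list[OF definable_shattered[of d],
          of "[base + Suc k * length xs..<base + d * length xs]"] by (simp only:)
  qed
  have fin: "\<exists>a\<in>tuples U (length (block k)). \<forall>P\<in>F. P (overwrite (block k) a w)"
    if F: "finite F" "F \<subseteq> range ?Q" for F
  proof -
    obtain J where J: "finite J" "F = ?Q ` J" using finite_subset_image[OF F] by auto
    obtain D where D: "\<And>d. d \<in> J \<Longrightarrow> d \<le> D" using J(1) finite_nat_set_iff_bounded_le by auto
    obtain u where u: "range u \<subseteq> Dom U"
      "\<And>n. n \<notin> {base + k * length xs..<base + D * length xs} \<Longrightarrow> u n = w n"
      "shattered D (tuple_at u)"
      using assms unfolding extendible_def set_upt by meson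
    let ?v = "overwrite (block k) (tuple_at u k) w"
    have len: "length (tuple_at u k) = length (block k)" by (simp add: tuple_at_def)
    have ublk: "?v n = u n" if nb: "n \<in> set (block k)" for n
    proof -
      obtain l where l: "l < length (block k)" "n = block k ! l" using nb by (metis in_set_conv_nth)
      then have "asg (block k) (tuple_at u k) n = u n"
        using asg_eq[OF _ len l(1)] by (simp add: tuple_at_def)
      then show ?thesis using nb by (simp add: overwrite_def)
    qed
    have "?Q d ?v" if d: "d \<in> J" for d
    proof -
      let ?u = "\<lambda>n. if n \<in> {base + Suc k * length xs..<base + d * length xs} then u n else ?v n"
      have tv: "tuple_at u k \<in> tuples U (length (block k))" using tuple_at_in[OF u(1)] by simp
      have "range ?u \<subseteq> Dom U" using u(1) range_overwrite[OF w tv] by (auto split: if_splits)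
      moreover have "?u n = u n" if "n < base + d * length xs" "base \<le> n" for n
      proof -
        consider "n < base + k * length xs" | "n \<in> set (block k)" | "base + Suc k * length xs \<le> n"
          by (force simp: set_block)
        then show ?thesis
        proof cases
          case 1
          then have "u n = w n" using u(2) by simp
          moreover have "?v n = w n" using 1 by (auto simp: overwrite_def set_block)
          ultimately show ?thesis by simp
        qed (use that ublk in auto)
      qed
      then have "tuple_at ?u i = tuple_at u i" if "i < d" for i
      proof (intro tuple_at_cong)
        fix n assume n: "base + i * length xs \<le> n" "n < base + Suc i * length xs"
        have "Suc i * length xs \<le> d * length xs" using that by (intro mult_le_mono1) simp
        then show "?u n = u n" using n \<open>\<And>n. n < base + d * length xs \<Longrightarrow> base \<le> n \<Longrightarrow> ?u n = u n\<close>[of n]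
          by linarith
      qed
      then have "shattered d (tuple_at ?u) = shattered d (tuple_at u)" by (intro shattered_cong) 
      then have "shattered d (tuple_at ?u)" using shattered_mono[OF u(3) D[OF d]] by simp
      ultimately show ?thesis by (intro exI[of _ ?u]) auto
    qed
    then show ?thesis using J tuple_at_in[OF u(1), of k] by (intro bexI[of _ "tuple_at u k"]) auto
  qed
  obtain a where a: "a \<in> tuples U (length (block k))" "\<And>d. ?Q d (overwrite (block k) a w)"
  proof (rule monster_realizes_definable[OF monster w block_simps(2)[of k] def fin])
    fix a assume "a \<in> tuples U (length (block k))"
      and *: "\<And>P. P \<in> range ?Q \<Longrightarrow> P (overwrite (block k) a w)"
    moreover have "?Q d (overwrite (block k) a w)" for d by (rule *) (rule rangeI)
    ultimately show thesis using that by simp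
  qed
  then have "extendible (Suc k) (overwrite (block k) a w)"
    unfolding extendible_def using range_overwrite[OF w a(1)] by simp
  then show ?thesis using that a(1) by simp
qed

text \<open>If shattered sequences of all finite lengths exist, \<open>extendible_step\<close> produces an infinite one
  block by block, since later steps leave earlier blocks unchanged.\<close>

theorem shattering_bounded:
  obtains d where "\<And>a. (\<And>i. i < d \<Longrightarrow> a i \<in> Ux) \<Longrightarrow> \<not> shattered d a"
proof (rule ccontr)
  assume no: "\<not> thesis"
  have ex: "\<exists>a. (\<forall>i<d. a i \<in> Ux) \<and> shattered d a" for d
    using no that by meson
  have ne: "Dom U \<noteq> {}" using monster unfolding monster_model_def is_model_def is_struc_def by blast
  then obtain c where c: "c \<in> Dom U" by blast
  have "extendible 0 (\<lambda>_. c)"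
    unfolding extendible_def
  proof (intro conjI allI)
    show "range (\<lambda>_. c) \<subseteq> Dom U" using c by auto
    fix d
    obtain a where a: "\<And>i. i < d \<Longrightarrow> a i \<in> Ux" "shattered d a" using ex by blast
    let ?u = "\<lambda>n. if n \<in> {base..<base + d * length xs}
       then a ((n - base) div length xs) ! ((n - base) mod length xs) else c"
    have idx: "(n - base) div length xs < d \<and> (n - base) mod length xs < length xs"
      if "n \<in> {base..<base + d * length xs}" for n
    proof -
      have "n - base < d * length xs" using that by auto
      moreover have "length xs > 0" using calculation by (cases xs) auto
      ultimately show ?thesis by (simp add: less_mult_imp_div_less)
    qed
    have "range ?u \<subseteq> Dom U"
    proof
      fix e assume "e \<in> range ?u"
      then obtain n where n: "e = ?u n" by blast
      show "e \<in> Dom U"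
      proof (cases "n \<in> {base..<base + d * length xs}")
        case True
        then show ?thesis using n idx[OF True] a(1) by (auto simp: tuples_def subset_iff)
      next
        case False
        then have "e = c" unfolding n by (rule if_not_P)
        then show ?thesis using c by simp
      qed
    qed
    moreover have tu: "tuple_at ?u i = a i" if "i < d" for i
    proof (rule nth_equalityI)
      show len: "length (tuple_at ?u i) = length (a i)"
        using a(1)[OF that] by (simp add: tuple_at_def tuples_def)
      fix l assume "l < length (tuple_at ?u i)"
      then have l: "l < length xs" by (simp add: tuple_at_def)
      have "i * length xs + l < Suc i * length xs" using l by simp
      also have "\<dots> \<le> d * length xs" using that by (intro mult_le_mono1) simp
      finally have lt: "i * length xs + l < d * length xs" .
      have "length xs \<noteq> 0" using l by linarith
      then have "(i * length xs + l) div length xs = i"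
        using div_mult_self3[of "length xs" i l] div_less[OF l] by linarith
      moreover have "(i * length xs + l) mod length xs = l"
        using mod_mult_self3[of i "length xs" l] mod_less[OF l] by linarith
      ultimately show "tuple_at ?u i ! l = a i ! l"
        using l lt by (simp add: tuple_at_def block_def add.assoc)
    qed
    have "shattered d (tuple_at ?u) = shattered d a" by (rule shattered_cong) (rule tu)
    then have "shattered d (tuple_at ?u)" using a(2) by simp
    ultimately show "\<exists>u. range u \<subseteq> Dom U \<and>
        (\<forall>n. n \<notin> set [base + 0 * length xs..<base + d * length xs] \<longrightarrow> u n = c) \<and>
        shattered d (tuple_at u)" by (intro exI[of _ ?u]) auto
  qed
  moreover have "\<exists>w'. extendible (Suc k) w' \<and> (\<forall>n. n \<notin> set (block k) \<longrightarrow> w' n = w n)"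
    if "extendible k w" for k w
    using extendible_step[OF that] by (metis overwrite_def)
  ultimately obtain w where w: "\<And>k. extendible k (w k)"
      "\<And>k. \<forall>n. n \<notin> set (block k) \<longrightarrow> w (Suc k) n = w k n"
    using dependent_nat_choice[of extendible "\<lambda>k w w'. \<forall>n. n \<notin> set (block k) \<longrightarrow> w' n = w n"]
    by metis
  define a where "a i = tuple_at (w (Suc i)) i" for i
  have stable: "tuple_at (w (Suc i + k)) i = a i" for i k
  proof (induction k)
    case (Suc k)
    have "tuple_at (w (Suc (Suc i + k))) i = tuple_at (w (Suc i + k)) i"
    proof (rule tuple_at_cong)
      fix n assume n: "n < base + Suc i * length xs"
      have "Suc i * length xs \<le> (Suc i + k) * length xs" by (intro mult_le_mono1) simp
      then have "n \<notin> set (block (Suc i + k))"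
        using n unfolding set_block atLeastLessThan_iff by linarith
      then show "w (Suc (Suc i + k)) n = w (Suc i + k) n" using w(2) by blast
    qed
    then show ?case using Suc by simp
  qed (simp add: a_def)
  have wr: "range (w k) \<subseteq> Dom U" for k using w(1) by (simp add: extendible_def)
  have "shattered d a" for d
  proof -
    obtain u where u: "\<And>n. n \<notin> set [base + d * length xs..<base + d * length xs] \<Longrightarrow> u n = w d n"
        "shattered d (tuple_at u)"
      using w(1)[of d] unfolding extendible_def by meson
    then have "u = w d" by (auto simp: fun_eq_iff)
    moreover have "tuple_at (w d) i = a i" if "i < d" for i
      using stable[of i "d - Suc i"] that by simp
    then have "shattered d (tuple_at (w d)) = shattered d a" by (rule shattered_cong)
    ultimately show ?thesis using u(2) by simp
  qed
  moreover have "a i \<in> Ux" for i using tuple_at_in[OF wr] by (simp add: a_def)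
  ultimately show False using not_all_shattered by blast
qed

end

section \<open>Type spaces\<close>

text \<open>Both the Stone topology on complete types and the topology on \<open>\<phi>\<close>-types are of this form.\<close>

definition type_topology ::
    "('f, 'r, 'a) struc \<Rightarrow> nat list \<Rightarrow> ('f + 'a, 'r) fm set \<Rightarrow> ('f + 'a, 'r) fm set topology" where
  "type_topology N zs \<Delta> =
     topology_generated_by ((\<lambda>\<psi>. {p \<in> max_consistent N zs \<Delta>. \<psi> \<in> p}) ` \<Delta>)"

locale complemented =
  fixes N :: "('f, 'r, 'a) struc" and zs :: "nat list" and \<Delta> :: "('f + 'a, 'r) fm set"
  assumes complement: "\<psi> \<in> \<Delta> \<Longrightarrow> \<exists>\<eta>\<in>\<Delta>. complementary N zs \<psi> \<eta>"
    and nonempty: "\<Delta> \<noteq> {}"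
begin

abbreviation "types \<equiv> max_consistent N zs \<Delta>"
abbreviation "cl \<psi> \<equiv> {p \<in> types. \<psi> \<in> p}"

lemma topspace_type_topology: "topspace (type_topology N zs \<Delta>) = types"
proof -
  have "\<exists>\<psi>\<in>\<Delta>. \<psi> \<in> p" if "p \<in> types" for p
  proof -
    obtain \<psi> where "\<psi> \<in> \<Delta>" using nonempty by blast
    then show ?thesis using complement max_consistent_decides[OF that] by metis
  qed
  then show ?thesis by (auto simp: type_topology_def)
qed

lemma complement_cl:
  assumes "\<psi> \<in> \<Delta>" obtains \<eta> where "\<eta> \<in> \<Delta>" "types - cl \<psi> = cl \<eta>"
proof -
  obtain \<eta> where \<eta>: "\<eta> \<in> \<Delta>" "complementary N zs \<psi> \<eta>" using complement assms by blast
  then have "types - cl \<psi> = cl \<eta>" using max_consistent_decides assms by blast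
  then show ?thesis using that \<eta>(1) by blast
qed

lemma openin_cl: "\<psi> \<in> \<Delta> \<Longrightarrow> openin (type_topology N zs \<Delta>) (cl \<psi>)"
  unfolding type_topology_def by (rule topology_generated_by_Basis) blast

lemma closedin_cl: "\<psi> \<in> \<Delta> \<Longrightarrow> closedin (type_topology N zs \<Delta>) (cl \<psi>)"
proof -
  assume \<psi>: "\<psi> \<in> \<Delta>"
  obtain \<eta> where "\<eta> \<in> \<Delta>" "types - cl \<psi> = cl \<eta>" using complement_cl[OF \<psi>] .
  then show ?thesis unfolding closedin_def topspace_type_topology using openin_cl by auto
qed

lemma types_eq_iff:
  assumes "p \<in> types" "q \<in> types" "\<And>\<psi>. \<psi> \<in> \<Delta> \<Longrightarrow> \<psi> \<in> p \<longleftrightarrow> \<psi> \<in> q"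
  shows "p = q"
  using assms unfolding max_consistent_def by blast

lemma Hausdorff: "Hausdorff_space (type_topology N zs \<Delta>)"
  unfolding Hausdorff_space_def topspace_type_topology
proof (intro allI impI)
  fix p q assume pq: "p \<in> types \<and> q \<in> types \<and> p \<noteq> q"
  then obtain \<psi> where \<psi>: "\<psi> \<in> \<Delta>" "\<psi> \<in> p \<longleftrightarrow> \<psi> \<notin> q" using types_eq_iff by metis
  obtain \<eta> where \<eta>: "\<eta> \<in> \<Delta>" "types - cl \<psi> = cl \<eta>" using complement_cl[OF \<psi>(1)] .
  have *: "disjnt (cl \<psi>) (cl \<eta>)" "disjnt (cl \<eta>) (cl \<psi>)" using \<eta>(2) by (auto simp: disjnt_def)
  have "p \<in> cl \<psi> \<and> q \<in> cl \<eta> \<or> p \<in> cl \<eta> \<and> q \<in> cl \<psi>" using \<eta>(2) \<psi>(2) pq by auto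
  then show "\<exists>V W. openin (type_topology N zs \<Delta>) V \<and> openin (type_topology N zs \<Delta>) W
      \<and> p \<in> V \<and> q \<in> W \<and> disjnt V W"
    using * openin_cl[OF \<psi>(1)] openin_cl[OF \<eta>(1)] by meson
qed

lemma type_topology_subbase:
  "topology (arbitrary union_of (finite intersection_of (\<lambda>x. x \<in> cl ` \<Delta>) relative_to \<Union> (cl ` \<Delta>)))
      = type_topology N zs \<Delta>" (is "topology ?P = _")
proof -
  have 1: "generate_topology_on (cl ` \<Delta>) V" if "?P V" for V
  proof -
    have "generate_topology_on (cl ` \<Delta>) W"
      if W: "(finite intersection_of (\<lambda>x. x \<in> cl ` \<Delta>) relative_to \<Union> (cl ` \<Delta>)) W" for W
    proof -
      obtain \<F> where \<F>: "finite \<F>" "\<F> \<subseteq> cl ` \<Delta>" "W = \<Union> (cl ` \<Delta>) \<inter> \<Inter>\<F>"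
        using W unfolding relative_to_def intersection_of_def by blast
      have top: "generate_topology_on (cl ` \<Delta>) (\<Union> (cl ` \<Delta>))"
        by (rule generate_topology_on.UN) (rule generate_topology_on.Basis)
      show ?thesis
      proof (cases "\<F> = {}")
        case True
        then show ?thesis using \<F>(3) top by simp
      next
        case False
        then have "generate_topology_on (cl ` \<Delta>) (\<Inter>\<F>)"
          using \<F> by (intro generate_topology_on_Inter) (auto intro: generate_topology_on.Basis)
        then show ?thesis unfolding \<F>(3) by (rule generate_topology_on.Int[OF top])
      qed
    qed
    then show ?thesis
      using that unfolding union_of_def by (auto intro: generate_topology_on.UN)
  qed
  have 2: "?P V" if V: "generate_topology_on (cl ` \<Delta>) V" for V
  proof (rule generate_topology_on_coarsest[OF istopology_subbase _ V])
    fix W assume W: "W \<in> cl ` \<Delta>"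
    then have "(finite intersection_of (\<lambda>x. x \<in> cl ` \<Delta>) relative_to \<Union> (cl ` \<Delta>)) W"
      unfolding relative_to_def intersection_of_def
      by (intro exI[of _ W] conjI exI[of _ "{W}"]) auto
    then show "?P W" by (rule arbitrary_union_of_inc)
  qed
  have "?P = generate_topology_on (cl ` \<Delta>)" using 1 2 by blast
  then show ?thesis by (simp add: type_topology_def)
qed

text \<open>By the Alexander subbase theorem only covers by sets \<open>cl \<psi>\<close> matter. If no finite part of such a
  cover covers all types, the complements of the \<open>\<psi>\<close> are consistent, and a type containing them is
  left uncovered.\<close>

lemma compact: "compact_space (type_topology N zs \<Delta>)"
proof (rule Alexander_subbase[OF type_topology_subbase])
  fix \<C> assume C': "\<C> \<subseteq> cl ` \<Delta>" "\<Union>\<C> = topspace (type_topology N zs \<Delta>)"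
  then have C: "\<C> \<subseteq> cl ` \<Delta>" "types \<subseteq> \<Union>\<C>" using topspace_type_topology by auto
  have "\<exists>\<C>'. finite \<C>' \<and> \<C>' \<subseteq> \<C> \<and> types \<subseteq> \<Union>\<C>'"
  proof (rule ccontr)
    assume no: "\<not> ?thesis"
    define \<Gamma> where "\<Gamma> = {\<eta> \<in> \<Delta>. types - cl \<eta> \<in> \<C>}"
    have "fin_sat N zs \<Gamma>"
      unfolding fin_sat_def
    proof (intro allI impI)
      fix F assume F: "finite F \<and> F \<subseteq> \<Gamma>"
      have "finite ((\<lambda>\<eta>. types - cl \<eta>) ` F)" "(\<lambda>\<eta>. types - cl \<eta>) ` F \<subseteq> \<C>"
        using F by (auto simp: \<Gamma>_def)
      then have "\<not> types \<subseteq> \<Union> ((\<lambda>\<eta>. types - cl \<eta>) ` F)" using no by meson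
      then obtain p where p: "p \<in> types" "F \<subseteq> p" by auto
      then have "fin_sat N zs p" by (simp add: max_consistent_def)
      then show "\<exists>a\<in>tuples N (length zs). \<forall>\<psi>\<in>F. sat (with_params N) (asg zs a) \<psi>"
        using p F by (meson fin_satE)
    qed
    moreover have "\<Gamma> \<subseteq> \<Delta>" by (auto simp: \<Gamma>_def)
    ultimately obtain p where p: "p \<in> types" "\<Gamma> \<subseteq> p" using extend_to_max_consistent by metis
    then obtain V where V: "V \<in> \<C>" "p \<in> V" using C(2) by blast
    then obtain \<psi> where \<psi>: "\<psi> \<in> \<Delta>" "V = cl \<psi>" using C(1) by blast
    obtain \<eta> where \<eta>: "\<eta> \<in> \<Delta>" "types - cl \<psi> = cl \<eta>" using complement_cl[OF \<psi>(1)] .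
    then have "types - cl \<eta> = V" using \<psi> by blast
    then have "\<eta> \<in> \<Gamma>" using \<eta>(1) V(1) by (simp add: \<Gamma>_def)
    then show False using p V \<eta> \<psi> by blast
  qed
  then obtain \<C>' where "finite \<C>'" "\<C>' \<subseteq> \<C>" "types \<subseteq> \<Union>\<C>'" by (elim exE conjE)
  moreover have "\<Union>\<C>' \<subseteq> types" using C'(1) \<open>\<C>' \<subseteq> \<C>\<close> by blast
  ultimately show "\<exists>\<C>'. finite \<C>' \<and> \<C>' \<subseteq> \<C> \<and> \<Union>\<C>' = topspace (type_topology N zs \<Delta>)"
    unfolding topspace_type_topology by (intro exI[of _ \<C>']) simp
qed

lemma limitin_types:
  assumes "p \<in> types" "\<And>\<psi>. \<psi> \<in> \<Delta> \<Longrightarrow> \<psi> \<in> p \<Longrightarrow> eventually (\<lambda>i. s i \<in> types \<and> \<psi> \<in> s i) F"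
  shows "limitin (type_topology N zs \<Delta>) s p F"
  unfolding limitin_def topspace_type_topology
proof (intro conjI allI impI assms(1))
  fix V assume "openin (type_topology N zs \<Delta>) V \<and> p \<in> V"
  then have "generate_topology_on (cl ` \<Delta>) V" "p \<in> V"
    by (auto simp: type_topology_def openin_topology_generated_by_iff)
  then show "\<forall>\<^sub>F i in F. s i \<in> V"
  proof (induction rule: generate_topology_on.induct)
    case (Int a b)
    then show ?case by (simp add: eventually_conj)
  next
    case (UN K)
    then obtain k where "k \<in> K" "p \<in> k" by blast
    then have "\<forall>\<^sub>F i in F. s i \<in> k" using UN by blast
    then show ?case by (rule eventually_mono) (use \<open>k \<in> K\<close> in blast)
  next
    case (Basis V)
    then show ?case using assms(2) by auto
  qed auto
qed

end

section \<open>Countably many formulas\<close>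

instance tm :: (countable) countable by countable_datatype
instance fm :: (countable, countable) countable by countable_datatype

lemma wf_tm_symbols: "wf_tm L t \<Longrightarrow> set_tm t \<subseteq> Funs L"
  by (induction t) auto

lemma wf_fm_symbols: "wf_fm L \<psi> \<Longrightarrow> set1_fm \<psi> \<subseteq> Funs L \<and> set2_fm \<psi> \<subseteq> Rels L"
proof (induction \<psi>)
  case (Eq s t)
  then show ?case using wf_tm_symbols[of L s] wf_tm_symbols[of L t] by auto
next
  case (Rel R ts)
  then show ?case using wf_tm_symbols[of L] by fastforce
qed auto

text \<open>The symbols of the language form a countable set in a possibly uncountable type, so formulas are
  first recoded with numbers as symbols.\<close>

lemma countable_formulas:
  assumes "countable_language L" shows "countable (formulas L V)"
proof -
  have cF: "countable (Funs L)" and cR: "countable (Rels L)"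
    using assms by (auto simp: countable_language_def)
  let ?f = "map_fm (to_nat_on (Funs L)) (to_nat_on (Rels L))"
  have "inj_on ?f (formulas L V)"
  proof (rule inj_onI)
    fix \<psi> \<eta> assume "\<psi> \<in> formulas L V" "\<eta> \<in> formulas L V" and eq: "?f \<psi> = ?f \<eta>"
    then have "wf_fm L \<psi>" "wf_fm L \<eta>" by (auto simp: formulas_def)
    note sym = wf_fm_symbols[OF this(1)] wf_fm_symbols[OF this(2)]
    show "\<psi> = \<eta>"
    proof (rule fm.inj_map_strong[OF _ _ eq])
      fix z z' assume "z \<in> set1_fm \<psi>" "z' \<in> set1_fm \<eta>" "to_nat_on (Funs L) z = to_nat_on (Funs L) z'"
      then show "z = z'" using sym inj_on_to_nat_on[OF cF] by (meson inj_onD subsetD)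
    next
      fix z z' assume "z \<in> set2_fm \<psi>" "z' \<in> set2_fm \<eta>" "to_nat_on (Rels L) z = to_nat_on (Rels L) z'"
      then show "z = z'" using sym inj_on_to_nat_on[OF cR] by (meson inj_onD subsetD)
    qed
  qed
  then show ?thesis by (rule countable_image_inj_on[rotated]) simp
qed

lemma wf_tm_lang_params_mono:
  "wf_tm (lang_params L A) t \<Longrightarrow> A \<subseteq> B \<Longrightarrow> wf_tm (lang_params L B) t"
  by (induction t) (auto simp: lang_params_def)

lemma wf_fm_lang_params_mono:
  "wf_fm (lang_params L A) \<psi> \<Longrightarrow> A \<subseteq> B \<Longrightarrow> wf_fm (lang_params L B) \<psi>"
proof (induction \<psi>)
  case (Rel R ts)
  then have "wf_tm (lang_params L B) t" if "t \<in> set ts" for t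
    using wf_tm_lang_params_mono that by (metis wf_fm.simps(2))
  then show ?case using Rel by (simp add: lang_params_def)
qed (auto intro: wf_tm_lang_params_mono)

section \<open>Values of invariant types\<close>

locale countable_base = nip_formula L T \<kappa> U \<phi> xs ys
  for L :: "('f, 'r) language" and T :: "('f, 'r) fm set" and \<kappa> :: "'k rel"
    and U :: "('f, 'r, 'u) struc" and \<phi> :: "('f, 'r) fm" and xs ys :: "nat list" +
  fixes A :: "'u set"
  assumes A: "A \<subseteq> Dom U" "countable A"
    and countable_L: "countable_language L"
begin

abbreviation "Form \<equiv> formulas (lang_params L A) (set ys)"
abbreviation "Sy \<equiv> complete_types L U A ys"
abbreviation "Inv \<equiv> inv_phi_types L U A \<phi> xs ys"
abbreviation "Sphi \<equiv> phi_types U \<phi> xs ys"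

text \<open>The value of \<open>p\<close> at \<open>q\<close>, as in the definition of \<open>defining_set\<close>.\<close>

definition decides :: "('f + 'u, 'r) fm set \<Rightarrow> ('f + 'u, 'r) fm set \<Rightarrow> bool" where
  "decides p q \<longleftrightarrow> (\<forall>b\<in>realizations U ys q. proves U xs p (inst \<phi> ys b))"

lemma Dom_nonempty: "Dom U \<noteq> {}"
  using monster unfolding monster_model_def is_model_def is_struc_def by blast

lemma countable_Form: "countable Form"
proof (rule countable_formulas)
  show "countable_language (lang_params L A)"
    using countable_L A by (simp add: countable_language_def lang_params_def)
qed

lemma Form_Neg: "\<psi> \<in> Form \<Longrightarrow> Neg \<psi> \<in> Form" by (simp add: formulas_def)
lemma Form_And: "\<psi> \<in> Form \<Longrightarrow> \<eta> \<in> Form \<Longrightarrow> And \<psi> \<eta> \<in> Form" by (simp add: formulas_def)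

definition verum :: "('f + 'u, 'r) fm" where "verum = Ex 0 (Eq (Var 0) (Var 0))"

lemma verum: "verum \<in> Form" "sat (with_params U) v verum"
  using Dom_nonempty by (auto simp: verum_def formulas_def with_params_def)

sublocale stone: complemented U ys Form
proof
  show "\<exists>\<eta>\<in>Form. complementary U ys \<psi> \<eta>" if "\<psi> \<in> Form" for \<psi>
    using Form_Neg[OF that] by (intro bexI[of _ "Neg \<psi>"]) auto
  show "Form \<noteq> {}" using verum(1) by blast
qed

lemma Uy_nonempty: "Uy \<noteq> {}"
proof -
  obtain c where "c \<in> Dom U" using Dom_nonempty by blast
  then have "replicate (length ys) c \<in> Uy" by (auto simp: tuples_def)
  then show ?thesis by blast
qed

sublocale phi: complemented U xs "phi_formulas U \<phi> ys"
proof
  show "\<exists>\<eta>\<in>phi_formulas U \<phi> ys. complementary U xs \<psi> \<eta>" if \<psi>: "\<psi> \<in> phi_formulas U \<phi> ys" for \<psi>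
  proof -
    obtain b where "b \<in> Uy" "\<psi> = inst \<phi> ys b \<or> \<psi> = Neg (inst \<phi> ys b)"
      using \<psi> unfolding phi_formulas_def by blast
    moreover from this have "inst \<phi> ys b \<in> phi_formulas U \<phi> ys" "Neg (inst \<phi> ys b) \<in> phi_formulas U \<phi> ys"
      unfolding phi_formulas_def by blast+
    ultimately show ?thesis using complementary_Neg by blast
  qed
  show "phi_formulas U \<phi> ys \<noteq> {}" using Uy_nonempty by (auto simp: phi_formulas_def)
qed

lemma Sy_eq: "Sy = stone.types" by (simp add: complete_types_def)
lemma Sphi_eq: "Sphi = phi.types" by (simp add: phi_types_def)
lemma stone_topology_eq: "stone_topology L U A ys = type_topology U ys Form"
  by (simp add: stone_topology_def type_topology_def complete_types_def)
lemma phi_topology_eq: "phi_topology U \<phi> xs ys = type_topology U xs (phi_formulas U \<phi> ys)"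
  by (simp add: phi_topology_def type_topology_def phi_types_def)

lemma phi_formulasI: "b \<in> Uy \<Longrightarrow> inst \<phi> ys b \<in> phi_formulas U \<phi> ys \<and> Neg (inst \<phi> ys b) \<in> phi_formulas U \<phi> ys"
  unfolding phi_formulas_def by blast

lemma Neg_inst_iff:
  assumes "p \<in> Sphi" "b \<in> Uy" shows "Neg (inst \<phi> ys b) \<in> p \<longleftrightarrow> inst \<phi> ys b \<notin> p"
  using max_consistent_decides[OF assms(1)[unfolded phi_types_def]] phi_formulasI[OF assms(2)] by simp

lemma proves_iff:
  assumes "p \<in> Sphi" "b \<in> Uy" shows "proves U xs p (inst \<phi> ys b) \<longleftrightarrow> inst \<phi> ys b \<in> p"
proof
  assume "proves U xs p (inst \<phi> ys b)"
  then obtain F where F: "finite F" "F \<subseteq> p" "\<And>a. a \<in> Ux \<Longrightarrow> \<forall>\<theta>\<in>F. sat (with_params U) (asg xs a) \<theta> \<Longrightarrow>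
        sat (with_params U) (asg xs a) (inst \<phi> ys b)"
    unfolding proves_def by blast
  show "inst \<phi> ys b \<in> p"
    using max_consistent_closed_under_entailment[OF assms(1)[unfolded phi_types_def] _ F]
      phi_formulasI[OF assms(2)] by blast
next
  assume "inst \<phi> ys b \<in> p"
  then show "proves U xs p (inst \<phi> ys b)"
    unfolding proves_def by (intro exI[of _ "{inst \<phi> ys b}"]) simp
qed

lemma Inv_subset: "Inv \<subseteq> Sphi" by (auto simp: inv_phi_types_def)

lemma realization_exists:
  assumes "q \<in> Sy" obtains b where "b \<in> realizations U ys q"
proof (rule monster_realizes[OF monster A])
  show "distinct ys" using distinct by simp
  show "q \<subseteq> Form" "fin_sat U ys q" using assms by (auto simp: complete_types_def max_consistent_def)
qed

lemma tp_realization: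
  assumes "q \<in> Sy" "b \<in> realizations U ys q" shows "tp L U A ys b = q"
proof
  have b: "b \<in> Uy" "\<And>\<psi>. \<psi> \<in> q \<Longrightarrow> sat (with_params U) (asg ys b) \<psi>"
    using assms(2) by (auto simp: realizations_def)
  show "q \<subseteq> tp L U A ys b"
    using assms(1) b(2) by (auto simp: tp_def complete_types_def max_consistent_def)
  show "tp L U A ys b \<subseteq> q"
  proof
    fix \<psi> assume "\<psi> \<in> tp L U A ys b"
    then have \<psi>: "\<psi> \<in> Form" "sat (with_params U) (asg ys b) \<psi>" by (auto simp: tp_def)
    then have "Neg \<psi> \<notin> q" using b(2)[of "Neg \<psi>"] by auto
    then show "\<psi> \<in> q"
      using max_consistent_decides[OF assms(1)[unfolded complete_types_def] \<psi>(1) Form_Neg[OF \<psi>(1)]] by simp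
  qed
qed

lemma tp_complete:
  assumes "b \<in> Uy" shows "tp L U A ys b \<in> Sy" "b \<in> realizations U ys (tp L U A ys b)"
proof -
  show "b \<in> realizations U ys (tp L U A ys b)"
    using assms by (auto simp: realizations_def tp_def)
  then have "fin_sat U ys (tp L U A ys b)"
    unfolding fin_sat_def realizations_def by blast
  moreover have "\<exists>\<eta>\<in>tp L U A ys b. complementary U ys \<psi> \<eta>"
    if "\<psi> \<in> Form" "\<psi> \<notin> tp L U A ys b" for \<psi>
    using that Form_Neg by (intro bexI[of _ "Neg \<psi>"]) (auto simp: tp_def)
  ultimately show "tp L U A ys b \<in> Sy"
    unfolding complete_types_def by (intro max_consistentI) (auto simp: tp_def)
qed

lemma decides_iff:
  assumes "p \<in> Inv" "q \<in> Sy" "b \<in> realizations U ys q"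
  shows "decides p q \<longleftrightarrow> inst \<phi> ys b \<in> p"
proof -
  have p: "p \<in> Sphi" using assms(1) Inv_subset by blast
  have "proves U xs p (inst \<phi> ys b') \<longleftrightarrow> proves U xs p (inst \<phi> ys b)"
    if b': "b' \<in> realizations U ys q" for b'
  proof -
    have "tp L U A ys b' = tp L U A ys b"
      using tp_realization[OF assms(2)] b' assms(3) by metis
    moreover have "b' \<in> Uy" "b \<in> Uy" using b' assms(3) by (auto simp: realizations_def)
    ultimately show ?thesis using assms(1) unfolding inv_phi_types_def by blast
  qed
  moreover have "b \<in> Uy" using assms(3) by (auto simp: realizations_def)
  ultimately show ?thesis using assms(3) proves_iff[OF p] unfolding decides_def by blast
qed

lemma decides_tp:
  assumes "p \<in> Inv" "b \<in> Uy" shows "decides p (tp L U A ys b) \<longleftrightarrow> inst \<phi> ys b \<in> p"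
  using decides_iff[OF assms(1) tp_complete[OF assms(2)]] .

text \<open>The part of \<open>p\<close> that speaks of countably many \<open>b\<close> is realized in the model. This is how facts about
  the model, such as the bound on shattering, are brought to bear on global types.\<close>

lemma realize_phi_type:
  assumes "p \<in> Sphi" "B \<subseteq> Uy" "countable B"
  obtains a where "a \<in> Ux" "\<And>b. b \<in> B \<Longrightarrow> holds a b \<longleftrightarrow> inst \<phi> ys b \<in> p"
proof -
  define lit where "lit b = (if inst \<phi> ys b \<in> p then inst \<phi> ys b else Neg (inst \<phi> ys b))" for b
  have litp: "lit b \<in> p" if "b \<in> B" for b
    using that assms(2) Neg_inst_iff[OF assms(1)] by (auto simp: lit_def)
  let ?A = "\<Union>b\<in>B. set b"
  have A': "?A \<subseteq> Dom U" using assms(2) by (auto simp: tuples_def)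
  have cA: "countable ?A" by (rule countable_UN[OF assms(3)]) (simp add: countable_finite)
  have "distinct xs" using distinct by simp
  moreover have "lit ` B \<subseteq> formulas (lang_params L ?A) (set xs)"
  proof -
    have "inst \<phi> ys b \<in> formulas (lang_params L ?A) (set xs)" if "b \<in> B" for b
      by (rule inst_formulas(1)) (use that assms(2) in auto)
    then show ?thesis unfolding lit_def formulas_def by (auto simp: subset_iff)
  qed
  moreover have "fin_sat U xs (lit ` B)"
    by (rule fin_sat_mono[of _ _ p]) (use litp assms(1) in \<open>auto simp: phi_types_def max_consistent_def\<close>)
  ultimately obtain a where a: "a \<in> realizations U xs (lit ` B)"
    by (rule monster_realizes[OF monster A' cA])
  then have aU: "a \<in> Ux" by (simp add: realizations_def)
  moreover have "holds a b \<longleftrightarrow> inst \<phi> ys b \<in> p" if "b \<in> B" for b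
  proof -
    have "sat (with_params U) (asg xs a) (lit b)" using a that by (auto simp: realizations_def)
    then show ?thesis using sat_inst_holds(1)[OF aU, of b] that assms(2)
      by (auto simp: lit_def split: if_splits)
  qed
  ultimately show ?thesis using that by blast
qed

text \<open>Realizations of the types that shatter, over finitely many witnesses of the patterns, would be
  shattered tuples.\<close>

lemma invariant_types_not_shattering:
  obtains d :: nat where "\<And>g. (\<And>i. i < d \<Longrightarrow> g i \<in> Inv) \<Longrightarrow>
     \<not> (\<forall>S\<in>Pow {..<d}. \<exists>q\<in>Sy. \<forall>i<d. decides (g i) q \<longleftrightarrow> i \<in> S)"
proof -
  obtain d where d: "\<And>a. (\<And>i. i < d \<Longrightarrow> a i \<in> Ux) \<Longrightarrow> \<not> shattered d a"
    using shattering_bounded by metis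
  have *: "\<not> (\<forall>S\<in>Pow {..<d}. \<exists>q\<in>Sy. \<forall>i<d. decides (g i) q \<longleftrightarrow> i \<in> S)"
    if g: "\<And>i. i < d \<Longrightarrow> g i \<in> Inv" for g
  proof
    assume "\<forall>S\<in>Pow {..<d}. \<exists>q\<in>Sy. \<forall>i<d. decides (g i) q \<longleftrightarrow> i \<in> S"
    then obtain Q where Q: "\<And>S. S \<in> Pow {..<d} \<Longrightarrow> Q S \<in> Sy"
      "\<And>S i. S \<in> Pow {..<d} \<Longrightarrow> i < d \<Longrightarrow> decides (g i) (Q S) \<longleftrightarrow> i \<in> S" by metis
    then have "\<forall>S\<in>Pow {..<d}. \<exists>b. b \<in> realizations U ys (Q S)" using realization_exists by metis
    then obtain b where b: "\<And>S. S \<in> Pow {..<d} \<Longrightarrow> b S \<in> realizations U ys (Q S)" by metis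
    then have bU: "b ` Pow {..<d} \<subseteq> Uy" by (auto simp: realizations_def)
    have "\<exists>a\<in>Ux. \<forall>S\<in>Pow {..<d}. holds a (b S) \<longleftrightarrow> inst \<phi> ys (b S) \<in> g i" if "i < d" for i
    proof -
      have "g i \<in> Sphi" using g[OF that] Inv_subset by blast
      moreover have "countable (b ` Pow {..<d})" by (simp add: countable_finite)
      ultimately obtain c where "c \<in> Ux" "\<And>b'. b' \<in> b ` Pow {..<d} \<Longrightarrow> holds c b' \<longleftrightarrow> inst \<phi> ys b' \<in> g i"
        using realize_phi_type[OF _ bU] by metis
      then show ?thesis by blast
    qed
    then obtain a where a: "\<And>i. i < d \<Longrightarrow> a i \<in> Ux"
      "\<And>i S. i < d \<Longrightarrow> S \<in> Pow {..<d} \<Longrightarrow> holds (a i) (b S) \<longleftrightarrow> inst \<phi> ys (b S) \<in> g i" by metis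
    have "shattered d a"
      unfolding shattered_def
    proof
      fix S assume S: "S \<in> Pow {..<d}"
      have "holds (a i) (b S) \<longleftrightarrow> i \<in> S" if "i < d" for i
        using a(2)[OF that S] Q(2)[OF S that] decides_iff[OF g[OF that] Q(1)[OF S] b[OF S]] by simp
      then show "\<exists>b\<in>Uy. \<forall>i\<in>{..<d}. holds (a i) b \<longleftrightarrow> i \<in> S" using bU S by blast
    qed
    then show False using d a(1) by blast
  qed
  show ?thesis by (rule that[of d], rule *, blast)
qed

text \<open>A finite part of a type is implied by a single formula of it, so the basic open sets \<open>cl \<psi>\<close> see
  every finite part.\<close>

lemma finite_conjunction:
  assumes "q \<in> Sy" "finite F" "F \<subseteq> q"
  shows "\<exists>\<psi>\<in>q. \<forall>b\<in>Uy. sat (with_params U) (asg ys b) \<psi> \<longrightarrow> (\<forall>\<theta>\<in>F. sat (with_params U) (asg ys b) \<theta>)"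
  using assms(2,3)
proof (induction F rule: finite_induct)
  case empty
  have "verum \<in> q"
    by (rule max_consistent_closed_under_entailment[OF assms(1)[unfolded complete_types_def] verum(1), of "{}"])
      (auto simp: verum(2))
  then show ?case by auto
next
  case (insert \<theta> F)
  then obtain \<psi> where \<psi>: "\<psi> \<in> q"
    "\<forall>b\<in>Uy. sat (with_params U) (asg ys b) \<psi> \<longrightarrow> (\<forall>\<theta>\<in>F. sat (with_params U) (asg ys b) \<theta>)" by auto
  have qF: "q \<subseteq> Form" using assms(1) by (auto simp: complete_types_def max_consistent_def)
  have "And \<theta> \<psi> \<in> q"
  proof (rule max_consistent_closed_under_entailment[OF assms(1)[unfolded complete_types_def], of _ "{\<theta>, \<psi>}"])
    show "And \<theta> \<psi> \<in> Form" using Form_And insert.prems \<psi>(1) qF by blast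
  qed (use insert.prems \<psi>(1) in auto)
  then show ?case using \<psi>(2) by (intro bexI[of _ "And \<theta> \<psi>"]) auto
qed

text \<open>Some basic open set \<open>\<psi>\<close> meets \<open>F\<close> in a nonempty set on which \<open>p\<close> has only one value. Otherwise,
  for every \<open>n\<close> there are \<open>n\<close> tuples against which each \<open>q \<in> F\<close> has realizations of every pattern,
  and this exceeds the bound on shattering.\<close>

lemma not_dense_codense:
  assumes "p \<in> Inv" "F \<subseteq> Sy" "F \<noteq> {}"
  shows "\<exists>\<psi>\<in>Form. (\<exists>q\<in>F. \<psi> \<in> q) \<and>
    ((\<forall>q\<in>F. \<psi> \<in> q \<longrightarrow> decides p q) \<or> (\<forall>q\<in>F. \<psi> \<in> q \<longrightarrow> \<not> decides p q))"
proof (rule ccontr)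
  assume no: "\<not> ?thesis"
  define \<Psi> where "\<Psi> = {\<psi>\<in>Form. \<exists>q\<in>F. \<psi> \<in> q}"
  have "\<forall>\<psi>\<in>\<Psi>. \<forall>\<epsilon>. \<exists>q\<in>F. \<psi> \<in> q \<and> decides p q = \<epsilon>"
  proof (intro ballI allI)
    fix \<psi> \<epsilon> assume "\<psi> \<in> \<Psi>"
    then have "(\<exists>q\<in>F. \<psi> \<in> q \<and> \<not> decides p q) \<and> (\<exists>q\<in>F. \<psi> \<in> q \<and> decides p q)"
      using no unfolding \<Psi>_def by blast
    then show "\<exists>q\<in>F. \<psi> \<in> q \<and> decides p q = \<epsilon>" by (cases \<epsilon>) simp_all
  qed
  then obtain Q where Q: "\<And>\<psi> \<epsilon>. \<psi> \<in> \<Psi> \<Longrightarrow>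
      Q \<psi> \<epsilon> \<in> F \<and> \<psi> \<in> Q \<psi> \<epsilon> \<and> decides p (Q \<psi> \<epsilon>) = \<epsilon>" by metis
  have pS: "p \<in> Sphi" using assms(1) Inv_subset by blast
  have claim: "\<exists>a. (\<forall>i<n. a i \<in> Ux) \<and> (\<forall>q\<in>F. \<forall>S\<in>Pow {..<n}. \<exists>b\<in>realizations U ys q.
      \<forall>i\<in>{..<n}. holds (a i) b \<longleftrightarrow> i \<in> S)" for n :: nat
  proof (induction n)
    case 0
    have "\<exists>b. b \<in> realizations U ys q" if q: "q \<in> F" for q
      using realization_exists[of q] assms(2) q by blast
    then show ?case by auto
  next
    case (Suc n)
    then obtain a where a: "\<And>i. i < n \<Longrightarrow> a i \<in> Ux"
      "\<forall>q\<in>F. \<forall>S\<in>Pow {..<n}. \<exists>b\<in>realizations U ys q. \<forall>i\<in>{..<n}. holds (a i) b \<longleftrightarrow> i \<in> S" by metis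
    then obtain b where b: "\<And>q S. q \<in> F \<Longrightarrow> S \<in> Pow {..<n} \<Longrightarrow> b q S \<in> realizations U ys q"
      "\<And>q S i. q \<in> F \<Longrightarrow> S \<in> Pow {..<n} \<Longrightarrow> i < n \<Longrightarrow> holds (a i) (b q S) \<longleftrightarrow> i \<in> S"
      by (metis lessThan_iff)
    \<comment> \<open>The new tuple realizes \<open>p\<close> over realizations, of each pattern, of types in \<open>F\<close> of either
      value near any given type.\<close>
    define B where "B = (\<lambda>(\<psi>, \<epsilon>, S). b (Q \<psi> \<epsilon>) S) ` (\<Psi> \<times> UNIV \<times> Pow {..<n})"
    have "countable (\<Psi> \<times> (UNIV :: bool set) \<times> Pow {..<n})"
      unfolding \<Psi>_def using countable_Form by (intro countable_SIGMA countable_Collect) (auto intro: countable_finite)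
    then have cB: "countable B" unfolding B_def by (rule countable_image)
    have BU: "B \<subseteq> Uy" unfolding B_def using b(1) Q by (auto simp: realizations_def)
    obtain c where c: "c \<in> Ux" "\<And>b. b \<in> B \<Longrightarrow> holds c b \<longleftrightarrow> inst \<phi> ys b \<in> p"
      using realize_phi_type[OF pS BU cB] by blast
    have cb: "holds c (b (Q \<psi> \<epsilon>) S) \<longleftrightarrow> \<epsilon>" if "\<psi> \<in> \<Psi>" "S \<in> Pow {..<n}" for \<psi> \<epsilon> S
    proof -
      have "b (Q \<psi> \<epsilon>) S \<in> B" unfolding B_def using that by (intro image_eqI[of _ _ "(\<psi>, \<epsilon>, S)"]) auto
      moreover have "Q \<psi> \<epsilon> \<in> Sy" using Q[OF that(1)] assms(2) by blast
      ultimately show ?thesis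
        using c(2) decides_iff[OF assms(1) _ b(1)[OF _ that(2)]] Q[OF that(1)] by metis
    qed
    let ?a = "a(n := c)"
    have aU: "?a i \<in> Ux" if "i < Suc n" for i using that a(1) c(1) by auto
    have "\<exists>b\<in>realizations U ys q. \<forall>i\<in>{..<Suc n}. holds (?a i) b \<longleftrightarrow> i \<in> S"
      if q: "q \<in> F" and S: "S \<in> Pow {..<Suc n}" for q S
    proof -
      define lit where "lit i = (if i \<in> S then inst \<phi> xs (?a i) else Neg (inst \<phi> xs (?a i)))" for i
      let ?A = "A \<union> (\<Union>i\<in>{..<Suc n}. set (?a i))"
      have qSy: "q \<in> Sy" using q assms(2) by blast
      have qF: "q \<subseteq> Form" using qSy by (auto simp: complete_types_def max_consistent_def)
      have A': "?A \<subseteq> Dom U" using A(1) aU by (auto simp: tuples_def)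
      have cA: "countable ?A" using A(2) by (auto intro!: countable_Un countable_UN countable_finite)
      have mono: "Form \<subseteq> formulas (lang_params L ?A) (set ys)"
        using wf_fm_lang_params_mono[of L A _ ?A] by (auto simp: formulas_def)
      have lits: "lit ` {..<Suc n} \<subseteq> formulas (lang_params L ?A) (set ys)"
      proof -
        have "inst \<phi> xs (?a i) \<in> formulas (lang_params L ?A) (set ys)" if "i < Suc n" for i
          by (rule inst_formulas(2)[OF aU[OF that]]) (use that in blast)
        then show ?thesis unfolding lit_def formulas_def by (auto simp: subset_iff)
      qed
      have fin: "fin_sat U ys (q \<union> lit ` {..<Suc n})"
        unfolding fin_sat_def
      proof (intro allI impI)
        fix G assume G: "finite G \<and> G \<subseteq> q \<union> lit ` {..<Suc n}"
        obtain \<psi> where \<psi>: "\<psi> \<in> q" "\<And>b. b \<in> Uy \<Longrightarrow> sat (with_params U) (asg ys b) \<psi> \<Longrightarrow>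
           (\<forall>\<theta>\<in>G \<inter> q. sat (with_params U) (asg ys b) \<theta>)"
          using finite_conjunction[OF qSy, of "G \<inter> q"] G by blast
        then have \<psi>': "\<psi> \<in> \<Psi>" unfolding \<Psi>_def using q qF by blast
        \<comment> \<open>The type \<open>?Q\<close> is so close to \<open>q\<close> that it contains \<open>\<psi>\<close>, and its value is the one that
          the pattern prescribes for the new tuple.\<close>
        let ?S = "S \<inter> {..<n}" and ?Q = "Q \<psi> (n \<in> S)"
        let ?b = "b ?Q ?S"
        have S': "?S \<in> Pow {..<n}" by blast
        have QF: "?Q \<in> F" "\<psi> \<in> ?Q" using Q[OF \<psi>'] by auto
        have br: "?b \<in> realizations U ys ?Q" using b(1)[OF QF(1) S'] .
        then have bU: "?b \<in> Uy" and sat: "sat (with_params U) (asg ys ?b) \<psi>"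
          using QF(2) by (auto simp: realizations_def)
        have hb: "holds (?a i) ?b \<longleftrightarrow> i \<in> S" if "i < Suc n" for i
        proof (cases "i = n")
          case True
          then show ?thesis using cb[OF \<psi>' S', of "n \<in> S"] by simp
        next
          case False
          then show ?thesis using b(2)[OF QF(1) S', of i] that by simp
        qed
        have "sat (with_params U) (asg ys ?b) (lit i)" if "i < Suc n" for i
          using hb[OF that] sat_inst_holds(2)[OF aU[OF that] bU] by (auto simp: lit_def)
        then show "\<exists>b\<in>Uy. \<forall>\<theta>\<in>G. sat (with_params U) (asg ys b) \<theta>"
          using G \<psi>(2)[OF bU sat] bU by (intro bexI[of _ ?b]) auto
      qed
      have "q \<union> lit ` {..<Suc n} \<subseteq> formulas (lang_params L ?A) (set ys)" "distinct ys"
        using qF mono lits distinct by auto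
      then obtain e where e: "e \<in> realizations U ys (q \<union> lit ` {..<Suc n})"
        using fin by (metis monster_realizes[OF monster A' cA])
      then have er: "e \<in> realizations U ys q" "e \<in> Uy" by (auto simp: realizations_def)
      have "holds (?a i) e \<longleftrightarrow> i \<in> S" if "i < Suc n" for i
      proof -
        have "sat (with_params U) (asg ys e) (lit i)" using e that by (auto simp: realizations_def)
        then show ?thesis using sat_inst_holds(2)[OF aU[OF that] er(2)]
          by (auto simp: lit_def split: if_splits)
      qed
      then show ?thesis using er(1) by blast
    qed
    then show ?case using aU by blast
  qed
  obtain d where d: "\<And>a. (\<And>i. i < d \<Longrightarrow> a i \<in> Ux) \<Longrightarrow> \<not> shattered d a"
    using shattering_bounded by metis
  obtain a where a: "\<And>i. i < d \<Longrightarrow> a i \<in> Ux" 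
    "\<forall>q\<in>F. \<forall>S\<in>Pow {..<d}. \<exists>b\<in>realizations U ys q. \<forall>i\<in>{..<d}. holds (a i) b \<longleftrightarrow> i \<in> S"
    using claim[of d] by metis
  have "shattered d a"
    unfolding shattered_def
  proof
    fix S assume "S \<in> Pow {..<d}"
    then show "\<exists>b\<in>Uy. \<forall>i\<in>{..<d}. holds (a i) b \<longleftrightarrow> i \<in> S"
      using a(2) assms(3) unfolding realizations_def by blast
  qed
  then show False using d a(1) by blast
qed

end

section \<open>Sets that are both \<open>F\<^sub>\<sigma>\<close> and \<open>G\<^sub>\<delta>\<close>\<close>

text \<open>Call a member of \<open>\<B>\<close> good if \<open>A\<close> and the complement of \<open>A\<close> are \<open>F\<^sub>\<sigma>\<close> inside it. The union of the
  good members inherits this, as there are countably many of them. If it is not the whole space,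
  some member meets the closed rest \<open>F\<close>, and \<open>A\<close> contains or misses that part; hence this member is
  good as well, which is absurd.\<close>

lemma ambiguous_if_not_dense_codense:
  assumes "countable \<B>" "\<And>B. B \<in> \<B> \<Longrightarrow> openin X B \<and> closedin X B" "A \<subseteq> topspace X"
    and *: "\<And>F. closedin X F \<Longrightarrow> F \<noteq> {} \<Longrightarrow> \<exists>B\<in>\<B>. B \<inter> F \<noteq> {} \<and> (B \<inter> F \<subseteq> A \<or> B \<inter> F \<inter> A = {})"
  shows "fsigma_in X A \<and> gdelta_in X A"
proof -
  define good where "good = {B \<in> \<B>. fsigma_in X (B \<inter> A) \<and> fsigma_in X (B - A)}"
  define F where "F = topspace X - \<Union>good"
  have cg: "countable good" using assms(1) by (simp add: good_def)
  have clF: "closedin X F"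
    unfolding F_def using assms(2) by (intro closedin_diff openin_Union) (auto simp: good_def)
  have fs: "fsigma_in X (\<Union>((\<lambda>B. B \<inter> A) ` good))" "fsigma_in X (\<Union>((\<lambda>B. B - A) ` good))"
    using cg by (intro fsigma_in_Union; force simp: good_def)+
  have "F = {}"
  proof (rule ccontr)
    assume "F \<noteq> {}"
    then obtain B where B: "B \<in> \<B>" "B \<inter> F \<noteq> {}" "B \<inter> F \<subseteq> A \<or> B \<inter> F \<inter> A = {}"
      using *[OF clF] by blast
    have cB: "fsigma_in X B" "fsigma_in X (B \<inter> F)"
      using assms(2)[OF B(1)] clF by (auto intro: closed_imp_fsigma_in)
    have sub: "B \<subseteq> topspace X" using assms(2)[OF B(1)] closedin_subset by blast
    have 1: "fsigma_in X (B \<inter> \<Union>((\<lambda>B. B \<inter> A) ` good))" "fsigma_in X (B \<inter> \<Union>((\<lambda>B. B - A) ` good))"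
      using cB(1) fs by (auto intro: fsigma_in_Int)
    have split: "B = (B \<inter> F) \<union> (B \<inter> \<Union>good)" using sub by (auto simp: F_def)
    have "fsigma_in X (B \<inter> A) \<and> fsigma_in X (B - A)"
      using B(3)
    proof
      assume s: "B \<inter> F \<subseteq> A"
      have "B \<inter> A = (B \<inter> F) \<union> (B \<inter> \<Union>((\<lambda>B. B \<inter> A) ` good))" "B - A = B \<inter> \<Union>((\<lambda>B. B - A) ` good)"
        using split s by blast+
      then show ?thesis using 1 cB(2) fsigma_in_Un by metis
    next
      assume s: "B \<inter> F \<inter> A = {}"
      have "B - A = (B \<inter> F) \<union> (B \<inter> \<Union>((\<lambda>B. B - A) ` good))" "B \<inter> A = B \<inter> \<Union>((\<lambda>B. B \<inter> A) ` good)"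
        using split s by blast+
      then show ?thesis using 1 cB(2) fsigma_in_Un by metis
    qed
    then have "B \<in> good" using B(1) by (simp add: good_def)
    then show False using B(2) by (auto simp: F_def)
  qed
  then have W: "topspace X \<subseteq> \<Union>good" by (auto simp: F_def)
  have sub: "B \<subseteq> topspace X" if "B \<in> good" for B
    using that assms(2) openin_subset by (auto simp: good_def)
  have top: "topspace X = \<Union>good" using W sub by (intro equalityI Union_least)
  have "A = \<Union>((\<lambda>B. B \<inter> A) ` good)" using assms(3) unfolding top by auto
  moreover have "topspace X - A = \<Union>((\<lambda>B. B - A) ` good)" unfolding top by auto
  ultimately show ?thesis using fs assms(3) gdelta_in_fsigma_in by metis
qed

lemma fsigma_in_continuous_preimage:
  assumes "continuous_map X Y f" "fsigma_in Y A" shows "fsigma_in X {x \<in> topspace X. f x \<in> A}"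
proof -
  obtain \<C> where \<C>: "countable \<C>" "\<And>C. C \<in> \<C> \<Longrightarrow> closedin Y C" "\<Union>\<C> = A"
    using assms(2) unfolding fsigma_in_def union_of_def by blast
  have "{x \<in> topspace X. f x \<in> A} = \<Union>((\<lambda>C. {x \<in> topspace X. f x \<in> C}) ` \<C>)" using \<C>(3) by blast
  moreover have "fsigma_in X \<dots>"
    using \<C>(1,2) assms(1) by (intro fsigma_in_Union) (auto intro: closed_imp_fsigma_in closedin_continuous_map_preimage)
  ultimately show ?thesis by simp
qed

lemma gdelta_in_continuous_preimage:
  assumes "continuous_map X Y f" "gdelta_in Y A" shows "gdelta_in X {x \<in> topspace X. f x \<in> A}"
proof -
  have "fsigma_in X {x \<in> topspace X. f x \<in> topspace Y - A}"
    using fsigma_in_continuous_preimage[OF assms(1)] assms(2) gdelta_in_fsigma_in by metis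
  moreover have "{x \<in> topspace X. f x \<in> topspace Y - A} = topspace X - {x \<in> topspace X. f x \<in> A}"
    using continuous_map_image_subset_topspace[OF assms(1)] by blast
  ultimately show ?thesis by (auto simp: gdelta_in_fsigma_in)
qed

text \<open>Write \<open>A\<close> and its complement as increasing unions of closed sets; the \<open>n\<close>-th continuous function
  separates the \<open>n\<close>-th of them, by Urysohn's lemma.\<close>

lemma baire_one_indicator:
  assumes "normal_space X" "fsigma_in X A" "gdelta_in X A"
  shows "restrict (\<lambda>x. of_bool (x \<in> A)) (topspace X) \<in> baire_one X"
proof -
  have "fsigma_in X (topspace X - A)" using assms(3) by (simp add: gdelta_in_fsigma_in)
  then obtain D where D: "\<And>n. closedin X (D n)" "\<And>n. D n \<subseteq> D (Suc n)" "\<Union>(range D) = topspace X - A"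
    unfolding fsigma_in_ascending by blast
  obtain C where C: "\<And>n. closedin X (C n)" "\<And>n. C n \<subseteq> C (Suc n)" "\<Union>(range C) = A"
    using assms(2) unfolding fsigma_in_ascending by blast
  have "\<exists>g. continuous_map X euclideanreal g \<and> g ` D n \<subseteq> {0} \<and> g ` C n \<subseteq> {1}" for n
  proof -
    have "disjnt (D n) (C n)" using C(3) D(3) by (fastforce simp: disjnt_def)
    then show ?thesis using assms(1) C(1) D(1) unfolding normal_space_iff_Urysohn_alt by blast
  qed
  then obtain g where g: "\<And>n. continuous_map X euclideanreal (g n)" "\<And>n. g n ` D n \<subseteq> {0}" "\<And>n. g n ` C n \<subseteq> {1}"
    by metis
  have "(\<lambda>n. g n x) \<longlonglongrightarrow> of_bool (x \<in> A)" if x: "x \<in> topspace X" for x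
  proof (cases "x \<in> A")
    case True
    then obtain n where "x \<in> C n" using C(3) by blast
    then have "x \<in> C m" if "m \<ge> n" for m using lift_Suc_mono_le[of C n m] C(2) that by blast
    then have "\<forall>\<^sub>F m in sequentially. g m x = 1"
      using g(3) by (intro eventually_sequentiallyI[of n]) blast
    then show ?thesis using True by (simp add: tendsto_eventually)
  next
    case False
    then obtain n where "x \<in> D n" using D(3) x by blast
    then have "x \<in> D m" if "m \<ge> n" for m using lift_Suc_mono_le[of D n m] D(2) that by blast
    then have "\<forall>\<^sub>F m in sequentially. g m x = 0"
      using g(2) by (intro eventually_sequentiallyI[of n]) blast
    then show ?thesis using False by (simp add: tendsto_eventually)
  qed
  then have "\<forall>x\<in>topspace X. (\<lambda>n. g n x) \<longlonglongrightarrow> restrict (\<lambda>x. of_bool (x \<in> A)) (topspace X) x"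
    by simp
  then show ?thesis using g(1) unfolding baire_one_def by blast
qed

section \<open>Countable tightness\<close>

lemma gdelta_inE:
  assumes "gdelta_in Y G"
  obtains C :: "nat \<Rightarrow> 'a set" where "\<forall>n. openin Y (C n)" "\<Inter>(range C) = G"
proof -
  from assms obtain C :: "nat \<Rightarrow> 'a set"
    where C: "(\<forall>n. openin Y (C n)) \<and> (\<forall>n. C (Suc n) \<subseteq> C n) \<and> \<Inter>(range C) = G"
    unfolding gdelta_in_descending by (rule exE)
  show ?thesis by (rule that[of C]) (use C in auto)
qed

text \<open>The set and its complement would both be dense \<open>G\<^sub>\<delta>\<close> sets in the compact space \<open>F\<close>, and they are
  disjoint, against the Baire category theorem.\<close>

lemma ambiguous_not_dense_codense:
  assumes "compact_space Y" "Hausdorff_space Y" "fsigma_in Y G" "gdelta_in Y G"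
    and "closedin Y F" "F \<noteq> {}"
    and dense: "\<And>V. openin Y V \<Longrightarrow> V \<inter> F \<noteq> {} \<Longrightarrow> V \<inter> F \<inter> G \<noteq> {}"
    and codense: "\<And>V. openin Y V \<Longrightarrow> V \<inter> F \<noteq> {} \<Longrightarrow> V \<inter> F - G \<noteq> {}"
  shows False
proof -
  obtain C :: "nat \<Rightarrow> _" where C: "\<forall>n. openin Y (C n)" "\<Inter>(range C) = G"
    by (rule gdelta_inE[OF assms(4)])
  have coG: "gdelta_in Y (topspace Y - G)" using assms(3) by (simp add: fsigma_in_gdelta_in)
  obtain D :: "nat \<Rightarrow> _" where D: "\<forall>n. openin Y (D n)" "\<Inter>(range D) = topspace Y - G"
    by (rule gdelta_inE[OF coG])
  let ?F = "subtopology Y F"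
  let ?\<G> = "range (\<lambda>n. F \<inter> C n) \<union> range (\<lambda>n. F \<inter> D n)"
  have FY: "F \<subseteq> topspace Y" using assms(5) by (rule closedin_subset)
  then have top: "topspace ?F = F" by auto
  have "compact_space ?F" using assms(1,5) by (simp add: closedin_compact_space compact_space_subtopology)
  moreover have "Hausdorff_space ?F" using assms(2) by (rule Hausdorff_space_subtopology)
  ultimately have "locally_compact_space ?F" "regular_space ?F"
    using compact_imp_locally_compact_space compact_Hausdorff_imp_regular_space by blast+
  moreover have "openin ?F T \<and> ?F closure_of T = topspace ?F" if T: "T \<in> ?\<G>" for T
  proof
    show "openin ?F T" using T C(1) D(1) by (auto simp: openin_subtopology Int_commute)
    show "?F closure_of T = topspace ?F"
      unfolding dense_intersects_open
    proof (intro allI impI)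
      fix S assume "openin ?F S \<and> S \<noteq> {}"
      then obtain V where V: "openin Y V" "S = V \<inter> F" "V \<inter> F \<noteq> {}" by (auto simp: openin_subtopology)
      obtain y where y: "y \<in> V \<inter> F \<inter> G" using dense[OF V(1,3)] by blast
      obtain y' where y': "y' \<in> V \<inter> F - G" using codense[OF V(1,3)] by blast
      have "y \<in> C n" "y' \<in> D n" for n using y y' C(2) D(2) FY by blast+
      then show "T \<inter> S \<noteq> {}" using T V(2) y y' by blast
    qed
  qed
  ultimately have "?F closure_of \<Inter>?\<G> = topspace ?F"
    by (intro Baire_category) auto
  moreover have "\<Inter>?\<G> = {}"
  proof -
    have "\<Inter>?\<G> \<subseteq> \<Inter>(range C) \<inter> \<Inter>(range D)" by blast
    then show ?thesis using C(2) D(2) by blast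
  qed
  ultimately show False using top assms(6) by simp
qed

lemma second_countableE:
  assumes "second_countable X"
  obtains \<B> where "countable \<B>" "\<And>B. B \<in> \<B> \<Longrightarrow> openin X B"
    "\<And>V y. openin X V \<Longrightarrow> y \<in> V \<Longrightarrow> \<exists>B\<in>\<B>. y \<in> B \<and> B \<subseteq> V"
proof -
  from assms obtain \<B> where \<B>: "countable \<B> \<and> (\<forall>V\<in>\<B>. openin X V) \<and>
      (\<forall>U x. openin X U \<and> x \<in> U \<longrightarrow> (\<exists>V\<in>\<B>. x \<in> V \<and> V \<subseteq> U))"
    unfolding second_countable_def by (rule exE)
  show ?thesis by (rule that[of \<B>]) (use \<B> in auto)
qed

text \<open>Think of \<open>G g\<close> as the set where \<open>g\<close> agrees with the point to be approximated. Remove all basic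
  open sets that are covered by countably many \<open>G z\<close>; suppose that the closed rest \<open>F\<close> is
  nonempty. A sequence in \<open>Z\<close> can be chosen to cover eventually every point of a countable dense
  subset of \<open>F\<close>. Being countable, it leaves points uncovered in every open set that meets \<open>F\<close>.
  For an accumulation point \<open>g\<close> of the sequence, \<open>G g\<close> is therefore dense and codense in \<open>F\<close>.\<close>

lemma countable_subcover_of_finite_cover:
  fixes Y :: "'y topology" and G :: "'p \<Rightarrow> 'y set"
  assumes "compact_space Y" "Hausdorff_space Y" "second_countable Y"
    and ambiguous: "\<And>g. g \<in> K \<Longrightarrow> fsigma_in Y (G g) \<and> gdelta_in Y (G g)"
    and cluster: "\<And>z :: nat \<Rightarrow> 'p. range z \<subseteq> Z \<Longrightarrow> \<exists>g\<in>K. \<forall>y\<in>topspace Y.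
        ((\<forall>\<^sub>F k in sequentially. y \<in> G (z k)) \<longrightarrow> y \<in> G g) \<and>
        ((\<forall>\<^sub>F k in sequentially. y \<notin> G (z k)) \<longrightarrow> y \<notin> G g)"
    and finite: "\<And>E. finite E \<Longrightarrow> E \<subseteq> topspace Y \<Longrightarrow> \<exists>z\<in>Z. E \<subseteq> G z"
  shows "\<exists>C. C \<subseteq> Z \<and> countable C \<and> topspace Y \<subseteq> \<Union> (G ` C)"
proof -
  obtain \<B> where \<B>: "countable \<B>" "\<And>B. B \<in> \<B> \<Longrightarrow> openin Y B"
    "\<And>V y. openin Y V \<Longrightarrow> y \<in> V \<Longrightarrow> \<exists>B\<in>\<B>. y \<in> B \<and> B \<subseteq> V"
    using second_countableE[OF assms(3)] by metis
  define \<S> where "\<S> = {B \<in> \<B>. \<exists>C. C \<subseteq> Z \<and> countable C \<and> B \<subseteq> \<Union> (G ` C)}"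
  define F where "F = topspace Y - \<Union>\<S>"
  have "\<forall>B\<in>\<S>. \<exists>C. C \<subseteq> Z \<and> countable C \<and> B \<subseteq> \<Union> (G ` C)" by (simp add: \<S>_def)
  then obtain c where c: "\<And>B. B \<in> \<S> \<Longrightarrow> c B \<subseteq> Z \<and> countable (c B) \<and> B \<subseteq> \<Union> (G ` c B)" by metis
  let ?C0 = "\<Union> (c ` \<S>)"
  have "countable \<S>" using \<B>(1) by (simp add: \<S>_def)
  then have C0: "?C0 \<subseteq> Z" "countable ?C0" using c by (simp_all add: UN_least)
  have C0': "\<Union>\<S> \<subseteq> \<Union> (G ` ?C0)"
  proof
    fix y assume "y \<in> \<Union>\<S>"
    then obtain B where "B \<in> \<S>" "y \<in> B" by (rule UnionE)
    then have "y \<in> \<Union> (G ` c B)" "c B \<subseteq> ?C0" using c[of B] by (blast, blast)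
    then show "y \<in> \<Union> (G ` ?C0)" by auto
  qed
  show ?thesis
  proof (cases "F = {}")
    case True
    then show ?thesis using C0 C0' by (intro exI[of _ ?C0]) (auto simp: F_def)
  next
    case False
    have clF: "closedin Y F"
      unfolding F_def using \<B>(2) by (intro closedin_diff openin_Union) (auto simp: \<S>_def)
    define \<B>' where "\<B>' = {B \<in> \<B>. B \<inter> F \<noteq> {}}"
    have cB': "countable \<B>'" using \<B>(1) by (simp add: \<B>'_def)
    have ne: "\<B>' \<noteq> {}"
    proof -
      obtain y where "y \<in> F" using False by blast
      then obtain B where "B \<in> \<B>" "y \<in> B" using \<B>(3)[of "topspace Y" y] by (auto simp: F_def)
      then show ?thesis using \<open>y \<in> F\<close> by (auto simp: \<B>'_def)
    qed
    have uncovered: "\<exists>y. y \<in> B \<inter> F \<and> y \<notin> \<Union> (G ` C)"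
      if B: "B \<in> \<B>'" and C: "C \<subseteq> Z" "countable C" for B C
    proof (rule ccontr)
      assume "\<not> ?thesis"
      moreover have "B \<subseteq> topspace Y" using B \<B>(2) openin_subset by (auto simp: \<B>'_def)
      ultimately have "B \<subseteq> \<Union> (G ` C) \<union> \<Union>\<S>" by (auto simp: F_def)
      also have "\<dots> \<subseteq> \<Union> (G ` C) \<union> \<Union> (G ` ?C0)" using C0' by (rule Un_mono[OF subset_refl])
      also have "\<dots> = \<Union> (G ` (C \<union> ?C0))" by (simp only: image_Un Union_Un_distrib)
      finally have "B \<subseteq> \<Union> (G ` (C \<union> ?C0))" .
      moreover have "C \<union> ?C0 \<subseteq> Z" "countable (C \<union> ?C0)" using C C0 by simp_all
      ultimately have "B \<in> \<S>" using B unfolding \<S>_def \<B>'_def by blast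
      then show False using B by (auto simp: \<B>'_def F_def)
    qed
    define d where "d B = (SOME y. y \<in> B \<inter> F)" for B
    have d: "d B \<in> B \<inter> F" if "B \<in> \<B>'" for B
      using that some_in_eq[of "B \<inter> F"] by (simp add: \<B>'_def d_def)
    let ?e = "\<lambda>i. d (from_nat_into \<B>' i)"
    have eF: "?e i \<in> topspace Y" for i
      using d[OF from_nat_into[OF ne]] by (auto simp: F_def)
    have "\<exists>z. z \<in> Z \<and> ?e ` {..k} \<subseteq> G z" for k
      using finite[of "?e ` {..k}"] eF by blast
    then obtain z where z: "\<And>k. z k \<in> Z" "\<And>k. ?e ` {..k} \<subseteq> G (z k)" by metis
    have "range z \<subseteq> Z" "countable (range z)" using z(1) by auto
    then have "\<exists>y. y \<in> B \<inter> F \<and> y \<notin> \<Union> (G ` range z)" if "B \<in> \<B>'" for B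
      using uncovered that by blast
    then obtain d' where d': "\<And>B. B \<in> \<B>' \<Longrightarrow> d' B \<in> B \<inter> F \<and> d' B \<notin> \<Union> (G ` range z)" by metis
    obtain g where g: "g \<in> K" and
      g1: "\<And>y. y \<in> topspace Y \<Longrightarrow> (\<forall>\<^sub>F k in sequentially. y \<in> G (z k)) \<Longrightarrow> y \<in> G g" and
      g2: "\<And>y. y \<in> topspace Y \<Longrightarrow> (\<forall>\<^sub>F k in sequentially. y \<notin> G (z k)) \<Longrightarrow> y \<notin> G g"
      using cluster[OF \<open>range z \<subseteq> Z\<close>] by blast
    have in_g: "d B \<in> G g" if B: "B \<in> \<B>'" for B
    proof (rule g1)
      show "d B \<in> topspace Y" using d[OF B] by (auto simp: F_def)
      obtain i where i: "from_nat_into \<B>' i = B" using from_nat_into_surj[OF cB' B] by blast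
      show "\<forall>\<^sub>F k in sequentially. d B \<in> G (z k)"
      proof (rule eventually_sequentiallyI[of i])
        fix k assume "i \<le> k"
        then have "?e i \<in> ?e ` {..k}" by blast
        then show "d B \<in> G (z k)" using z(2) i by auto
      qed
    qed
    have notin_g: "d' B \<notin> G g" if B: "B \<in> \<B>'" for B
    proof (rule g2)
      show "d' B \<in> topspace Y" using d'[OF B] by (auto simp: F_def)
      show "\<forall>\<^sub>F k in sequentially. d' B \<notin> G (z k)" using d'[OF B] by simp
    qed
    have False
    proof (rule ambiguous_not_dense_codense[OF assms(1,2) _ _ clF False])
      show "fsigma_in Y (G g)" "gdelta_in Y (G g)" using ambiguous[OF g] by auto
      fix V assume V: "openin Y V" "V \<inter> F \<noteq> {}"
      then obtain y where "y \<in> V" "y \<in> F" by blast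
      then obtain B where "B \<in> \<B>" "y \<in> B" "B \<subseteq> V" using \<B>(3)[OF V(1)] by blast
      then have B: "B \<in> \<B>'" "B \<subseteq> V" using \<open>y \<in> F\<close> by (auto simp: \<B>'_def)
      show "V \<inter> F \<inter> G g \<noteq> {}" using d[OF B(1)] in_g[OF B(1)] B(2) by blast
      show "V \<inter> F - G g \<noteq> {}" using d'[OF B(1)] notin_g[OF B(1)] B(2) by blast
    qed
    then show ?thesis ..
  qed
qed

lemma second_countable_finite_power:
  assumes "second_countable X" shows "second_countable (product_topology (\<lambda>_. X) {..<n::nat})"
proof -
  obtain \<B> where \<B>: "countable \<B>" "\<And>B. B \<in> \<B> \<Longrightarrow> openin X B"
    "\<And>V y. openin X V \<Longrightarrow> y \<in> V \<Longrightarrow> \<exists>B\<in>\<B>. y \<in> B \<and> B \<subseteq> V"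
    using second_countableE[OF assms] by metis
  let ?\<B> = "(\<lambda>b. Pi\<^sub>E {..<n} b) ` (Pi\<^sub>E {..<n} (\<lambda>_. \<B>))"
  show ?thesis
    unfolding second_countable_def
  proof (intro exI[of _ ?\<B>] conjI ballI allI impI)
    show "countable ?\<B>" using \<B>(1) by (intro countable_image countable_PiE) auto
    show "openin (product_topology (\<lambda>_. X) {..<n}) V" if "V \<in> ?\<B>" for V
    proof -
      obtain b where "b \<in> Pi\<^sub>E {..<n} (\<lambda>_. \<B>)" "V = Pi\<^sub>E {..<n} b" using \<open>V \<in> ?\<B>\<close> by blast
      then have "\<forall>i\<in>{..<n}. openin X (b i)" using \<B>(2) by (meson PiE_mem)
      then show ?thesis unfolding \<open>V = Pi\<^sub>E {..<n} b\<close> by (simp add: openin_PiE_gen)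
    qed
    fix V t assume "openin (product_topology (\<lambda>_. X) {..<n}) V \<and> t \<in> V"
    then have "\<exists>W. finite {i \<in> {..<n}. W i \<noteq> topspace X} \<and> (\<forall>i\<in>{..<n}. openin X (W i)) \<and>
        t \<in> Pi\<^sub>E {..<n} W \<and> Pi\<^sub>E {..<n} W \<subseteq> V"
      unfolding openin_product_topology_alt by simp
    then obtain W where W: "\<forall>i\<in>{..<n}. openin X (W i)" "t \<in> Pi\<^sub>E {..<n} W" "Pi\<^sub>E {..<n} W \<subseteq> V"
      by (elim exE conjE)
    then have "\<forall>i\<in>{..<n}. \<exists>B\<in>\<B>. t i \<in> B \<and> B \<subseteq> W i" using \<B>(3) by (meson PiE_mem)
    then obtain b where b: "\<And>i. i \<in> {..<n} \<Longrightarrow> b i \<in> \<B> \<and> t i \<in> b i \<and> b i \<subseteq> W i" by metis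
    have "Pi\<^sub>E {..<n} (restrict b {..<n}) = Pi\<^sub>E {..<n} b" by (rule PiE_cong) simp
    moreover have "restrict b {..<n} \<in> Pi\<^sub>E {..<n} (\<lambda>_. \<B>)" using b by auto
    ultimately have "Pi\<^sub>E {..<n} b \<in> ?\<B>" by (metis image_eqI)
    moreover have "t \<in> Pi\<^sub>E {..<n} b" using W(2) b by (auto simp: PiE_iff)
    moreover have "Pi\<^sub>E {..<n} b \<subseteq> Pi\<^sub>E {..<n} W" by (rule PiE_mono) (use b in simp)
    then have "Pi\<^sub>E {..<n} b \<subseteq> V" using W(3) by simp
    ultimately show "\<exists>U\<in>?\<B>. t \<in> U \<and> U \<subseteq> V" by blast
  qed
qed

lemma fsigma_in_INT_finite:
  assumes "\<And>j. j < (n::nat) \<Longrightarrow> fsigma_in Y (A j)"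
  shows "fsigma_in Y {t \<in> topspace Y. \<forall>j<n. t \<in> A j}"
  using assms
proof (induction n)
  case (Suc n)
  have "{t \<in> topspace Y. \<forall>j<Suc n. t \<in> A j} = {t \<in> topspace Y. \<forall>j<n. t \<in> A j} \<inter> A n"
    using less_Suc_eq by auto
  then show ?case using Suc by (simp add: fsigma_in_Int)
qed simp

lemma gdelta_in_INT_finite:
  assumes "\<And>j. j < (n::nat) \<Longrightarrow> gdelta_in Y (A j)"
  shows "gdelta_in Y {t \<in> topspace Y. \<forall>j<n. t \<in> A j}"
  using assms
proof (induction n)
  case (Suc n)
  have "{t \<in> topspace Y. \<forall>j<Suc n. t \<in> A j} = {t \<in> topspace Y. \<forall>j<n. t \<in> A j} \<inter> A n"
    using less_Suc_eq by auto
  then show ?case using Suc by (simp add: gdelta_in_Int)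
qed simp

text \<open>Agreement on a finite set of \<open>n\<close> points is a matter of one point of the \<open>n\<close>-th power of \<open>X\<close>, so the
  covering lemma applies to all finite powers in turn.\<close>

lemma countable_tightness:
  fixes X :: "'x topology" and H :: "'p \<Rightarrow> 'x \<Rightarrow> bool"
  assumes X: "compact_space X" "Hausdorff_space X" "second_countable X"
    and ambiguous: "\<And>g. g \<in> K \<Longrightarrow>
        fsigma_in X {x \<in> topspace X. H g x} \<and> gdelta_in X {x \<in> topspace X. H g x}"
    and cluster: "\<And>z :: nat \<Rightarrow> 'p. range z \<subseteq> Z \<Longrightarrow> \<exists>g\<in>K. \<forall>E. finite E \<and> E \<subseteq> topspace X \<longrightarrow>
        (\<exists>\<^sub>F k in sequentially. \<forall>x\<in>E. H (z k) x = H g x)"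
    and f: "f \<in> K"
    and approx: "\<And>E. finite E \<Longrightarrow> E \<subseteq> topspace X \<Longrightarrow> \<exists>z\<in>Z. \<forall>x\<in>E. H z x = H f x"
  shows "\<exists>C. C \<subseteq> Z \<and> countable C \<and>
    (\<forall>E. finite E \<and> E \<subseteq> topspace X \<longrightarrow> (\<exists>z\<in>C. \<forall>x\<in>E. H z x = H f x))"
proof -
  have *: "\<exists>C. C \<subseteq> Z \<and> countable C \<and> (\<forall>t\<in>Pi\<^sub>E {..<n} (\<lambda>_. topspace X). \<exists>z\<in>C. \<forall>j<n. H z (t j) = H f (t j))"
    for n :: nat
  proof -
    define Y where "Y = product_topology (\<lambda>_. X) {..<n}"
    define G where "G g = {t \<in> topspace Y. \<forall>j<n. H g (t j) = H f (t j)}" for g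
    have topY: "topspace Y = Pi\<^sub>E {..<n} (\<lambda>_. topspace X)" by (simp add: Y_def)
    have "\<exists>C. C \<subseteq> Z \<and> countable C \<and> topspace Y \<subseteq> \<Union> (G ` C)"
    proof (rule countable_subcover_of_finite_cover[where K = K])
      show "compact_space Y" "Hausdorff_space Y"
        using X by (auto simp: Y_def compact_space_product_topology Hausdorff_space_product_topology)
      show "second_countable Y" unfolding Y_def by (rule second_countable_finite_power[OF X(3)])
      show "fsigma_in Y (G g) \<and> gdelta_in Y (G g)" if g: "g \<in> K" for g
      proof -
        let ?A = "{x \<in> topspace X. H g x}" and ?B = "{x \<in> topspace X. H f x}"
        let ?E = "(?A \<inter> ?B) \<union> ((topspace X - ?A) \<inter> (topspace X - ?B))"
        have E: "fsigma_in X ?E" "gdelta_in X ?E"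
          using ambiguous[OF g] ambiguous[OF f]
          by (auto intro!: fsigma_in_Un fsigma_in_Int fsigma_in_diff gdelta_in_Un gdelta_in_Int gdelta_in_diff)
        have proj: "continuous_map Y X (\<lambda>t. t j)" if "j < n" for j
          unfolding Y_def using that by (intro continuous_map_product_projection) simp
        let ?A' = "\<lambda>j. {t \<in> topspace Y. t j \<in> ?E}"
        have A': "fsigma_in Y (?A' j)" "gdelta_in Y (?A' j)" if "j < n" for j
          using fsigma_in_continuous_preimage[OF proj E(1)] gdelta_in_continuous_preimage[OF proj E(2)] that
          by auto
        have "G g = {t \<in> topspace Y. \<forall>j<n. t \<in> ?A' j}"
          unfolding G_def topY by (auto simp: PiE_iff)
        then show ?thesis using fsigma_in_INT_finite[OF A'(1)] gdelta_in_INT_finite[OF A'(2)] by simp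
      qed
      fix z :: "nat \<Rightarrow> 'p" assume rz: "range z \<subseteq> Z"
      obtain g where g: "g \<in> K" "\<And>E. finite E \<Longrightarrow> E \<subseteq> topspace X \<Longrightarrow>
        \<exists>\<^sub>F k in sequentially. \<forall>x\<in>E. H (z k) x = H g x"
        using cluster[OF rz] by (elim bexE) simp
      have "((\<forall>\<^sub>F k in sequentially. t \<in> G (z k)) \<longrightarrow> t \<in> G g) \<and>
          ((\<forall>\<^sub>F k in sequentially. t \<notin> G (z k)) \<longrightarrow> t \<notin> G g)" if t: "t \<in> topspace Y" for t
      proof -
        have "t ` {..<n} \<subseteq> topspace X" using t unfolding topY by auto
        then have fr: "\<exists>\<^sub>F k in sequentially. \<forall>x\<in>t ` {..<n}. H (z k) x = H g x" by (intro g(2)) auto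
        have same: "t \<in> G (z k) \<longleftrightarrow> t \<in> G g" if "\<forall>x\<in>t ` {..<n}. H (z k) x = H g x" for k
          using that t by (auto simp: G_def)
        have "\<exists>k. P k \<and> (t \<in> G (z k) \<longleftrightarrow> t \<in> G g)" if "\<forall>\<^sub>F k in sequentially. P k" for P
          using frequently_ex[OF frequently_rev_mp[OF fr, of "\<lambda>k. P k \<and> (t \<in> G (z k) \<longleftrightarrow> t \<in> G g)"]]
            eventually_mono[OF that, of "\<lambda>k. (\<forall>x\<in>t ` {..<n}. H (z k) x = H g x) \<longrightarrow> P k \<and> (t \<in> G (z k) \<longleftrightarrow> t \<in> G g)"]
            same by blast
        then show ?thesis by blast
      qed
      then show "\<exists>g\<in>K. \<forall>y\<in>topspace Y. ((\<forall>\<^sub>F k in sequentially. y \<in> G (z k)) \<longrightarrow> y \<in> G g) \<and>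
          ((\<forall>\<^sub>F k in sequentially. y \<notin> G (z k)) \<longrightarrow> y \<notin> G g)" using g(1) by blast
    next
      fix E assume E: "finite E" "E \<subseteq> topspace Y"
      let ?E = "\<Union>t\<in>E. t ` {..<n}"
      have "?E \<subseteq> topspace X" using E(2) unfolding topY by auto
      then obtain z where "z \<in> Z" "\<forall>x\<in>?E. H z x = H f x" using approx[of ?E] E(1) by auto
      then show "\<exists>z\<in>Z. E \<subseteq> G z" using E(2) by (intro bexI[of _ z]) (auto simp: G_def)
    qed
    then obtain C where C: "C \<subseteq> Z" "countable C" "topspace Y \<subseteq> \<Union> (G ` C)" by (elim exE conjE)
    have "\<exists>z\<in>C. \<forall>j<n. H z (t j) = H f (t j)" if "t \<in> topspace Y" for t
    proof -
      obtain z where "z \<in> C" "t \<in> G z" using C(3) \<open>t \<in> topspace Y\<close> by (meson UN_E subsetD)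
      then show ?thesis by (auto simp: G_def)
    qed
    then show ?thesis using C(1,2) unfolding topY by (intro exI[of _ C]) simp
  qed
  have "\<exists>C. \<forall>n::nat. C n \<subseteq> Z \<and> countable (C n) \<and>
      (\<forall>t\<in>Pi\<^sub>E {..<n} (\<lambda>_. topspace X). \<exists>z\<in>C n. \<forall>j<n. H z (t j) = H f (t j))"
    by (intro choice allI) (rule *)
  then obtain C where C0: "\<forall>n::nat. C n \<subseteq> Z \<and> countable (C n) \<and>
      (\<forall>t\<in>Pi\<^sub>E {..<n} (\<lambda>_. topspace X). \<exists>z\<in>C n. \<forall>j<n. H z (t j) = H f (t j))"
    by (rule exE)
  then have C: "\<And>n. C n \<subseteq> Z" "\<And>n. countable (C n)"
    "\<And>n t. t \<in> Pi\<^sub>E {..<n} (\<lambda>_. topspace X) \<Longrightarrow> \<exists>z\<in>C n. \<forall>j<n. H z (t j) = H f (t j)" by simp_all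
  have "\<exists>z\<in>\<Union> (range C). \<forall>x\<in>E. H z x = H f x" if E: "finite E" "E \<subseteq> topspace X" for E
  proof -
    obtain e where e: "bij_betw e {..<card E} E"
      using ex_bij_betw_nat_finite[OF E(1)] unfolding lessThan_atLeast0 by (rule exE)
    have "e j \<in> topspace X" if "j < card E" for j
      using bij_betwE[OF e] E(2) that by (meson lessThan_iff subsetD)
    then have "restrict e {..<card E} \<in> Pi\<^sub>E {..<card E} (\<lambda>_. topspace X)"
      by (simp add: PiE_iff)
    from C(3)[OF this] obtain z where z: "z \<in> C (card E)" "\<forall>j<card E. H z (e j) = H f (e j)" by auto
    have "H z x = H f x" if "x \<in> E" for x
    proof -
      have "x \<in> e ` {..<card E}" using e that by (simp add: bij_betw_def)
      then show ?thesis using z(2) by auto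
    qed
    then show ?thesis using z(1) by blast
  qed
  then show ?thesis using C(1,2) by (intro exI[of _ "\<Union> (range C)"]) auto
qed

section \<open>Convergent sequences from an ultrafilter\<close>

definition ultra :: "'a filter \<Rightarrow> bool" where
  "ultra \<U> \<longleftrightarrow> (\<forall>P. eventually (\<lambda>x. \<not> P x) \<U> \<longleftrightarrow> \<not> eventually P \<U>)"

text \<open>A maximal family of sets with the finite intersection property that contains the sets of \<open>F\<close>.\<close>

lemma ultrafilter_refinement:
  assumes "F \<noteq> bot" obtains \<U> where "\<U> \<le> F" "ultra \<U>"
proof -
  define fip :: "'a set set \<Rightarrow> bool" where
    "fip \<A> \<longleftrightarrow> (\<forall>\<F>. finite \<F> \<and> \<F> \<subseteq> \<A> \<longrightarrow> \<Inter>\<F> \<noteq> {})" for \<A>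
  let ?base = "{A. eventually (\<lambda>x. x \<in> A) F}"
  let ?M = "{\<A>. ?base \<subseteq> \<A> \<and> fip \<A>}"
  have "\<exists>\<A>\<in>?M. \<forall>\<B>\<in>?M. \<A> \<subseteq> \<B> \<longrightarrow> \<B> = \<A>"
  proof (rule subset_Zorn_nonempty)
    have "fip ?base"
      unfolding fip_def
    proof (intro allI impI)
      fix \<F> assume "finite \<F> \<and> \<F> \<subseteq> ?base"
      then have "\<forall>\<^sub>F x in F. \<forall>A\<in>\<F>. x \<in> A" by (intro eventually_ball_finite) auto
      then show "\<Inter>\<F> \<noteq> {}" using assms eventually_happens' by fastforce
    qed
    then show "?M \<noteq> {}" by blast
    fix \<C> assume ne: "\<C> \<noteq> {}" and \<C>: "subset.chain ?M \<C>"
    have "fip (\<Union>\<C>)"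
      unfolding fip_def
    proof (intro allI impI)
      fix \<F> assume F: "finite \<F> \<and> \<F> \<subseteq> \<Union>\<C>"
      then obtain \<A> where "\<A> \<in> \<C>" "\<F> \<subseteq> \<A>"
        using finite_subset_Union_chain[of \<F> \<C> ?M] \<C> ne by metis
      moreover from this have "fip \<A>" using \<C> unfolding subset.chain_def by blast
      ultimately show "\<Inter>\<F> \<noteq> {}" using F unfolding fip_def by blast
    qed
    moreover have "?base \<subseteq> \<Union>\<C>" using \<C> ne unfolding subset.chain_def by blast
    ultimately show "\<Union>\<C> \<in> ?M" by simp
  qed
  then obtain \<A> where \<A>0: "\<A> \<in> ?M" "\<forall>\<B>\<in>?M. \<A> \<subseteq> \<B> \<longrightarrow> \<B> = \<A>" by (rule bexE)
  then have \<A>: "?base \<subseteq> \<A>" "fip \<A>" by auto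
  have ins: "A \<in> \<A> \<or> (\<exists>\<F>. finite \<F> \<and> \<F> \<subseteq> \<A> \<and> A \<inter> \<Inter>\<F> = {})" for A
  proof (cases "fip (insert A \<A>)")
    case True
    then have "insert A \<A> \<in> ?M" using \<A>(1) by auto
    then show ?thesis using bspec[OF \<A>0(2), of "insert A \<A>"] by blast
  next
    case False
    then obtain \<F> where \<F>: "finite \<F>" "\<F> \<subseteq> insert A \<A>" "\<Inter>\<F> = {}" unfolding fip_def by blast
    then have "finite (\<F> - {A})" "\<F> - {A} \<subseteq> \<A>" "A \<inter> \<Inter>(\<F> - {A}) = {}" by blast+
    then show ?thesis by blast
  qed
  define \<U> where "\<U> = (INF A\<in>\<A>. principal A)"
  have ev: "eventually (\<lambda>x. x \<in> A) \<U>" if "A \<in> \<A>" for A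
    unfolding \<U>_def using that by (intro eventually_INF1[of A]) (auto simp: eventually_principal)
  have nb: "\<not> eventually (\<lambda>x. False) \<U>"
  proof
    assume "eventually (\<lambda>x. False) \<U>"
    then obtain \<F> where \<F>: "finite \<F>" "\<F> \<subseteq> \<A>" "eventually (\<lambda>x. False) (INF A\<in>\<F>. principal A)"
      using eventually_INF[of "\<lambda>x. False" principal \<A>] unfolding \<U>_def by metis
    then have "\<Inter>\<F> = {}" by (auto simp: INF_principal_finite eventually_principal)
    then show False using \<A>(2) \<F>(1,2) unfolding fip_def by blast
  qed
  have "\<U> \<le> F"
  proof (rule filter_leI)
    fix P assume "eventually P F"
    then have "{x. P x} \<in> \<A>" using \<A>(1) by auto
    then show "eventually P \<U>" using ev by fastforce
  qed
  moreover have "ultra \<U>"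
    unfolding ultra_def
  proof (intro allI iffI)
    fix P assume 1: "eventually (\<lambda>x. \<not> P x) \<U>"
    show "\<not> eventually P \<U>"
    proof
      assume "eventually P \<U>"
      with 1 have "eventually (\<lambda>x. False) \<U>" by eventually_elim simp
      then show False using nb by simp
    qed
  next
    fix P assume "\<not> eventually P \<U>"
    then have "{x. P x} \<notin> \<A>" using ev by fastforce
    then obtain \<F> where \<F>: "finite \<F>" "\<F> \<subseteq> \<A>" "{x. P x} \<inter> \<Inter>\<F> = {}"
      using ins[of "{x. P x}"] by (elim disjE exE conjE) simp_all
    have "\<forall>\<^sub>F x in \<U>. \<forall>A\<in>\<F>. x \<in> A" using \<F> ev by (intro eventually_ball_finite) auto
    then show "eventually (\<lambda>x. \<not> P x) \<U>" by (rule eventually_mono) (use \<F>(3) in blast)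
  qed
  ultimately show ?thesis using that by blast
qed

lemma ultra_ex:
  assumes "ultra \<U>" "eventually P \<U>" shows "\<exists>x. P x"
proof (rule ccontr)
  assume "\<nexists>x. P x"
  with assms(2) have "eventually (\<lambda>x. False) \<U>" by (auto elim: eventually_mono)
  then show False using assms(1)[unfolded ultra_def, rule_format, of "\<lambda>x. False"] by simp
qed

text \<open>\<open>iterated \<U> k P gs\<close> says that \<open>P (gs @ [g\<^sub>1, \<dots>, g\<^sub>k])\<close> holds for most \<open>g\<^sub>1\<close>, for most \<open>g\<^sub>2\<close> depending on
  \<open>g\<^sub>1\<close>, and so on.\<close>

primrec iterated :: "'a filter \<Rightarrow> nat \<Rightarrow> ('a list \<Rightarrow> bool) \<Rightarrow> 'a list \<Rightarrow> bool" where
  "iterated \<U> 0 P gs = P gs"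
| "iterated \<U> (Suc k) P gs = (\<forall>\<^sub>F g in \<U>. iterated \<U> k P (gs @ [g]))"

lemma iterated_not: "ultra \<U> \<Longrightarrow> iterated \<U> k (\<lambda>gs. \<not> P gs) gs = (\<not> iterated \<U> k P gs)"
  by (induction k arbitrary: gs) (simp_all add: ultra_def)

lemma iterated_ball:
  "finite I \<Longrightarrow> iterated \<U> k (\<lambda>gs. \<forall>S\<in>I. P S gs) gs = (\<forall>S\<in>I. iterated \<U> k (P S) gs)"
  by (induction k arbitrary: gs) (simp_all add: eventually_ball_finite_distrib)

lemma iterated_ex:
  assumes "ultra \<U>" "eventually (\<lambda>g. g \<in> Z) \<U>"
  shows "iterated \<U> k P gs \<Longrightarrow> \<exists>hs. length hs = k \<and> set hs \<subseteq> Z \<and> P (gs @ hs)"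
proof (induction k arbitrary: gs)
  case (Suc k)
  then have "\<forall>\<^sub>F g in \<U>. g \<in> Z \<and> iterated \<U> k P (gs @ [g])" using assms(2) by (simp add: eventually_conj)
  then obtain g where "g \<in> Z" "iterated \<U> k P (gs @ [g])" using ultra_ex[OF assms(1)] by blast
  moreover from this obtain hs where "length hs = k" "set hs \<subseteq> Z" "P ((gs @ [g]) @ hs)" using Suc.IH by blast
  ultimately show ?case by (intro exI[of _ "g # hs"]) simp
qed simp

text \<open>For some pattern \<open>S\<close>, most sequences of length \<open>d\<close>, in the iterated sense, do not realize \<open>S\<close>.
  The countably many sets \<open>B gs\<close> of the ultrafilter contain the permitted continuations of \<open>gs\<close>.
  Given a point \<open>x\<close>, try to realize \<open>S\<close> at \<open>x\<close> by choosing \<open>g\<^sub>i\<close> from these sets. The attempt must get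
  stuck, and it can only get stuck at a set \<open>B gs\<close> all of whose members agree with \<open>f\<close> at \<open>x\<close>,
  because agreement with \<open>f\<close> can always be chosen.\<close>

lemma convergent_sequence_if_not_shattering:
  fixes H :: "'p \<Rightarrow> 'x \<Rightarrow> bool" and d :: nat
  assumes "countable Z"
    and not_shattering: "\<And>g. (\<And>i. i < d \<Longrightarrow> g i \<in> Z) \<Longrightarrow>
       \<not> (\<forall>S\<in>Pow {..<d}. \<exists>x\<in>X. \<forall>i<d. H (g i) x \<longleftrightarrow> i \<in> S)"
    and approx: "\<And>E. finite E \<Longrightarrow> E \<subseteq> X \<Longrightarrow> \<exists>z\<in>Z. \<forall>x\<in>E. H z x = H f x"
  shows "\<exists>s :: nat \<Rightarrow> 'p. range s \<subseteq> Z \<and> (\<forall>x\<in>X. \<forall>\<^sub>F k in sequentially. H (s k) x = H f x)"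
proof -
  let ?Fin = "{E. finite E \<and> E \<subseteq> X}" and ?agree = "\<lambda>E. {z \<in> Z. \<forall>x\<in>E. H z x = H f x}"
  define \<F> where "\<F> = (INF E\<in>?Fin. principal (?agree E))"
  have ev\<F>: "eventually P \<F> \<longleftrightarrow> (\<exists>E\<in>?Fin. eventually P (principal (?agree E)))" for P
    unfolding \<F>_def
  proof (rule eventually_INF_base)
    fix E E' assume "E \<in> ?Fin" "E' \<in> ?Fin"
    then show "\<exists>D\<in>?Fin. principal (?agree D) \<le> inf (principal (?agree E)) (principal (?agree E'))"
      by (intro bexI[of _ "E \<union> E'"]) auto
  qed auto
  have "\<F> \<noteq> bot"
  proof
    assume "\<F> = bot"
    then have "eventually (\<lambda>_. False) \<F>" by simp
    then obtain E where "finite E" "E \<subseteq> X" "?agree E = {}" by (auto simp: ev\<F> eventually_principal)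
    then show False using approx[of E] by blast
  qed
  then obtain \<U> where \<U>: "\<U> \<le> \<F>" "ultra \<U>" by (rule ultrafilter_refinement)
  have evZ: "\<forall>\<^sub>F z in \<U>. z \<in> Z"
    by (rule filter_leD[OF \<U>(1)]) (auto simp: ev\<F> eventually_principal)
  have ev: "\<forall>\<^sub>F z in \<U>. H z x = H f x" if "x \<in> X" for x
    by (rule filter_leD[OF \<U>(1)], unfold ev\<F>, rule bexI[of _ "{x}"])
      (use that in \<open>auto simp: eventually_principal\<close>)
  define realized where "realized S gs \<longleftrightarrow> (\<exists>x\<in>X. \<forall>i<d. H (gs ! i) x \<longleftrightarrow> i \<in> S)" for S gs
  obtain S where S: "S \<subseteq> {..<d}" "iterated \<U> d (\<lambda>gs. \<not> realized S gs) []"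
  proof (rule ccontr)
    assume "\<not> thesis"
    then have "\<forall>S\<in>Pow {..<d}. iterated \<U> d (realized S) []" using that iterated_not[OF \<U>(2)] by blast
    then have "iterated \<U> d (\<lambda>gs. \<forall>S\<in>Pow {..<d}. realized S gs) []" by (simp add: iterated_ball)
    then obtain hs where "length hs = d" "set hs \<subseteq> Z" "\<forall>S\<in>Pow {..<d}. realized S hs"
      using iterated_ex[OF \<U>(2) evZ] by fastforce
    then show False using not_shattering[of "(!) hs"] unfolding realized_def by (auto simp: subset_iff)
  qed
  define B where "B gs = {g \<in> Z. iterated \<U> (d - Suc (length gs)) (\<lambda>gs. \<not> realized S gs) (gs @ [g])}" for gs
  define I where "I = {gs \<in> lists Z. \<forall>\<^sub>F g in \<U>. g \<in> B gs}"
  have cI: "countable I" using assms(1) by (auto simp: I_def)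
  have main: "\<exists>gs\<in>I. \<forall>g\<in>B gs. H g x = H f x"
    if x: "x \<in> X" and "set gs \<subseteq> Z" "length gs + k = d" "iterated \<U> k (\<lambda>gs. \<not> realized S gs) gs"
      "\<forall>i<length gs. H (gs ! i) x \<longleftrightarrow> i \<in> S" for x gs k
    using that(2-)
  proof (induction k arbitrary: gs)
    case 0
    then have "realized S gs" using x unfolding realized_def by auto
    then show ?case using 0 by simp
  next
    case (Suc k)
    have k: "d - Suc (length gs) = k" using Suc.prems(2) by simp
    have evB: "\<forall>\<^sub>F g in \<U>. g \<in> B gs"
      using Suc.prems(3) evZ by (simp add: B_def k eventually_conj)
    then have gsI: "gs \<in> I" using Suc.prems(1) by (auto simp: I_def)
    show ?case
    proof (cases "\<forall>g\<in>B gs. H g x = H f x")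
      case True
      then show ?thesis using gsI by blast
    next
      case False
      then obtain g1 where g1: "g1 \<in> B gs" "H g1 x \<noteq> H f x" by blast
      obtain g2 where g2: "g2 \<in> B gs" "H g2 x = H f x"
        using ultra_ex[OF \<U>(2) eventually_conj[OF evB ev[OF x]]] by blast
      obtain g where g: "g \<in> B gs" "H g x \<longleftrightarrow> length gs \<in> S" using g1 g2 by metis
      have "\<exists>gs\<in>I. \<forall>g\<in>B gs. H g x = H f x"
      proof (rule Suc.IH[of "gs @ [g]"])
        show "set (gs @ [g]) \<subseteq> Z" using Suc.prems(1) g(1) by (auto simp: B_def)
        show "length (gs @ [g]) + k = d" using Suc.prems(2) by simp
        show "iterated \<U> k (\<lambda>gs. \<not> realized S gs) (gs @ [g])" using g(1) by (simp add: B_def k)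
        show "\<forall>i<length (gs @ [g]). H ((gs @ [g]) ! i) x \<longleftrightarrow> i \<in> S"
          using Suc.prems(4) g(2) by (auto simp: nth_append less_Suc_eq)
      qed
      then show ?thesis .
    qed
  qed
  let ?e = "from_nat_into I"
  have "\<exists>g. g \<in> Z \<and> (\<forall>i\<in>{..k}. ?e i \<in> I \<longrightarrow> g \<in> B (?e i))" for k
  proof -
    have "\<forall>\<^sub>F g in \<U>. \<forall>i\<in>{..k}. ?e i \<in> I \<longrightarrow> g \<in> B (?e i)"
      by (intro eventually_ball_finite) (auto simp: I_def)
    then show ?thesis using ultra_ex[OF \<U>(2) eventually_conj[OF evZ]] by blast
  qed
  then obtain s where s: "\<And>k. s k \<in> Z" "\<And>k i. i \<le> k \<Longrightarrow> ?e i \<in> I \<Longrightarrow> s k \<in> B (?e i)"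
    by (metis atMost_iff)
  have "\<forall>\<^sub>F k in sequentially. H (s k) x = H f x" if x: "x \<in> X" for x
  proof -
    obtain gs where gs: "gs \<in> I" "\<forall>g\<in>B gs. H g x = H f x"
      using main[OF x, of "[]" d] S(2) by auto
    obtain i where i: "?e i = gs" using from_nat_into_surj[OF cI gs(1)] by blast
    then have "H (s k) x = H f x" if "k \<ge> i" for k using s(2)[OF that] gs by simp
    then show ?thesis by (rule eventually_sequentiallyI)
  qed
  then show ?thesis using s(1) by blast
qed

section \<open>The space of invariant types\<close>

lemma continuous_map_indicator:
  assumes "openin X {x \<in> topspace X. P x}" "openin X {x \<in> topspace X. \<not> P x}"
  shows "continuous_map X euclideanreal (\<lambda>x. of_bool (P x))"
  unfolding continuous_map_def
proof (intro conjI allI impI)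
  fix V :: "real set"
  have "{x \<in> topspace X. of_bool (P x) \<in> V} =
    (if 1 \<in> V then {x \<in> topspace X. P x} else {}) \<union> (if 0 \<in> V then {x \<in> topspace X. \<not> P x} else {})"
    by auto
  then show "openin X {x \<in> topspace X. of_bool (P x) \<in> V}" using assms by auto
qed auto

lemma baire_one_compose:
  assumes "f \<in> baire_one X" "continuous_map Y X h"
  shows "restrict (f \<circ> h) (topspace Y) \<in> baire_one Y"
proof -
  obtain g where g: "\<And>n::nat. continuous_map X euclideanreal (g n)"
    "\<And>x. x \<in> topspace X \<Longrightarrow> (\<lambda>n. g n x) \<longlonglongrightarrow> f x"
    using assms(1) unfolding baire_one_def by blast
  have "h y \<in> topspace X" if "y \<in> topspace Y" for y
    using continuous_map_image_subset_topspace[OF assms(2)] that by blast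
  then have "\<forall>y\<in>topspace Y. (\<lambda>n. (g n \<circ> h) y) \<longlonglongrightarrow> restrict (f \<circ> h) (topspace Y) y"
    using g(2) by simp
  moreover have "\<forall>n. continuous_map Y euclideanreal (g n \<circ> h)"
    using g(1) assms(2) continuous_map_compose by blast
  ultimately show ?thesis
    unfolding baire_one_def by (intro CollectI conjI exI[of _ "\<lambda>n. g n \<circ> h"]) auto
qed

context countable_base
begin

abbreviation "W \<equiv> stone_topology L U A ys"
abbreviation "P \<equiv> phi_topology U \<phi> xs ys"

lemma topspace_W: "topspace W = Sy"
  by (simp add: stone_topology_eq stone.topspace_type_topology Sy_eq)

lemma topspace_P: "topspace P = Sphi"
  by (simp add: phi_topology_eq phi.topspace_type_topology Sphi_eq)

lemma compact_W: "compact_space W" and Hausdorff_W: "Hausdorff_space W"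
  by (simp_all add: stone_topology_eq stone.compact stone.Hausdorff)

lemma compact_P: "compact_space P" and Hausdorff_P: "Hausdorff_space P"
  by (simp_all add: phi_topology_eq phi.compact phi.Hausdorff)

lemma openin_W: "\<psi> \<in> Form \<Longrightarrow> openin W {q \<in> Sy. \<psi> \<in> q}"
  using stone.openin_cl by (simp add: stone_topology_eq Sy_eq)

lemma closedin_W: "\<psi> \<in> Form \<Longrightarrow> closedin W {q \<in> Sy. \<psi> \<in> q}"
  using stone.closedin_cl by (simp add: stone_topology_eq Sy_eq)

lemma And_mem:
  assumes "q \<in> Sy" "\<psi> \<in> Form" "\<eta> \<in> Form" shows "And \<psi> \<eta> \<in> q \<longleftrightarrow> \<psi> \<in> q \<and> \<eta> \<in> q"
proof -
  obtain b where b: "b \<in> realizations U ys q" using realization_exists[OF assms(1)] .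
  have "\<theta> \<in> q \<longleftrightarrow> sat (with_params U) (asg ys b) \<theta>" if "\<theta> \<in> Form" for \<theta>
    using tp_realization[OF assms(1) b] that unfolding tp_def by blast
  then show ?thesis using assms Form_And by auto
qed

lemma basis_W:
  assumes "openin W V" "q \<in> V"
  shows "\<exists>\<psi>\<in>Form. \<psi> \<in> q \<and> {q \<in> Sy. \<psi> \<in> q} \<subseteq> V"
proof -
  have "generate_topology_on ((\<lambda>\<psi>. {q \<in> Sy. \<psi> \<in> q}) ` Form) V"
    using assms(1) by (simp add: stone_topology_def openin_topology_generated_by_iff)
  then show ?thesis using assms(2)
  proof (induction rule: generate_topology_on.induct)
    case (Int V V')
    then obtain \<psi> \<psi>' where p: "\<psi> \<in> Form" "\<psi> \<in> q" "{q \<in> Sy. \<psi> \<in> q} \<subseteq> V"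
      "\<psi>' \<in> Form" "\<psi>' \<in> q" "{q \<in> Sy. \<psi>' \<in> q} \<subseteq> V'" by blast
    have "q \<in> Sy"
      using Int.hyps(1) Int.prems openin_subset[of W V] topspace_W
      by (auto simp: stone_topology_def openin_topology_generated_by_iff)
    then show ?case using p And_mem Form_And by (intro bexI[of _ "And \<psi> \<psi>'"]) auto
  next
    case (UN K)
    then show ?case by (meson Union_iff Union_upper subset_trans)
  qed auto
qed

lemma second_countable_W: "second_countable W"
  unfolding second_countable_def
proof (intro exI[of _ "(\<lambda>\<psi>. {q \<in> Sy. \<psi> \<in> q}) ` Form"] conjI ballI allI impI)
  show "countable ((\<lambda>\<psi>. {q \<in> Sy. \<psi> \<in> q}) ` Form)" using countable_Form by simp
  show "openin W V" if "V \<in> (\<lambda>\<psi>. {q \<in> Sy. \<psi> \<in> q}) ` Form" for V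
    using that openin_W by blast
  fix V q assume V: "openin W V \<and> q \<in> V"
  then have "q \<in> Sy" using openin_subset topspace_W by blast
  then show "\<exists>B\<in>(\<lambda>\<psi>. {q \<in> Sy. \<psi> \<in> q}) ` Form. q \<in> B \<and> B \<subseteq> V"
  proof -
    obtain \<psi> where "\<psi> \<in> Form" "\<psi> \<in> q" "{q \<in> Sy. \<psi> \<in> q} \<subseteq> V" using basis_W[of V q] V by blast
    then show ?thesis using \<open>q \<in> Sy\<close> by (intro bexI[of _ "{q \<in> Sy. \<psi> \<in> q}"]) auto
  qed
qed

lemma defining_set_eq: "defining_set L U A \<phi> xs ys p = {q \<in> Sy. decides p q}"
  by (simp add: defining_set_def decides_def)

lemma defining_set_ambiguous:
  assumes "p \<in> Inv"
  shows "fsigma_in W {q \<in> Sy. decides p q} \<and> gdelta_in W {q \<in> Sy. decides p q}"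
proof (rule ambiguous_if_not_dense_codense[where \<B> = "(\<lambda>\<psi>. {q \<in> Sy. \<psi> \<in> q}) ` Form"])
  show "countable ((\<lambda>\<psi>. {q \<in> Sy. \<psi> \<in> q}) ` Form)" using countable_Form by simp
  show "openin W B \<and> closedin W B" if "B \<in> (\<lambda>\<psi>. {q \<in> Sy. \<psi> \<in> q}) ` Form" for B
    using that openin_W closedin_W by blast
  show "{q \<in> Sy. decides p q} \<subseteq> topspace W" by (auto simp: topspace_W)
  fix F assume F: "closedin W F" "F \<noteq> {}"
  then have FS: "F \<subseteq> Sy" using closedin_subset topspace_W by blast
  obtain \<psi> where \<psi>: "\<psi> \<in> Form" "\<exists>q\<in>F. \<psi> \<in> q"
    "(\<forall>q\<in>F. \<psi> \<in> q \<longrightarrow> decides p q) \<or> (\<forall>q\<in>F. \<psi> \<in> q \<longrightarrow> \<not> decides p q)"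
    using not_dense_codense[OF assms FS F(2)] by blast
  then show "\<exists>B\<in>(\<lambda>\<psi>. {q \<in> Sy. \<psi> \<in> q}) ` Form. B \<inter> F \<noteq> {} \<and>
      (B \<inter> F \<subseteq> {q \<in> Sy. decides p q} \<or> B \<inter> F \<inter> {q \<in> Sy. decides p q} = {})"
    using FS by (intro bexI[of _ "{q \<in> Sy. \<psi> \<in> q}"]) auto
qed

lemma borel_definable_Inv:
  assumes "p \<in> Inv" shows "borel_definable L U A \<phi> xs ys p"
proof -
  let ?\<B> = "sigma_sets Sy {V. openin W V}"
  obtain C where C: "\<And>n::nat. closedin W (C n)" "\<Union>(range C) = {q \<in> Sy. decides p q}"
    using defining_set_ambiguous[OF assms] unfolding fsigma_in_ascending by blast
  have "C n \<in> ?\<B>" for n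
  proof -
    have "Sy - C n \<in> ?\<B>" using C(1) unfolding closedin_def topspace_W by blast
    then have "Sy - (Sy - C n) \<in> ?\<B>" by (rule sigma_sets.Compl)
    moreover have "Sy - (Sy - C n) = C n" using C(1) closedin_subset topspace_W by blast
    ultimately show ?thesis by simp
  qed
  then have "\<Union>(range C) \<in> ?\<B>" by (rule sigma_sets.Union)
  then show ?thesis unfolding borel_definable_def defining_set_eq C(2) .
qed

lemma Inv_iff:
  "p \<in> Inv \<longleftrightarrow> p \<in> Sphi \<and> (\<forall>b\<in>Uy. \<forall>b'\<in>Uy. tp L U A ys b = tp L U A ys b' \<longrightarrow>
     (inst \<phi> ys b \<in> p \<longleftrightarrow> inst \<phi> ys b' \<in> p))"
  unfolding inv_phi_types_def using proves_iff by blast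

lemma openin_P:
  assumes "b \<in> Uy"
  shows "openin P {p \<in> Sphi. inst \<phi> ys b \<in> p}" "openin P {p \<in> Sphi. inst \<phi> ys b \<notin> p}"
proof -
  have o: "openin P {p \<in> Sphi. \<psi> \<in> p}" if "\<psi> \<in> phi_formulas U \<phi> ys" for \<psi>
    using phi.openin_cl[OF that] by (simp add: phi_topology_eq Sphi_eq)
  show "openin P {p \<in> Sphi. inst \<phi> ys b \<in> p}" using o phi_formulasI[OF assms] by blast
  have "{p \<in> Sphi. inst \<phi> ys b \<notin> p} = {p \<in> Sphi. Neg (inst \<phi> ys b) \<in> p}"
    using Neg_inst_iff[OF _ assms] by blast
  then show "openin P {p \<in> Sphi. inst \<phi> ys b \<notin> p}" using o phi_formulasI[OF assms] by simp
qed

text \<open>Failure of invariance at a pair \<open>b\<close>, \<open>b'\<close> is an open condition.\<close>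

lemma closedin_Inv: "closedin P Inv"
  unfolding closedin_def
proof
  show "Inv \<subseteq> topspace P" using Inv_subset topspace_P by simp
  let ?V = "\<lambda>(b, b'). {p \<in> Sphi. inst \<phi> ys b \<in> p} \<inter> {p \<in> Sphi. inst \<phi> ys b' \<notin> p}"
  let ?I = "{(b, b'). b \<in> Uy \<and> b' \<in> Uy \<and> tp L U A ys b = tp L U A ys b'}"
  have "topspace P - Inv = \<Union> (?V ` ?I)"
  proof (intro equalityI subsetI)
    fix p assume "p \<in> topspace P - Inv"
    then have "p \<in> Sphi" "\<not> (\<forall>b\<in>Uy. \<forall>b'\<in>Uy. tp L U A ys b = tp L U A ys b' \<longrightarrow>
     (inst \<phi> ys b \<in> p \<longleftrightarrow> inst \<phi> ys b' \<in> p))" using Inv_iff[of p] by (auto simp: topspace_P)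
    then obtain b b' where *: "p \<in> Sphi" "b \<in> Uy" "b' \<in> Uy" "tp L U A ys b = tp L U A ys b'"
      "inst \<phi> ys b \<in> p \<longleftrightarrow> inst \<phi> ys b' \<notin> p" by blast
    then have "p \<in> ?V (b, b') \<or> p \<in> ?V (b', b)" "(b, b') \<in> ?I" "(b', b) \<in> ?I" by auto
    then show "p \<in> \<Union> (?V ` ?I)" by blast
  qed (auto simp: topspace_P Inv_iff)
  moreover have "openin P (\<Union> (?V ` ?I))"
    using openin_P by (intro openin_Union) auto
  ultimately show "openin P (topspace P - Inv)" by simp
qed

lemma phi_types_eqI:
  assumes "p \<in> Sphi" "p' \<in> Sphi" "\<And>b. b \<in> Uy \<Longrightarrow> inst \<phi> ys b \<in> p \<longleftrightarrow> inst \<phi> ys b \<in> p'"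
  shows "p = p'"
proof (rule phi.types_eq_iff)
  fix \<psi> assume "\<psi> \<in> phi_formulas U \<phi> ys"
  then obtain b where "b \<in> Uy" "\<psi> = inst \<phi> ys b \<or> \<psi> = Neg (inst \<phi> ys b)"
    unfolding phi_formulas_def by blast
  then show "\<psi> \<in> p \<longleftrightarrow> \<psi> \<in> p'" using assms Neg_inst_iff by blast
qed (use assms Sphi_eq in auto)

text \<open>The formulas that belong to most types of the sequence form an invariant type again.\<close>

lemma cluster_point:
  assumes z: "range (z :: nat \<Rightarrow> _) \<subseteq> Inv"
  shows "\<exists>g\<in>Inv. \<forall>E. finite E \<and> E \<subseteq> Sy \<longrightarrow>
        (\<exists>\<^sub>F k in sequentially. \<forall>q\<in>E. decides (z k) q = decides g q)"
proof -
  obtain \<U> where \<U>: "\<U> \<le> sequentially" "ultra \<U>"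
    using ultrafilter_refinement[OF sequentially_bot] by blast
  have zI: "z k \<in> Inv" for k using z by blast
  then have zS: "z k \<in> Sphi" for k using Inv_subset by blast
  let ?\<Delta> = "phi_formulas U \<phi> ys"
  define g where "g = {\<psi> \<in> ?\<Delta>. \<forall>\<^sub>F k in \<U>. \<psi> \<in> z k}"
  have gS: "g \<in> Sphi"
    unfolding phi_types_def
  proof (rule max_consistentI)
    show "g \<subseteq> ?\<Delta>" by (auto simp: g_def)
    show "fin_sat U xs g"
      unfolding fin_sat_def
    proof (intro allI impI)
      fix F assume F: "finite F \<and> F \<subseteq> g"
      then have "\<forall>\<^sub>F k in \<U>. \<forall>\<psi>\<in>F. \<psi> \<in> z k"
        by (intro eventually_ball_finite) (auto simp: g_def)
      then obtain k where "F \<subseteq> z k" using ultra_ex[OF \<U>(2)] by blast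
      moreover have "fin_sat U xs (z k)" using zS by (simp add: phi_types_def max_consistent_def)
      ultimately show "\<exists>a\<in>Ux. \<forall>\<psi>\<in>F. sat (with_params U) (asg xs a) \<psi>"
        using F by (meson fin_satE)
    qed
    fix \<psi> assume \<psi>: "\<psi> \<in> ?\<Delta>" "\<psi> \<notin> g"
    obtain \<eta> where \<eta>: "\<eta> \<in> ?\<Delta>" "complementary U xs \<psi> \<eta>" using phi.complement[OF \<psi>(1)] by blast
    have "\<forall>\<^sub>F k in \<U>. \<psi> \<notin> z k" using \<psi> \<U>(2) by (simp add: g_def ultra_def)
    then have "\<forall>\<^sub>F k in \<U>. \<eta> \<in> z k"
      using max_consistent_decides[OF zS[unfolded phi_types_def] \<psi>(1) \<eta>] by simp
    then have "\<eta> \<in> g" using \<eta>(1) by (simp add: g_def)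
    then show "\<exists>\<eta>\<in>g. complementary U xs \<psi> \<eta>" using \<eta>(2) by blast
  qed
  have g_iff: "inst \<phi> ys b \<in> g \<longleftrightarrow> (\<forall>\<^sub>F k in \<U>. inst \<phi> ys b \<in> z k)" if "b \<in> Uy" for b
    using phi_formulasI[OF that] by (simp add: g_def)
  have gI: "g \<in> Inv"
    unfolding Inv_iff
  proof (intro conjI gS ballI impI)
    fix b b' assume "b \<in> Uy" "b' \<in> Uy" "tp L U A ys b = tp L U A ys b'"
    moreover from this have "inst \<phi> ys b \<in> z k \<longleftrightarrow> inst \<phi> ys b' \<in> z k" for k
      using zI[of k] unfolding Inv_iff by blast
    ultimately show "inst \<phi> ys b \<in> g \<longleftrightarrow> inst \<phi> ys b' \<in> g" using g_iff by simp
  qed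
  have "\<exists>\<^sub>F k in sequentially. \<forall>q\<in>E. decides (z k) q = decides g q"
    if E: "finite E" "E \<subseteq> Sy" for E
  proof -
    have "\<forall>\<^sub>F k in \<U>. decides (z k) q = decides g q" if q: "q \<in> E" for q
    proof -
      have qS: "q \<in> Sy" using q E(2) by blast
      obtain b where b: "b \<in> realizations U ys q" using realization_exists[OF qS] .
      then have bU: "b \<in> Uy" by (simp add: realizations_def)
      have "decides (z k) q \<longleftrightarrow> inst \<phi> ys b \<in> z k" for k using decides_iff[OF zI qS b] .
      moreover have "decides g q \<longleftrightarrow> (\<forall>\<^sub>F k in \<U>. inst \<phi> ys b \<in> z k)"
        using decides_iff[OF gI qS b] g_iff[OF bU] by simp
      ultimately show ?thesis
        using \<U>(2) unfolding ultra_def by (cases "decides g q") auto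
    qed
    then have "\<forall>\<^sub>F k in \<U>. \<forall>q\<in>E. decides (z k) q = decides g q"
      using E(1) by (intro eventually_ball_finite) auto
    then have "\<not> (\<forall>\<^sub>F k in \<U>. \<not> (\<forall>q\<in>E. decides (z k) q = decides g q))"
      using \<U>(2) unfolding ultra_def by blast
    then show ?thesis unfolding frequently_def using filter_leD[OF \<U>(1)] by blast
  qed
  then show ?thesis using gI by blast
qed

lemma limit_of_sequence:
  assumes Z: "Z \<subseteq> Inv" and p: "p \<in> P closure_of Z"
  shows "\<exists>s. range s \<subseteq> Z \<and> limitin P s p sequentially"
proof -
  have pI: "p \<in> Inv" using closure_of_minimal[OF Z closedin_Inv] p by blast
  then have pS: "p \<in> Sphi" using Inv_subset by blast
  have approx: "\<exists>z\<in>Z. \<forall>q\<in>E. decides z q = decides p q" if E: "finite E" "E \<subseteq> Sy" for E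
  proof -
    have "\<forall>q\<in>E. \<exists>b. b \<in> realizations U ys q" using realization_exists E(2) by (metis subsetD)
    then obtain b where b: "\<And>q. q \<in> E \<Longrightarrow> b q \<in> realizations U ys q" by metis
    then have bU: "b q \<in> Uy" if "q \<in> E" for q using that by (simp add: realizations_def)
    define V where "V q = {p' \<in> Sphi. inst \<phi> ys (b q) \<in> p' \<longleftrightarrow> inst \<phi> ys (b q) \<in> p}" for q
    have "openin P (V q)" if "q \<in> E" for q
      using openin_P[OF bU[OF that]] by (cases "inst \<phi> ys (b q) \<in> p") (simp_all add: V_def)
    then have "openin P (topspace P \<inter> \<Inter> (V ` E))"
      using E(1) by (intro openin_Int_Inter) auto
    moreover have "p \<in> topspace P \<inter> \<Inter> (V ` E)" using pS by (simp add: V_def topspace_P)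
    ultimately obtain z where z: "z \<in> Z" "z \<in> \<Inter> (V ` E)"
      using p unfolding in_closure_of by blast
    have "decides z q = decides p q" if "q \<in> E" for q
    proof -
      have "z \<in> V q" using z(2) that by blast
      moreover have "z \<in> Inv" "q \<in> Sy" using z(1) Z E(2) that by auto
      ultimately show ?thesis using decides_iff[OF _ _ b[OF that]] pI by (auto simp: V_def)
    qed
    then show ?thesis using z(1) by blast
  qed
  have "\<exists>C. C \<subseteq> Z \<and> countable C \<and>
    (\<forall>E. finite E \<and> E \<subseteq> topspace W \<longrightarrow> (\<exists>z\<in>C. \<forall>q\<in>E. decides z q = decides p q))"
  proof (rule countable_tightness[OF compact_W Hausdorff_W second_countable_W, where K = Inv])
    show "fsigma_in W {q \<in> topspace W. decides g q} \<and> gdelta_in W {q \<in> topspace W. decides g q}"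
      if "g \<in> Inv" for g
      using defining_set_ambiguous[OF that] by (simp add: topspace_W)
    show "\<exists>g\<in>Inv. \<forall>E. finite E \<and> E \<subseteq> topspace W \<longrightarrow>
        (\<exists>\<^sub>F k in sequentially. \<forall>q\<in>E. decides (z k) q = decides g q)"
      if "range z \<subseteq> Z" for z :: "nat \<Rightarrow> _"
      using cluster_point[of z] that Z by (simp add: topspace_W)
    show "p \<in> Inv" by (rule pI)
    show "\<exists>z\<in>Z. \<forall>q\<in>E. decides z q = decides p q" if "finite E" "E \<subseteq> topspace W" for E
      using approx that by (simp add: topspace_W)
  qed
  then obtain C where C: "C \<subseteq> Z" "countable C"
    "\<forall>E. finite E \<and> E \<subseteq> topspace W \<longrightarrow> (\<exists>z\<in>C. \<forall>q\<in>E. decides z q = decides p q)"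
    by (elim exE conjE)
  obtain d :: nat where d: "\<And>g. (\<And>i. i < d \<Longrightarrow> g i \<in> Inv) \<Longrightarrow>
     \<not> (\<forall>S\<in>Pow {..<d}. \<exists>q\<in>Sy. \<forall>i<d. decides (g i) q \<longleftrightarrow> i \<in> S)"
    using invariant_types_not_shattering by blast
  have "\<exists>s :: nat \<Rightarrow> _. range s \<subseteq> C \<and> (\<forall>q\<in>Sy. \<forall>\<^sub>F k in sequentially. decides (s k) q = decides p q)"
  proof (rule convergent_sequence_if_not_shattering[OF C(2), where d = d])
    show "\<not> (\<forall>S\<in>Pow {..<d}. \<exists>q\<in>Sy. \<forall>i<d. decides (g i) q \<longleftrightarrow> i \<in> S)"
      if "\<And>i. i < d \<Longrightarrow> g i \<in> C" for g
      by (rule d) (use that C(1) Z in blast)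
    show "\<exists>z\<in>C. \<forall>q\<in>E. decides z q = decides p q" if "finite E" "E \<subseteq> Sy" for E
      using C(3) that by (simp add: topspace_W)
  qed
  then obtain s :: "nat \<Rightarrow> _" where s: "range s \<subseteq> C"
    "\<forall>q\<in>Sy. \<forall>\<^sub>F k in sequentially. decides (s k) q = decides p q" by (elim exE conjE)
  have sI: "s k \<in> Inv" for k using s(1) C(1) Z by blast
  have "limitin P s p sequentially"
    unfolding phi_topology_eq
  proof (rule phi.limitin_types)
    show "p \<in> phi.types" using pS Sphi_eq by simp
    fix \<psi> assume \<psi>: "\<psi> \<in> phi_formulas U \<phi> ys" "\<psi> \<in> p"
    then obtain b where b: "b \<in> Uy" "\<psi> = inst \<phi> ys b \<or> \<psi> = Neg (inst \<phi> ys b)"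
      unfolding phi_formulas_def by blast
    have "\<forall>\<^sub>F k in sequentially. decides (s k) (tp L U A ys b) = decides p (tp L U A ys b)"
      using s(2) tp_complete(1)[OF b(1)] by blast
    then show "\<forall>\<^sub>F k in sequentially. s k \<in> phi.types \<and> \<psi> \<in> s k"
    proof (rule eventually_mono)
      fix k assume "decides (s k) (tp L U A ys b) = decides p (tp L U A ys b)"
      then have "inst \<phi> ys b \<in> s k \<longleftrightarrow> inst \<phi> ys b \<in> p"
        using decides_tp[OF sI b(1)] decides_tp[OF pI b(1)] by simp
      moreover have "s k \<in> Sphi" using sI Inv_subset by blast
      ultimately show "s k \<in> phi.types \<and> \<psi> \<in> s k"
        using b \<psi>(2) Neg_inst_iff[OF _ b(1)] pS Sphi_eq by auto
    qed
  qed
  moreover have "range s \<subseteq> Z" using s(1) C(1) by blast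
  ultimately show ?thesis by blast
qed

text \<open>Evaluation at the countably many formulas embeds \<open>S\<^sub>y(M)\<close> as a closed subspace \<open>X\<close> of a countable
  power of the reals, which is therefore Polish. An invariant type is sent to its value at each point
  of \<open>X\<close>. On the compact space of invariant types this map is continuous and injective, hence an
  embedding.\<close>

lemma rosenthal_compactum_Inv: "rosenthal_compactum (subtopology P Inv)"
proof -
  let ?K = "subtopology P Inv"
  let ?R = "powertop_real (UNIV :: nat set)"
  have topK: "topspace ?K = Inv" using Inv_subset topspace_P by auto
  have compK: "compact_space ?K"
    using closedin_Inv compact_P closedin_compact_space compact_space_subtopology by blast
  have HausK: "Hausdorff_space ?K" using Hausdorff_P by (rule Hausdorff_space_subtopology)
  have HausR: "Hausdorff_space (powertop_real I)" for I :: "'z set"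
    by (simp add: Hausdorff_space_product_topology)

  define e where "e q = (\<lambda>i::nat. of_bool (from_nat_into Form i \<in> q) :: real)" for q
  have Form_ne: "Form \<noteq> {}" using verum(1) by blast
  have contE: "continuous_map W ?R e"
    unfolding continuous_map_componentwise_UNIV
  proof
    fix i
    let ?\<psi> = "from_nat_into Form i"
    have \<psi>: "?\<psi> \<in> Form" using from_nat_into[OF Form_ne] .
    have "{q \<in> topspace W. ?\<psi> \<notin> q} = topspace W - {q \<in> Sy. ?\<psi> \<in> q}" by (auto simp: topspace_W)
    then have "openin W {q \<in> topspace W. ?\<psi> \<notin> q}" using closedin_W[OF \<psi>] by (simp add: closedin_def)
    moreover have "openin W {q \<in> topspace W. ?\<psi> \<in> q}" using openin_W[OF \<psi>] by (simp add: topspace_W)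
    ultimately show "continuous_map W euclideanreal (\<lambda>q. e q i)"
      unfolding e_def by (intro continuous_map_indicator)
  qed
  have injE: "inj_on e (topspace W)"
  proof (rule inj_onI)
    fix q q' assume q: "q \<in> topspace W" "q' \<in> topspace W" and eq: "e q = e q'"
    show "q = q'"
    proof (rule stone.types_eq_iff)
      show "q \<in> stone.types" "q' \<in> stone.types" using q by (auto simp: topspace_W Sy_eq)
      fix \<psi> assume "\<psi> \<in> Form"
      then obtain i where i: "from_nat_into Form i = \<psi>" using from_nat_into_surj[OF countable_Form] by blast
      have "e q i = e q' i" using eq by simp
      then show "\<psi> \<in> q \<longleftrightarrow> \<psi> \<in> q'" unfolding e_def i by (auto split: if_splits)
    qed
  qed
  have "closed_map W ?R e"
    using contE compact_W Hausdorff_imp_kc_space[OF HausR] by (intro continuous_imp_closed_map_gen)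
  then have embE: "embedding_map W ?R e" using injective_closed_imp_embedding_map contE injE by blast
  define X where "X = subtopology ?R (e ` topspace W)"
  have homE: "homeomorphic_map W X e" using embE by (simp add: embedding_map_def X_def)
  then obtain h where h: "homeomorphic_maps W X e h" unfolding homeomorphic_map_maps by blast
  then have hc: "continuous_map X W h" and he: "\<And>q. q \<in> Sy \<Longrightarrow> h (e q) = q"
    by (auto simp: homeomorphic_maps_def topspace_W)
  have X_hom: "W homeomorphic_space X" using h homeomorphic_space_def by blast
  have "polish_topology X"
    unfolding polish_topology_def
  proof
    have "completely_metrizable_space ?R"
      by (simp add: completely_metrizable_space_product_topology completely_metrizable_space_euclidean)
    moreover have "closedin ?R (e ` topspace W)"
      using \<open>closed_map W ?R e\<close> closedin_topspace unfolding closed_map_def by blast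
    ultimately show "completely_metrizable_space X" unfolding X_def by (rule completely_metrizable_space_closedin)
    have "second_countable X" using second_countable_W homeomorphic_space_second_countability X_hom by blast
    then show "separable_space X" by (rule second_countable_imp_separable_space)
  qed

  define \<Phi> where "\<Phi> p = restrict (\<lambda>c. of_bool (decides p (h c)) :: real) (topspace X)" for p
  have hS: "h c \<in> Sy" if "c \<in> topspace X" for c
    using continuous_map_image_subset_topspace[OF hc] that topspace_W by blast
  have normal: "normal_space W"
    using compact_W Hausdorff_W compact_Hausdorff_or_regular_imp_normal_space by blast
  have \<Phi>_baire: "\<Phi> p \<in> baire_one X" if "p \<in> Inv" for p
  proof -
    let ?f = "restrict (\<lambda>q. of_bool (q \<in> {q \<in> Sy. decides p q}) :: real) (topspace W)"
    have "?f \<in> baire_one W" using baire_one_indicator[OF normal] defining_set_ambiguous[OF that] by blast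
    then have "restrict (?f \<circ> h) (topspace X) \<in> baire_one X" using hc by (rule baire_one_compose)
    moreover have "restrict (?f \<circ> h) (topspace X) = \<Phi> p"
      unfolding \<Phi>_def by (rule restrict_ext) (simp add: hS topspace_W)
    ultimately show ?thesis by simp
  qed
  have cont\<Phi>: "continuous_map ?K (baire_one_topology X) \<Phi>"
    unfolding baire_one_topology_def continuous_map_in_subtopology continuous_map_componentwise
  proof (intro conjI ballI)
    show "\<Phi> ` topspace ?K \<subseteq> extensional (topspace X)" by (auto simp: \<Phi>_def)
    show "\<Phi> \<in> topspace ?K \<rightarrow> baire_one X" using \<Phi>_baire by (auto simp: topK)
    fix c assume c: "c \<in> topspace X"
    obtain b where b: "b \<in> realizations U ys (h c)" using realization_exists[OF hS[OF c]] .
    then have bU: "b \<in> Uy" by (simp add: realizations_def)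
    have "{p \<in> topspace ?K. inst \<phi> ys b \<in> p} = {p \<in> Sphi. inst \<phi> ys b \<in> p} \<inter> Inv"
      "{p \<in> topspace ?K. inst \<phi> ys b \<notin> p} = {p \<in> Sphi. inst \<phi> ys b \<notin> p} \<inter> Inv"
      using Inv_subset unfolding topK by auto
    then have "openin ?K {p \<in> topspace ?K. inst \<phi> ys b \<in> p}" "openin ?K {p \<in> topspace ?K. inst \<phi> ys b \<notin> p}"
      using openin_P[OF bU] unfolding openin_subtopology by blast+
    then have "continuous_map ?K euclideanreal (\<lambda>p. of_bool (inst \<phi> ys b \<in> p))"
      by (rule continuous_map_indicator)
    then show "continuous_map ?K euclideanreal (\<lambda>p. \<Phi> p c)"
      by (rule continuous_map_eq) (use decides_iff[OF _ hS[OF c] b] c in \<open>simp add: topK \<Phi>_def\<close>)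
  qed
  have inj\<Phi>: "inj_on \<Phi> (topspace ?K)"
  proof (rule inj_onI)
    fix p p' assume "p \<in> topspace ?K" "p' \<in> topspace ?K" and eq: "\<Phi> p = \<Phi> p'"
    then have p: "p \<in> Inv" "p' \<in> Inv" unfolding topK by auto
    show "p = p'"
    proof (rule phi_types_eqI)
      show "p \<in> Sphi" "p' \<in> Sphi" using p Inv_subset by auto
      fix b assume b: "b \<in> Uy"
      let ?q = "tp L U A ys b"
      have q: "?q \<in> Sy" using tp_complete(1)[OF b] .
      then have "e ?q \<in> topspace X"
        using homeomorphic_imp_surjective_map[OF homE] topspace_W by blast
      then have "decides p ?q \<longleftrightarrow> decides p' ?q"
        using fun_cong[OF eq, of "e ?q"] he[OF q] by (simp add: \<Phi>_def of_bool_eq_iff)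
      then show "inst \<phi> ys b \<in> p \<longleftrightarrow> inst \<phi> ys b \<in> p'" using decides_tp b p by blast
    qed
  qed
  have "Hausdorff_space (baire_one_topology X)"
    unfolding baire_one_topology_def using HausR by (rule Hausdorff_space_subtopology)
  then have "closed_map ?K (baire_one_topology X) \<Phi>"
    using cont\<Phi> compK Hausdorff_imp_kc_space by (intro continuous_imp_closed_map_gen) blast
  then have "embedding_map ?K (baire_one_topology X) \<Phi>"
    using cont\<Phi> inj\<Phi> by (intro injective_closed_imp_embedding_map)
  then show ?thesis
    unfolding rosenthal_compactum_def using compK HausK \<open>polish_topology X\<close> by blast
qed

end

theorem theorem0p1:
  fixes L :: "('f, 'r) language"
    and T :: "('f, 'r) fm set"
    and \<kappa> :: "'k rel"
    and U M :: "('f, 'r, 'u) struc"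
    and \<phi> :: "('f, 'r) fm"
    and xs ys :: "nat list"
  assumes "countable_language L"
    and "complete_theory L T"
    and "monster_model L T \<kappa> U"
    and "distinct (xs @ ys)"
    and "\<phi> \<in> formulas L (set (xs @ ys))"
    and "NIP U \<phi> xs ys"
    and "elementary_submodel L M U"
    and "countable (Dom M)"
  shows
    "(\<forall>p\<in>inv_phi_types L U (Dom M) \<phi> xs ys.
        borel_definable L U (Dom M) \<phi> xs ys p \<and>
        fsigma_in (stone_topology L U (Dom M) ys) (defining_set L U (Dom M) \<phi> xs ys p) \<and>
        gdelta_in (stone_topology L U (Dom M) ys) (defining_set L U (Dom M) \<phi> xs ys p)) \<and>
     rosenthal_compactum
       (subtopology (phi_topology U \<phi> xs ys) (inv_phi_types L U (Dom M) \<phi> xs ys)) \<and>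
     (\<forall>Z p. Z \<subseteq> inv_phi_types L U (Dom M) \<phi> xs ys \<and> p \<in> phi_topology U \<phi> xs ys closure_of Z \<longrightarrow>
        (\<exists>s. range s \<subseteq> Z \<and> limitin (phi_topology U \<phi> xs ys) s p sequentially))"
proof -
  have "Dom M \<subseteq> Dom U" using assms(7) by (simp add: elementary_submodel_def)
  then interpret countable_base L T \<kappa> U \<phi> xs ys "Dom M"
    using assms by unfold_locales
  show ?thesis
    using borel_definable_Inv defining_set_ambiguous rosenthal_compactum_Inv limit_of_sequence
    by (simp add: defining_set_eq)
qed

end
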